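(* Let $d\ge1$ be an integer, $0<s<2d$, and let $N$ be of the form $N=\binom{d+L}{d}$, $L\ge0$ an integer. Then, for every $\tau>0$ such that $\tau<1-\frac{1}{\sqrt d}$, $$\mathbb{E}_{\omega_N\sim\mathfrak{X}_*^{(N)}}\left[\mathcal{E}_s(\omega_N)\right]\le N^2V_s(\mathbb{S}^{2d})-\frac{N^2\,\mathrm{Vol}(\mathbb{S}^{2d-1})}{(2d-s)\,\mathrm{Vol}(\mathbb{S}^{2d})}\left(1-\frac{\tau^2}{4}\right)^{d-1}\tau^{2d-s}\left(1-\tau^2\frac{(1+\tau^2)^2}{1-\left(\frac{1}{\sqrt d}+\tau\right)^2}\right)^{L}\left(1-\frac{e^{-1+\frac{1}{2d}}}{2\sqrt{1-\frac{1}{2d}}}\right).$$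
   Context: Spheres $\mathbb{S}^m\subset\mathbb{R}^{m+1}$ carry their usual (unnormalized) surface measure, with total mass $\mathrm{Vol}(\mathbb{S}^m)$; $\mathbb{C}^d$ carries Lebesgue measure. For $\omega_N=\{x_1,\dots,x_N\}$ on a sphere, the Riesz $s$-energy is $\mathcal{E}_s(\omega_N)=\sum_{i\ne j}\|x_i-x_j\|^{-s}$, and $V_s(\mathbb{S}^m)=\frac{1}{\mathrm{Vol}(\mathbb{S}^m)^2}\int_{\mathbb{S}^m\times\mathbb{S}^m}\|p-q\|^{-s}\,dp\,dq$. A point process on a measure space $(\mathbb X,\mu)$ is determinantal (a DPP) with kernel $K$ if its joint intensities with respect to $\mu$ are $\rho_k(x_1,\dots,x_k)=\det(K(x_i,x_j))_{i,j=1}^k$ for all $k\ge1$. It is the projection DPP associated with an $N$-dimensional subspace of $L^2(\mathbb X,\mathbb C)$ if $K$ is the reproducing (projection) kernel of that subspace; it then has $N$ points almost surely. $\mathbb{C}^d\equiv\mathbb{R}^{2d}$ via $(z_1,\dots,z_d)\equiv(\mathrm{Re}\,z_1,\mathrm{Im}\,z_1,\dots,\mathrm{Re}\,z_d,\mathrm{Im}\,z_d)$. The stereographic projection is $\Pi_d(p)=\frac{1}{1-p_{2d+1}}(p_1,\dots,p_{2d})$ from $\mathbb{S}^{2d}\setminus\{(0,\dots,0,1)\}$ to $\mathbb{R}^{2d}$. Let $\mathrm{B}_x(a,b)=\int_0^x t^{a-1}(1-t)^{b-1}dt$ and $\mathrm{I}_x(a,b)=\mathrm{B}_x(a,b)/\mathrm{B}_1(a,b)$.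 The increasing function $g_d:(0,\infty)\to(0,\infty)$ is defined by $\mathrm{I}_{\frac{g_d(t)^2}{1+g_d(t)^2}}(d,d)=\left(\frac{t^2}{1+t^2}\right)^d$, and $\varphi_{g_d}(x)=g_d(\|x\|)\frac{x}{\|x\|}$ on $\mathbb{R}^{2d}\setminus\{0\}$. For $N=\binom{d+L}{d}$, let $\mathfrak{X}_{\mathcal H}$ be the projection DPP of $N$ points in $\mathbb{C}^d$ associated with the subspace of $L^2(\mathbb{C}^d,\mathbb{C})$ spanned by the functions $\frac{z_1^{\alpha_1}\cdots z_d^{\alpha_d}}{(1+\|z\|^2)^{(d+L+1)/2}}$, $\alpha_i\in\mathbb{Z}_{\ge0}$, $\alpha_1+\dots+\alpha_d\le L$. The process $\mathfrak{X}_*^{(N)}$ is the push-forward (image) of $\mathfrak{X}_{\mathcal H}$ under the map $\Pi_d^{-1}\circ\varphi_{g_d}$ into $\mathbb{S}^{2d}$.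
   Formalization: For even L≥2 the formal theorem also requires the base 1−τ²(1+τ²)²/(1−(1/√d+τ)²) of the L-th power to be nonnegative; without this the bound fails, e.g. d=4, L=2, s=4, τ=0.49 makes the right-hand side negative. *)

theory Defs
  imports "HOL-Probability.Probability" "HOL-Library.Function_Algebras"
begin

section \<open>Point processes\<close>

text \<open>A simple point process on \<open>\<mu>\<close> is a random locally finite subset of its space,
  defined on a probability space \<open>P\<close>.  The number of points in a set takes values in
  \<open>[0,\<infinity>]\<close>; it is the counting measure of the intersection.\<close>

definition num_points :: "'a set \<Rightarrow> 'a set \<Rightarrow> ennreal" where
  "num_points \<omega> A = emeasure (count_space UNIV) (\<omega> \<inter> A)"

definition point_process ::
  "'w measure \<Rightarrow> 'a::topological_space measure \<Rightarrow> ('w \<Rightarrow> 'a set) \<Rightarrow> bool" where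
  "point_process P \<mu> X \<longleftrightarrow>
     prob_space P \<and>
     (\<forall>w\<in>space P. X w \<subseteq> space \<mu> \<and> (\<forall>C. compact C \<longrightarrow> finite (X w \<inter> C))) \<and>
     (\<forall>A\<in>sets \<mu>. (\<lambda>w. num_points (X w) A) \<in> borel_measurable P)"

text \<open>\<open>\<rho>\<close> is the \<open>k\<close>-point joint intensity: it vanishes when two of the points coincide, and
  \<open>E[\<Prod>i. #(X \<inter> D i)] = \<integral> \<rho>\<close> over \<open>D 0 \<times> \<dots> \<times> D (k - 1)\<close> for mutually disjoint \<open>D i\<close>.
  A \<open>k\<close>-tuple of points is a function on \<open>{..<k}\<close>.\<close>

definition joint_intensity ::
  "'w measure \<Rightarrow> 'a measure \<Rightarrow> ('w \<Rightarrow> 'a set) \<Rightarrow> nat \<Rightarrow> ((nat \<Rightarrow> 'a) \<Rightarrow> real) \<Rightarrow> bool" where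
  "joint_intensity P \<mu> X k \<rho> \<longleftrightarrow>
     \<rho> \<in> borel_measurable (PiM {..<k} (\<lambda>_. \<mu>)) \<and>
     (\<forall>x\<in>space (PiM {..<k} (\<lambda>_. \<mu>)). 0 \<le> \<rho> x \<and> (\<not> inj_on x {..<k} \<longrightarrow> \<rho> x = 0)) \<and>
     (\<forall>D. (\<forall>i<k. D i \<in> sets \<mu>) \<and> disjoint_family_on D {..<k} \<longrightarrow>
        (\<integral>\<^sup>+ w. (\<Prod>i<k. num_points (X w) (D i)) \<partial>P) =
        (\<integral>\<^sup>+ x. ennreal (\<rho> x) * indicator (Pi\<^sub>E {..<k} D) x \<partial>(PiM {..<k} (\<lambda>_. \<mu>))))"

text \<open>Leibniz formula, since the size \<open>k\<close> of the matrix is not fixed by a type.\<close>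

definition kernel_det :: "('a \<Rightarrow> 'a \<Rightarrow> complex) \<Rightarrow> nat \<Rightarrow> (nat \<Rightarrow> 'a) \<Rightarrow> complex" where
  "kernel_det K k x =
     (\<Sum>p | p permutes {..<k}. of_int (sign p) * (\<Prod>i<k. K (x i) (x (p i))))"

definition determinantal ::
  "'w measure \<Rightarrow> 'a::topological_space measure \<Rightarrow> ('a \<Rightarrow> 'a \<Rightarrow> complex) \<Rightarrow> ('w \<Rightarrow> 'a set) \<Rightarrow> bool" where
  "determinantal P \<mu> K X \<longleftrightarrow>
     point_process P \<mu> X \<and>
     (\<forall>k\<ge>1. \<exists>\<rho>. joint_intensity P \<mu> X k \<rho> \<and>
        (\<forall>x\<in>space (PiM {..<k} (\<lambda>_. \<mu>)). complex_of_real (\<rho> x) = kernel_det K k x))"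

section \<open>Reproducing kernels and projection processes\<close>

interpretation cfun: vector_space "\<lambda>(c::complex) (f::'a \<Rightarrow> complex) x. c * f x"
  by unfold_locales (auto simp: fun_eq_iff algebra_simps)

text \<open>Subspaces of \<open>L\<^sup>2\<close> are given by spaces of genuine functions, not of classes modulo null
  sets, so that the kernel is determined pointwise.\<close>

definition square_integrable :: "'a measure \<Rightarrow> ('a \<Rightarrow> complex) \<Rightarrow> bool" where
  "square_integrable \<mu> f \<longleftrightarrow> f \<in> borel_measurable \<mu> \<and> integrable \<mu> (\<lambda>x. (cmod (f x))\<^sup>2)"

definition finite_dim_L2_subspace :: "'a measure \<Rightarrow> ('a \<Rightarrow> complex) set \<Rightarrow> bool" where
  "finite_dim_L2_subspace \<mu> H \<longleftrightarrow>
     (\<exists>B. finite B \<and> H = cfun.span B) \<and> (\<forall>f\<in>H. square_integrable \<mu> f)"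

definition reproducing_kernel ::
  "'a measure \<Rightarrow> ('a \<Rightarrow> complex) set \<Rightarrow> ('a \<Rightarrow> 'a \<Rightarrow> complex) \<Rightarrow> bool" where
  "reproducing_kernel \<mu> H K \<longleftrightarrow>
     (\<forall>y\<in>space \<mu>. (\<lambda>x. K x y) \<in> H) \<and>
     (\<forall>f\<in>H. \<forall>y\<in>space \<mu>. f y = (\<integral>x. f x * cnj (K x y) \<partial>\<mu>))"

definition projection_dpp ::
  "'w measure \<Rightarrow> 'a::topological_space measure \<Rightarrow> ('a \<Rightarrow> complex) set \<Rightarrow> ('w \<Rightarrow> 'a set) \<Rightarrow> bool" where
  "projection_dpp P \<mu> H X \<longleftrightarrow>
     finite_dim_L2_subspace \<mu> H \<and>
     (\<exists>K. reproducing_kernel \<mu> H K \<and> determinantal P \<mu> K X)"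

text \<open>The dimension \<open>d\<close> is \<open>CARD('n)\<close>.\<close>

definition weighted_monomial :: "nat \<Rightarrow> ('n::finite \<Rightarrow> nat) \<Rightarrow> complex ^ 'n \<Rightarrow> complex" where
  "weighted_monomial L \<alpha> z =
     (\<Prod>i\<in>UNIV. (z $ i) ^ \<alpha> i) /
     complex_of_real ((1 + (norm z)\<^sup>2) powr (real (CARD('n) + L + 1) / 2))"

definition weighted_polynomials :: "nat \<Rightarrow> (complex ^ 'n::finite \<Rightarrow> complex) set" where
  "weighted_polynomials L = cfun.span {weighted_monomial L \<alpha> | \<alpha>. (\<Sum>i\<in>UNIV. \<alpha> i) \<le> L}"

section \<open>Spheres and Riesz energies\<close>

text \<open>Surface measure of the unit sphere \<open>S\<close> of a Euclidean space of dimension \<open>n\<close>, via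
  polar coordinates: \<open>\<sigma>(A) = n * |{t * x | x \<in> A, 0 < t < 1}|\<close> for Borel \<open>A \<subseteq> S\<close>.
  Recall that \<open>sgn x = x /\<^sub>R norm x\<close>.\<close>

definition sphere_measure :: "'a::euclidean_space measure" where
  "sphere_measure =
     scale_measure (of_nat DIM('a))
       (distr (restrict_space lborel (ball 0 1 - {0})) (restrict_space borel (sphere 0 1)) sgn)"

definition sphere_vol :: "'a::euclidean_space itself \<Rightarrow> real" where
  "sphere_vol _ = measure (sphere_measure :: 'a measure) (sphere 0 1)"

definition continuous_energy :: "'a::euclidean_space itself \<Rightarrow> real \<Rightarrow> real" where
  "continuous_energy _ s =
     1 / (sphere_vol TYPE('a))\<^sup>2 *
     (\<integral>(p, q). norm (p - q) powr (- s) \<partial>((sphere_measure :: 'a measure) \<Otimes>\<^sub>M sphere_measure))"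

text \<open>Only meant for finite configurations.\<close>

definition riesz_energy :: "real \<Rightarrow> 'a::real_normed_vector set \<Rightarrow> real" where
  "riesz_energy s \<omega> = (\<Sum>x\<in>\<omega>. \<Sum>y\<in>\<omega> - {x}. norm (x - y) powr (- s))"

section \<open>The map to the sphere\<close>

text \<open>\<open>\<real>\<^sup>2\<^sup>d\<close> is identified with \<open>\<complex>\<^sup>d\<close>, which is \<open>complex ^ 'n\<close>, and \<open>\<real>\<^sup>2\<^sup>d\<^sup>+\<^sup>1\<close> with
  \<open>(complex ^ 'n) \<times> real\<close>, whose last coordinate is the second component; both identifications
  are isometric.  So \<open>S\<^sup>2\<^sup>d\<^sup>-\<^sup>1\<close> is the unit sphere of \<open>complex ^ 'n\<close> and \<open>S\<^sup>2\<^sup>d\<close> that of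
  \<open>(complex ^ 'n) \<times> real\<close>.\<close>

definition stereographic :: "(complex ^ 'n::finite) \<times> real \<Rightarrow> complex ^ 'n" where
  "stereographic p = (1 / (1 - snd p)) *\<^sub>R fst p"

definition inverse_stereographic :: "complex ^ 'n::finite \<Rightarrow> (complex ^ 'n) \<times> real" where
  "inverse_stereographic = the_inv_into (sphere 0 1 - {(0, 1)}) stereographic"

definition incomplete_Beta :: "real \<Rightarrow> real \<Rightarrow> real \<Rightarrow> real" where
  "incomplete_Beta x a b = integral {0..x} (\<lambda>t. t powr (a - 1) * (1 - t) powr (b - 1))"

definition regularized_Beta :: "real \<Rightarrow> real \<Rightarrow> real \<Rightarrow> real" where
  "regularized_Beta x a b = incomplete_Beta x a b / incomplete_Beta 1 a b"

definition g_fun :: "nat \<Rightarrow> real \<Rightarrow> real" where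
  "g_fun d t = (THE u. u > 0 \<and>
     regularized_Beta (u\<^sup>2 / (1 + u\<^sup>2)) (real d) (real d) = (t\<^sup>2 / (1 + t\<^sup>2)) ^ d)"

text \<open>The value at \<open>0\<close>, where the map is not defined on paper, is \<open>0\<close> here; the processes
  considered have no point at \<open>0\<close> almost surely.\<close>

definition radial_map :: "(real \<Rightarrow> real) \<Rightarrow> complex ^ 'n::finite \<Rightarrow> complex ^ 'n" where
  "radial_map g x = g (norm x) *\<^sub>R (x /\<^sub>R norm x)"

definition pushforward_process :: "('a \<Rightarrow> 'b) \<Rightarrow> ('w \<Rightarrow> 'a set) \<Rightarrow> 'w \<Rightarrow> 'b set" where
  "pushforward_process F X w = F ` X w"

definition to_sphere :: "complex ^ 'n::finite \<Rightarrow> (complex ^ 'n) \<times> real" where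
  "to_sphere = inverse_stereographic \<circ> radial_map (g_fun CARD('n))"

end

theory Submission
  imports Defs "HOL-Real_Asymp.Real_Asymp"
begin

text \<open>The map to the sphere carries the one-point intensity to the uniform measure, so the expected
  energy is \<open>N\<^sup>2 V\<^sub>s\<close> minus the integral of the squared kernel against the Riesz kernel, and a lower bound
  for this correlation term is needed.  The normalised squared kernel is \<open>\<rho> ^ L\<close>, where \<open>\<rho>\<close> is the squared
  cosine of the Fubini-Study distance.  On the part of the sphere where the last coordinate is at most \<open>T < 1\<close>
  one has \<open>\<rho> \<ge> 1 - \<parallel>p - q\<parallel>\<^sup>2 / (1 - T\<^sup>2)\<close>: the comparison of the polar angles of the sphere and of projective
  space is a contraction, and the angular directions are stretched at most by \<open>1 / sqrt (1 - T\<^sup>2)\<close>.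
  It remains to integrate over the points \<open>p\<close> of height at most \<open>1 / sqrt d\<close>, whose complement has small measure,
  and over the cap of radius \<open>\<tau>\<close> around \<open>p\<close>, with \<open>T = 1 / sqrt d + \<tau>\<close>.

  The kernel is identified by integration by parts: Wirtinger derivatives remove one factor \<open>z\<^sub>i\<close> of a
  monomial against one factor of the kernel, which proves the reproducing property by induction on the
  degree, without computing the norms of the monomials.\<close>

section \<open>Haar measure and polar coordinates\<close>

text \<open>The delicate point is to have the contraction in every dimension. Let \<open>F\<close>
  be the distribution function of the height on the sphere, \<open>W\<close> the full slice integral
  and \<open>c = 1 / (2 * d * W)\<close>. The contraction follows from
  \<open>c^2 * (1 - t^2)^(2 * d - 1) \<le> n^(4 * d - 2) * (1 - n^2)\<close> whenever
  \<open>n^(2 * d) = F t\<close>. To get this uniformly in \<open>d\<close>, \<open>F\<close> is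
  squeezed between multiples of \<open>(1 - t^2)^d\<close> with the right order at
  \<open>t = -1\<close>, and a recursion for \<open>W\<close> gives
  \<open>d * c^2 \<le> 1 / 12\<close>.

  Joint intensities only speak of products of disjoint sets, while the energy sums a singular
  function over all pairs of distinct points. The pair formula is therefore extended to all
  nonnegative Borel functions, and the computation stays in \<open>ennreal\<close> until the energy
  of the sphere is known to be finite, because the correlation term has to be subtracted.

  The base of the power \<open>L\<close> in the bound may be negative. For odd \<open>L\<close> the
  claim is then weaker than nonnegativity of the correlation term; otherwise the base must be
  nonnegative, or \<open>L = 0\<close>, for the pointwise bound to be raised to that power.\<close>

lemma nn_integral_lborel_translate:
  fixes f :: "'a::euclidean_space \<Rightarrow> ennreal"
  assumes [measurable]: "f \<in> borel_measurable borel"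
  shows "(\<integral>\<^sup>+x. f (a + x) \<partial>lborel) = (\<integral>\<^sup>+x. f x \<partial>lborel)"
proof -
  have "(\<integral>\<^sup>+x. f x \<partial>lborel) = (\<integral>\<^sup>+x. f x \<partial>distr lborel borel ((+) a))"
    by (simp add: lborel_distr_plus)
  also have "\<dots> = (\<integral>\<^sup>+x. f (a + x) \<partial>lborel)"
    by (subst nn_integral_distr) auto
  finally show ?thesis by simp
qed

text \<open>Uniqueness of Haar measure: evaluating the convolution \<open>\<integral>\<integral> 1\<^sub>A(x) 1\<^sub>B(x + y) dx d\<nu>(y)\<close> in
  both orders, for the image measure \<open>\<nu>\<close> and the unit ball \<open>A\<close>.\<close>

lemma lborel_distr_linear_isometry:
  fixes f :: "'a::euclidean_space \<Rightarrow> 'a"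
  assumes f: "linear f" and nf: "\<And>x. norm (f x) = norm x"
  shows "distr lborel borel f = lborel"
proof -
  have [measurable]: "f \<in> borel_measurable borel"
    by (intro borel_measurable_continuous_onI linear_continuous_on linear_conv_bounded_linear[THEN iffD1] f)
  define \<nu> where "\<nu> = distr lborel borel f"
  have [measurable_cong, simp]: "sets \<nu> = sets borel" "space \<nu> = UNIV"
    by (auto simp: \<nu>_def)
  have surj: "surj f"
  proof -
    have "inj f" unfolding linear_injective_0[OF f]
      by (metis nf norm_eq_zero)
    thus ?thesis using f linear_injective_imp_surjective by blast
  qed
  \<comment> \<open>Uniqueness of Haar measure leaves one scalar open; it is 1 because
    \<open>f\<close> preserves balls about the origin.\<close>
  have ball: "emeasure \<nu> (ball (0::'a) r) = emeasure lborel (ball (0::'a) r)" for r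
  proof -
    have "f -` ball (0::'a) r = ball 0 r" by (auto simp: nf)
    thus ?thesis unfolding \<nu>_def by (subst emeasure_distr) auto
  qed
  \<comment> \<open>The image measure is again translation invariant: \<open>f\<close> is onto, so a
    shift by \<open>x = f x'\<close> is a shift of the argument of \<open>f\<close> by
    \<open>x'\<close>.\<close>
  have trans: "(\<integral>\<^sup>+y. g (x + y) \<partial>\<nu>) = (\<integral>\<^sup>+y. g y \<partial>\<nu>)"
    if [measurable]: "g \<in> borel_measurable borel" for g :: "'a \<Rightarrow> ennreal" and x
  proof -
    obtain x' where x': "x = f x'" using surj by (metis surjD)
    have "(\<integral>\<^sup>+y. g (x + y) \<partial>\<nu>) = (\<integral>\<^sup>+y. g (f (x' + y)) \<partial>lborel)"
      unfolding \<nu>_def by (subst nn_integral_distr) (auto simp: x' linear_add[OF f])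
    also have "\<dots> = (\<integral>\<^sup>+y. g (f y) \<partial>lborel)"
      by (rule nn_integral_lborel_translate[of "\<lambda>y. g (f y)"]) simp
    also have "\<dots> = (\<integral>\<^sup>+y. g y \<partial>\<nu>)"
      unfolding \<nu>_def by (subst nn_integral_distr) auto
    finally show ?thesis .
  qed
  interpret \<nu>: sigma_finite_measure \<nu>
  proof (rule sigma_finite_measure.intro, intro exI conjI)
    let ?A = "range (\<lambda>n::nat. ball (0::'a) (real n))"
    show "countable ?A" "?A \<subseteq> sets \<nu>" by auto
    show "\<Union>?A = space \<nu>"
      using reals_Archimedean2 by (auto simp: dist_norm)
    show "\<forall>a\<in>?A. emeasure \<nu> a \<noteq> \<infinity>"
      using emeasure_lborel_ball_finite by (auto simp: ball less_top)
  qed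
  interpret P: pair_sigma_finite "lborel::'a measure" \<nu> ..
  let ?b = "ball (0::'a) 1"
  have "emeasure \<nu> B = emeasure lborel B" if [measurable]: "B \<in> sets borel" for B
  proof -
    have [measurable]: "?b \<in> sets borel" by simp
    have "emeasure lborel ?b * emeasure \<nu> B = (\<integral>\<^sup>+x. indicator ?b x * (\<integral>\<^sup>+y. indicator B (x + y) \<partial>\<nu>) \<partial>lborel)"
      by (subst trans) (auto simp: nn_integral_multc)
    also have "\<dots> = (\<integral>\<^sup>+x. \<integral>\<^sup>+y. indicator ?b x * indicator B (x + y) \<partial>\<nu> \<partial>lborel)"
      by (subst nn_integral_cmult) auto
    also have "\<dots> = (\<integral>\<^sup>+y. \<integral>\<^sup>+x. indicator ?b x * indicator B (x + y) \<partial>lborel \<partial>\<nu>)"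
      by (subst P.Fubini') auto
    also have "\<dots> = (\<integral>\<^sup>+y. \<integral>\<^sup>+x. indicator ?b (x - y) * indicator B x \<partial>lborel \<partial>\<nu>)"
    proof (rule nn_integral_cong)
      fix y
      show "(\<integral>\<^sup>+x. indicator ?b x * indicator B (x + y) \<partial>lborel) = (\<integral>\<^sup>+x. indicator ?b (x - y) * indicator B x \<partial>lborel)"
        using nn_integral_lborel_translate[of "\<lambda>x. indicator ?b (x - y) * indicator B x" y]
        by (simp add: add.commute)
    qed
    also have "\<dots> = (\<integral>\<^sup>+x. \<integral>\<^sup>+y. indicator ?b (x - y) * indicator B x \<partial>\<nu> \<partial>lborel)"
      by (subst P.Fubini') auto
    also have "\<dots> = (\<integral>\<^sup>+x. indicator B x * (\<integral>\<^sup>+y. indicator ?b (x - y) \<partial>\<nu>) \<partial>lborel)"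
      by (subst nn_integral_cmult[symmetric]) (auto simp: mult.commute)
    also have "\<dots> = (\<integral>\<^sup>+x. indicator B x * (\<integral>\<^sup>+y. indicator ?b y \<partial>\<nu>) \<partial>lborel)"
    proof -
      have "(\<integral>\<^sup>+y. indicator ?b (x - y) \<partial>\<nu>) = (\<integral>\<^sup>+y. indicator ?b y \<partial>\<nu>)" for x
      proof -
        have "indicator ?b (x - y) = (indicator ?b (- x + y) :: ennreal)" for y
          by (auto simp: indicator_def norm_minus_commute)
        thus ?thesis using trans[of "indicator ?b" "- x"] by simp
      qed
      thus ?thesis by simp
    qed
    also have "\<dots> = emeasure lborel B * emeasure lborel ?b"
      by (simp add: nn_integral_multc ball)
    finally have "emeasure lborel ?b * emeasure \<nu> B = emeasure lborel ?b * emeasure lborel B"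
      by (simp add: mult.commute)
    moreover have "emeasure lborel ?b \<noteq> 0" "emeasure lborel ?b \<noteq> \<infinity>"
      using content_ball_gt_0_iff[of "0::'a" 1] emeasure_lborel_ball_finite[of "0::'a" 1]
      by (auto simp: measure_def less_top)
    ultimately show ?thesis
      by (simp add: ennreal_mult_cancel_left)
  qed
  thus ?thesis unfolding \<nu>_def[symmetric]
    by (intro measure_eqI) auto
qed

lemma nn_integral_lborel_scale:
  fixes f :: "'a::euclidean_space \<Rightarrow> ennreal"
  assumes [measurable]: "f \<in> borel_measurable borel" and c: "c > 0"
  shows "(\<integral>\<^sup>+x. f (c *\<^sub>R x) \<partial>lborel) = ennreal ((1 / c) ^ DIM('a)) * (\<integral>\<^sup>+x. f x \<partial>lborel)"
proof -
  have "(\<integral>\<^sup>+x. f (c *\<^sub>R x) \<partial>lborel) =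
    (\<integral>\<^sup>+x. f (c *\<^sub>R x) \<partial>density (distr lborel borel (\<lambda>x. 0 + (1/c) *\<^sub>R x)) (\<lambda>_. \<bar>1/c\<bar>^DIM('a)))"
    by (subst lborel_affine[of "1/c" 0]) (use c in auto)
  also have "\<dots> = (\<integral>\<^sup>+x. ennreal ((1 / c) ^ DIM('a)) * f x \<partial>lborel)"
    using c by (subst nn_integral_density) (auto simp: nn_integral_distr)
  finally show ?thesis by (simp add: nn_integral_cmult)
qed

section \<open>Surface measure of the unit sphere\<close>

abbreviation sphere_space :: "'a::euclidean_space measure" where
  "sphere_space \<equiv> restrict_space borel (sphere 0 1)"

lemma sets_sphere_measure [simp, measurable_cong]:
  "sets (sphere_measure :: 'a::euclidean_space measure) = sets sphere_space"
  by (simp add: sphere_measure_def)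

lemma space_sphere_measure [simp]:
  "space (sphere_measure :: 'a::euclidean_space measure) = sphere 0 1"
  by (simp add: sphere_measure_def space_scale_measure space_restrict_space)

lemma borel_measurable_sphere_measureI:
  "f \<in> borel_measurable borel \<Longrightarrow> f \<in> borel_measurable (sphere_measure :: 'a::euclidean_space measure)"
  unfolding measurable_cong_sets[OF sets_sphere_measure refl]
  by (rule measurable_restrict_space1)

lemma measurable_sgn_sphere:
  "sgn \<in> restrict_space lborel (ball 0 1 - {0}) \<rightarrow>\<^sub>M (sphere_space :: 'a::euclidean_space measure)"
  by (intro measurable_restrict_space2 measurable_restrict_space1)
     (auto simp: space_restrict_space norm_sgn)

lemma nn_integral_sphere:
  fixes f :: "'a::euclidean_space \<Rightarrow> ennreal"
  assumes [measurable]: "f \<in> borel_measurable borel"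
  shows "(\<integral>\<^sup>+u. f u \<partial>sphere_measure) =
    of_nat DIM('a) * (\<integral>\<^sup>+x. indicator (ball 0 1 - {0}) x * f (sgn x) \<partial>lborel)"
proof -
  have f: "f \<in> borel_measurable sphere_space"
    by (rule measurable_restrict_space1) simp
  show ?thesis
    unfolding sphere_measure_def
    by (subst nn_integral_scale_measure)
       (auto simp: f nn_integral_distr[OF measurable_sgn_sphere] nn_integral_restrict_space mult.commute)
qed

lemma emeasure_sphere_measure_space:
  "emeasure (sphere_measure :: 'a::euclidean_space measure) (sphere 0 1) =
    of_nat DIM('a) * emeasure lborel (ball (0::'a) 1)"
proof -
  have "emeasure (sphere_measure :: 'a measure) (sphere 0 1) = (\<integral>\<^sup>+u. 1 \<partial>(sphere_measure :: 'a measure))"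
    by simp
  also have "\<dots> = of_nat DIM('a) * emeasure lborel (ball (0::'a) 1 - {0})"
    by (subst nn_integral_sphere) auto
  also have "emeasure lborel (ball (0::'a) 1 - {0}) = emeasure lborel (ball (0::'a) 1)"
    by (rule emeasure_Diff_null_set) auto
  finally show ?thesis .
qed

lemma finite_measure_sphere_measure: "finite_measure (sphere_measure :: 'a::euclidean_space measure)"
  using emeasure_lborel_ball_finite[of "0::'a" 1]
  by (intro finite_measureI)
     (auto simp: emeasure_sphere_measure_space ennreal_mult_eq_top_iff less_top)

lemma sphere_vol_pos: "sphere_vol TYPE('a::euclidean_space) > 0"
proof -
  have "sphere_vol TYPE('a) = DIM('a) * measure lborel (ball (0::'a) 1)"
    unfolding sphere_vol_def measure_def emeasure_sphere_measure_space
    by (simp add: enn2real_mult)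
  thus ?thesis using content_ball_gt_0_iff[of "0::'a" 1]
    by (simp add: measure_completion)
qed

lemma emeasure_sphere_vol:
  "emeasure (sphere_measure :: 'a::euclidean_space measure) (sphere 0 1) = ennreal (sphere_vol TYPE('a))"
  unfolding sphere_vol_def
  by (rule finite_measure.emeasure_eq_measure[OF finite_measure_sphere_measure])

text \<open>Integrates out the auxiliary radius in \<open>nn_integral_polar\<close>.\<close>

lemma nn_integral_inverse_power:
  assumes "a > 0" and "n > 0"
  shows "(\<integral>\<^sup>+r. ennreal (1 / r ^ Suc n) * indicator {a<..} r \<partial>lborel) = ennreal (1 / (n * a ^ n))"
proof -
  have "(\<integral>\<^sup>+r. ennreal (1 / r ^ Suc n) * indicator {a<..} r \<partial>lborel) =
     (\<integral>\<^sup>+r. ennreal (1 / r ^ Suc n) * indicator {a..} r \<partial>lborel)"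
    by (rule nn_integral_cong_AE, rule AE_mp[OF AE_lborel_singleton[of a]])
       (auto split: split_indicator)
  also have "\<dots> = ennreal (0 - (- (1 / (n * a ^ n))))"
  proof (rule nn_integral_FTC_atLeast[where F = "\<lambda>r. - (1 / (n * r ^ n))" and T = 0])
    show "DERIV (\<lambda>r. - (1 / (n * r ^ n))) x :> 1 / x ^ Suc n" if "a \<le> x" for x
    proof -
      have x: "x > 0" using that assms by simp
      have "DERIV (\<lambda>r. - (1 / (n * r ^ n))) x :> (n * (n * x ^ (n - 1))) / (n * x ^ n)\<^sup>2"
        using x assms by (auto intro!: derivative_eq_intros simp: power2_eq_square)
      also have "(n * (n * x ^ (n - 1))) / (n * x ^ n)\<^sup>2 = 1 / x ^ Suc n"
        using x power_minus_mult[OF assms(2), of x, symmetric] assms(2)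
        by (simp add: power2_eq_square divide_simps)
      finally show ?thesis .
    qed
    show "((\<lambda>r::real. - (1 / (n * r ^ n))) \<longlongrightarrow> 0) at_top"
      using assms(2) by real_asymp
  qed (use assms in auto)
  finally show ?thesis by simp
qed

text \<open>The sphere measure is defined by the cone over a set, so the right-hand side is an
  integral over \<open>x\<close> in the ball and a radius \<open>r\<close>. Replacing
  \<open>r\<close> by \<open>norm x * r\<close> removes the direction \<open>sgn x\<close>; after
  Fubini the substitution \<open>y = r * x\<close> leaves the region \<open>norm y < r\<close>, and
  the integral over \<open>r\<close> produces the factor \<open>1 / n\<close> that cancels the
  \<open>n\<close> in the definition.\<close>

lemma nn_integral_polar:
  fixes f :: "'a::euclidean_space \<Rightarrow> ennreal"
  assumes [measurable]: "f \<in> borel_measurable borel"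
  shows "(\<integral>\<^sup>+x. f x \<partial>lborel) =
    (\<integral>\<^sup>+u. \<integral>\<^sup>+r. ennreal (r ^ (DIM('a) - 1)) * indicator {0<..} r * f (r *\<^sub>R u) \<partial>lborel \<partial>sphere_measure)"
    (is "?L = ?R")
proof -
  let ?n = "DIM('a)"
  have n: "?n > 0" by simp
  have pw: "x * x ^ (?n - 1) = x ^ ?n" for x :: real
    using power_minus_mult[OF n, of x] by (simp add: mult.commute)
  let ?b = "ball (0::'a) 1 - {0}"
  have [measurable]: "?b \<in> sets borel" by simp
  have "?R = of_nat ?n * (\<integral>\<^sup>+x. indicator ?b x * (\<integral>\<^sup>+r. ennreal (r ^ (?n - 1)) * indicator {0<..} r * f (r *\<^sub>R sgn x) \<partial>lborel) \<partial>lborel)"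
    by (subst nn_integral_sphere) auto
  also have "(\<integral>\<^sup>+x. indicator ?b x * (\<integral>\<^sup>+r. ennreal (r ^ (?n - 1)) * indicator {0<..} r * f (r *\<^sub>R sgn x) \<partial>lborel) \<partial>lborel) =
    (\<integral>\<^sup>+x. \<integral>\<^sup>+r. indicator ?b x * (ennreal (norm x ^ ?n * r ^ (?n - 1)) * indicator {0<..} r * f (r *\<^sub>R x)) \<partial>lborel \<partial>lborel)"
  proof (rule nn_integral_cong)
    fix x :: 'a
    show "indicator ?b x * (\<integral>\<^sup>+r. ennreal (r ^ (?n - 1)) * indicator {0<..} r * f (r *\<^sub>R sgn x) \<partial>lborel) =
      (\<integral>\<^sup>+r. indicator ?b x * (ennreal (norm x ^ ?n * r ^ (?n - 1)) * indicator {0<..} r * f (r *\<^sub>R x)) \<partial>lborel)"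
    proof (cases "x = 0")
      case False
      have "(\<integral>\<^sup>+r. ennreal (r ^ (?n - 1)) * indicator {0<..} r * f (r *\<^sub>R sgn x) \<partial>lborel) =
        ennreal (norm x) * (\<integral>\<^sup>+r. ennreal ((norm x * r) ^ (?n - 1)) * indicator {0<..} (norm x * r) * f ((norm x * r) *\<^sub>R sgn x) \<partial>lborel)"
        using nn_integral_real_affine[of "\<lambda>r. ennreal (r ^ (?n - 1)) * indicator {0<..} r * f (r *\<^sub>R sgn x)" "norm x" 0] False
        by simp
      also have "\<dots> = (\<integral>\<^sup>+r. ennreal (norm x) * (ennreal ((norm x * r) ^ (?n - 1)) * indicator {0<..} (norm x * r) * f ((norm x * r) *\<^sub>R sgn x)) \<partial>lborel)"
        by (subst nn_integral_cmult) auto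
      also have "\<dots> = (\<integral>\<^sup>+r. ennreal (norm x ^ ?n * r ^ (?n - 1)) * indicator {0<..} r * f (r *\<^sub>R x) \<partial>lborel)"
      proof (rule nn_integral_cong)
        fix r :: real
        have "ennreal (norm x) * ennreal ((norm x * r) ^ (?n - 1)) = ennreal (norm x ^ ?n * r ^ (?n - 1))"
          if "r > 0"
        proof -
          have "ennreal (norm x) * ennreal ((norm x * r) ^ (?n - 1)) = ennreal (norm x * (norm x * r) ^ (?n - 1))"
            using that by (subst ennreal_mult[symmetric]) auto
          also have "norm x * (norm x * r) ^ (?n - 1) = norm x ^ ?n * r ^ (?n - 1)"
            by (simp only: power_mult_distrib mult.assoc[symmetric] pw)
          finally show ?thesis .
        qed
        moreover have "(norm x * r) *\<^sub>R sgn x = r *\<^sub>R x"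
          using False by (simp add: sgn_div_norm)
        ultimately show "ennreal (norm x) * (ennreal ((norm x * r) ^ (?n - 1)) * indicator {0<..} (norm x * r) * f ((norm x * r) *\<^sub>R sgn x)) =
           ennreal (norm x ^ ?n * r ^ (?n - 1)) * indicator {0<..} r * f (r *\<^sub>R x)"
          using False by (auto simp: indicator_def zero_less_mult_iff mult.assoc[symmetric])
      qed
      finally show ?thesis by (subst nn_integral_cmult) auto
    qed auto
  qed
  also have "\<dots> = (\<integral>\<^sup>+r. \<integral>\<^sup>+x. indicator ?b x * (ennreal (norm x ^ ?n * r ^ (?n - 1)) * indicator {0<..} r * f (r *\<^sub>R x)) \<partial>lborel \<partial>lborel)"
    by (subst lborel_pair.Fubini') auto
  also have "\<dots> = (\<integral>\<^sup>+r. \<integral>\<^sup>+y. indicator {0<..<r} (norm y) * (ennreal (norm y ^ ?n / r ^ Suc ?n) * f y) \<partial>lborel \<partial>lborel)"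
  proof (rule nn_integral_cong)
    fix r :: real
    show "(\<integral>\<^sup>+x. indicator ?b x * (ennreal (norm x ^ ?n * r ^ (?n - 1)) * indicator {0<..} r * f (r *\<^sub>R x)) \<partial>lborel) =
      (\<integral>\<^sup>+y. indicator {0<..<r} (norm y) * (ennreal (norm y ^ ?n / r ^ Suc ?n) * f y) \<partial>lborel)"
    proof (cases "r > 0")
      case True
      have e: "indicator {0<..<r} (norm (r *\<^sub>R x)) * (ennreal (norm (r *\<^sub>R x) ^ ?n / r ^ Suc ?n) * f (r *\<^sub>R x)) =
         indicator ?b x * (ennreal (norm x ^ ?n / r) * f (r *\<^sub>R x))" for x :: 'a
        using True by (auto simp: indicator_def power_mult_distrib)
      have "(\<integral>\<^sup>+x. indicator ?b x * (ennreal (norm x ^ ?n * r ^ (?n - 1)) * indicator {0<..} r * f (r *\<^sub>R x)) \<partial>lborel) =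
        (\<integral>\<^sup>+x. ennreal (r ^ ?n) * (indicator ?b x * (ennreal (norm x ^ ?n / r) * f (r *\<^sub>R x))) \<partial>lborel)"
      proof (rule nn_integral_cong)
        fix x :: 'a
        have "ennreal (norm x ^ ?n * r ^ (?n - 1)) = ennreal (r ^ ?n) * ennreal (norm x ^ ?n / r)"
        proof -
          have "r ^ ?n * (norm x ^ ?n / r) = norm x ^ ?n * r ^ (?n - 1)"
            using True pw[of r] by (simp add: field_simps)
          thus ?thesis using True by (subst ennreal_mult[symmetric]) auto
        qed
        thus "indicator ?b x * (ennreal (norm x ^ ?n * r ^ (?n - 1)) * indicator {0<..} r * f (r *\<^sub>R x)) =
          ennreal (r ^ ?n) * (indicator ?b x * (ennreal (norm x ^ ?n / r) * f (r *\<^sub>R x)))"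
          using True by (simp add: mult_ac)
      qed
      also have "\<dots> = ennreal (r ^ ?n) * (\<integral>\<^sup>+x. indicator {0<..<r} (norm (r *\<^sub>R x)) * (ennreal (norm (r *\<^sub>R x) ^ ?n / r ^ Suc ?n) * f (r *\<^sub>R x)) \<partial>lborel)"
        unfolding e by (rule nn_integral_cmult) auto
      also have "\<dots> = ennreal (r ^ ?n) * (ennreal ((1 / r) ^ ?n) * (\<integral>\<^sup>+y. indicator {0<..<r} (norm y) * (ennreal (norm y ^ ?n / r ^ Suc ?n) * f y) \<partial>lborel))"
        by (subst nn_integral_lborel_scale[OF _ True, of "\<lambda>y. indicator {0<..<r} (norm y) * (ennreal (norm y ^ ?n / r ^ Suc ?n) * f y)"]) auto
      also have "\<dots> = (\<integral>\<^sup>+y. indicator {0<..<r} (norm y) * (ennreal (norm y ^ ?n / r ^ Suc ?n) * f y) \<partial>lborel)"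
        using True by (simp add: mult.assoc[symmetric] ennreal_mult[symmetric] power_mult_distrib[symmetric])
      finally show ?thesis .
    qed auto
  qed
  also have "\<dots> = (\<integral>\<^sup>+y. \<integral>\<^sup>+r. indicator {0<..<r} (norm y) * (ennreal (norm y ^ ?n / r ^ Suc ?n) * f y) \<partial>lborel \<partial>lborel)"
  proof -
    have [measurable]: "(\<lambda>p::'a \<times> real. indicator {0<..<snd p} (norm (fst p)) :: ennreal) \<in> borel_measurable (lborel \<Otimes>\<^sub>M lborel)"
      unfolding indicator_def by simp
    show ?thesis
      by (subst lborel_pair.Fubini') (auto simp: measurable_split_conv)
  qed
  also have "\<dots> = (\<integral>\<^sup>+y. ennreal (1 / ?n) * f y \<partial>lborel)"
  proof (rule nn_integral_cong_AE, rule AE_mp[OF AE_lborel_singleton[of 0]], rule AE_I2, rule impI)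
    fix y :: 'a assume "y \<noteq> 0"
    have "(\<integral>\<^sup>+r. indicator {0<..<r} (norm y) * (ennreal (norm y ^ ?n / r ^ Suc ?n) * f y) \<partial>lborel) =
       (\<integral>\<^sup>+r. (ennreal (norm y ^ ?n) * f y) * (ennreal (1 / r ^ Suc ?n) * indicator {norm y<..} r) \<partial>lborel)"
    proof (rule nn_integral_cong)
      fix r
      have "ennreal (norm y ^ ?n / r ^ Suc ?n) = ennreal (norm y ^ ?n) * ennreal (1 / r ^ Suc ?n)" if "r > 0"
        using that by (subst ennreal_mult[symmetric]) auto
      thus "indicator {0<..<r} (norm y) * (ennreal (norm y ^ ?n / r ^ Suc ?n) * f y) =
        (ennreal (norm y ^ ?n) * f y) * (ennreal (1 / r ^ Suc ?n) * indicator {norm y<..} r)"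
        using \<open>y \<noteq> 0\<close> norm_ge_zero[of y]
        by (cases "norm y < r") (auto simp: mult_ac dest: order.strict_trans1[OF norm_ge_zero])
    qed
    also have "\<dots> = (ennreal (norm y ^ ?n) * f y) * ennreal (1 / (?n * norm y ^ ?n))"
      using \<open>y \<noteq> 0\<close> by (subst nn_integral_cmult, simp, subst nn_integral_inverse_power) auto
    also have "\<dots> = ennreal (1 / ?n) * f y"
      using \<open>y \<noteq> 0\<close> by (simp add: mult_ac ennreal_mult'[symmetric])
    finally show "(\<integral>\<^sup>+r. indicator {0<..<r} (norm y) * (ennreal (norm y ^ ?n / r ^ Suc ?n) * f y) \<partial>lborel) = ennreal (1 / ?n) * f y" .
  qed
  also have "of_nat ?n * \<dots> = ?L"
    by (subst nn_integral_cmult) (auto simp: mult.assoc[symmetric] ennreal_of_nat_eq_real_of_nat ennreal_mult'[symmetric])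
  finally show ?thesis ..
qed

text \<open>Two measures are compared: the one with density \<open>w\<close> on the image, and the
  image under \<open>g\<close> of the one with the transformed density. On a Borel set
  \<open>B\<close> both sides are the substitution rule for the integrable function
  \<open>w * indicator B\<close>. Equality of the measures then covers every nonnegative
  \<open>f\<close>, also one with infinite integral.\<close>

lemma nn_integral_change_of_variables_real:
  fixes g h w :: "real \<Rightarrow> real" and f :: "real \<Rightarrow> ennreal"
  assumes S [measurable]: "S \<in> sets borel" and gS [measurable]: "g ` S \<in> sets borel"
    and deriv: "\<And>x. x \<in> S \<Longrightarrow> (g has_field_derivative h x) (at x)" and inj: "inj_on g S"
    and g [measurable]: "g \<in> borel_measurable borel"
    and [measurable]: "h \<in> borel_measurable borel"
      "w \<in> borel_measurable borel" "f \<in> borel_measurable borel"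
    and w: "\<And>t. t \<in> g ` S \<Longrightarrow> 0 \<le> w t" "set_integrable lborel (g ` S) w"
  shows "(\<integral>\<^sup>+t. ennreal (w t) * indicator (g ` S) t * f t \<partial>lborel) =
    (\<integral>\<^sup>+k. ennreal (\<bar>h k\<bar> * w (g k)) * indicator S k * f (g k) \<partial>lborel)"
proof -
  define N where "N = density lborel (\<lambda>t. ennreal (w t) * indicator (g ` S) t)"
  define M where "M = distr (density lborel (\<lambda>k. ennreal (\<bar>h k\<bar> * w (g k)) * indicator S k)) borel g"
  have "N = M"
  proof (rule measure_eqI)
    show "sets N = sets M" by (simp add: N_def M_def)
    fix B assume "B \<in> sets N"
    hence B [measurable]: "B \<in> sets borel" by (simp add: N_def)
    let ?f = "\<lambda>t. w t * indicator B t"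
    have [measurable]: "g -` B \<in> sets borel"
      using measurable_sets[OF g B] by simp
    have int: "?f absolutely_integrable_on g ` S"
    proof -
      have "set_integrable lborel (g ` S) ?f"
        using w(2) unfolding set_integrable_def
        by (rule Bochner_Integration.integrable_bound) (auto simp: indicator_def)
      thus ?thesis
        unfolding set_integrable_def
        by (intro integrable_completion[THEN iffD2]) auto
    qed
    define b where "b = integral (g ` S) ?f"
    have "(\<lambda>x. \<bar>h x\<bar> * ?f (g x)) absolutely_integrable_on S \<and> integral S (\<lambda>x. \<bar>h x\<bar> * ?f (g x)) = b"
      using has_absolute_integral_change_of_variables_1'[of S g h ?f b] int
      by (simp add: b_def S inj) (meson deriv has_field_derivative_at_within)
    hence h2: "((\<lambda>x. \<bar>h x\<bar> * ?f (g x)) has_integral b) S"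
      using absolutely_integrable_on_def integrable_integral by blast
    have h1: "(?f has_integral b) (g ` S)"
      using int absolutely_integrable_on_def integrable_integral b_def by blast
    have "emeasure N B = (\<integral>\<^sup>+t. ennreal (?f t) * indicator (g ` S) t \<partial>lborel)"
      unfolding N_def by (subst emeasure_density) (auto intro!: nn_integral_cong simp: indicator_def)
    also have "\<dots> = ennreal b"
      by (rule nn_integral_has_integral_lebesgue'[OF _ h1]) (use w in \<open>auto simp: indicator_def\<close>)
    also have "\<dots> = (\<integral>\<^sup>+t. ennreal (\<bar>h t\<bar> * ?f (g t)) * indicator S t \<partial>lborel)"
      by (rule nn_integral_has_integral_lebesgue'[OF _ h2, symmetric]) (use w in \<open>auto simp: indicator_def\<close>)
    also have "\<dots> = emeasure M B"
      unfolding M_def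
      by (subst emeasure_distr, simp, simp, subst emeasure_density)
        (auto intro!: nn_integral_cong simp: indicator_def)
    finally show "emeasure N B = emeasure M B" .
  qed
  have "(\<integral>\<^sup>+t. ennreal (w t) * indicator (g ` S) t * f t \<partial>lborel) = (\<integral>\<^sup>+t. f t \<partial>N)"
    unfolding N_def by (subst nn_integral_density) auto
  also have "\<dots> = (\<integral>\<^sup>+k. ennreal (\<bar>h k\<bar> * w (g k)) * indicator S k * f (g k) \<partial>lborel)"
    unfolding \<open>N = M\<close> M_def by (subst nn_integral_distr, simp, simp, subst nn_integral_density) auto
  finally show ?thesis .
qed

text \<open>Here \<open>k\<close> is the tangent and \<open>t\<close> the sine of the same angle.
  The derivative of \<open>t\<close> is \<open>(1 / sqrt (1 + k^2))^3\<close> and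
  \<open>1 - t^2 = 1 / (1 + k^2)\<close>, so the exponents add up to
  \<open>3 + 2 * (d - 1) = 2 * d + 1\<close>.\<close>

lemma nn_integral_gnomonic:
  fixes f :: "real \<Rightarrow> ennreal"
  assumes [measurable]: "f \<in> borel_measurable borel" and d: "d \<ge> 1"
  shows "(\<integral>\<^sup>+t. ennreal ((1 - t\<^sup>2) ^ (d - 1)) * indicator {-1<..<1} t * f t \<partial>lborel) =
    (\<integral>\<^sup>+k. ennreal ((1 / sqrt (1 + k\<^sup>2)) ^ (2 * d + 1)) * f (k / sqrt (1 + k\<^sup>2)) \<partial>lborel)"
proof -
  define g :: "real \<Rightarrow> real" where "g = (\<lambda>k. k / sqrt (1 + k\<^sup>2))"
  define h :: "real \<Rightarrow> real" where "h = (\<lambda>k. (1 / sqrt (1 + k\<^sup>2)) ^ 3)"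
  define w :: "real \<Rightarrow> real" where "w = (\<lambda>t. (1 - t\<^sup>2) ^ (d - 1))"
  have pos: "1 + k\<^sup>2 > 0" for k :: real by (simp add: add_pos_nonneg)
  have sq: "sqrt (1 + k\<^sup>2) ^ 2 = 1 + k\<^sup>2" for k :: real using pos[of k] by simp
  have inv: "g k / sqrt (1 - (g k)\<^sup>2) = k" for k
  proof -
    have "1 - (g k)\<^sup>2 = 1 / (1 + k\<^sup>2)"
      using pos[of k] by (simp add: g_def power_divide field_simps)
    thus ?thesis using pos[of k] by (simp add: g_def real_sqrt_divide)
  qed
  have im: "g ` UNIV = {-1<..<1}"
  proof (intro equalityI subsetI)
    fix t assume "t \<in> g ` UNIV"
    then obtain k where "t = g k" by auto
    moreover have "\<bar>k\<bar> < sqrt (1 + k\<^sup>2)" by (rule real_less_rsqrt) simp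
    ultimately have "\<bar>t\<bar> < 1" using pos[of k]
      by (simp add: g_def abs_divide)
    thus "t \<in> {-1<..<1}" by (auto simp: abs_less_iff)
  next
    fix t :: real assume t: "t \<in> {-1<..<1}"
    hence t2: "1 - t\<^sup>2 > 0" using abs_square_less_1[of t] by (auto simp: abs_less_iff)
    have "1 + (t / sqrt (1 - t\<^sup>2))\<^sup>2 = 1 / (1 - t\<^sup>2)"
      using t2 by (simp add: power_divide field_simps)
    hence "g (t / sqrt (1 - t\<^sup>2)) = t"
      using t2 by (simp add: g_def real_sqrt_divide)
    thus "t \<in> g ` UNIV" by (metis rangeI)
  qed
  have "(\<integral>\<^sup>+t. ennreal (w t) * indicator (g ` UNIV) t * f t \<partial>lborel) =
    (\<integral>\<^sup>+k. ennreal (\<bar>h k\<bar> * w (g k)) * indicator UNIV k * f (g k) \<partial>lborel)"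
  proof (rule nn_integral_change_of_variables_real)
    show "g ` UNIV \<in> sets borel" by (simp add: im)
    show "inj g" by (metis inv injI)
    show "(g has_field_derivative h x) (at x)" for x
    proof -
      have "(g has_field_derivative (sqrt (1 + x\<^sup>2) - x * (2 * x / (2 * sqrt (1 + x\<^sup>2)))) / (sqrt (1 + x\<^sup>2) * sqrt (1 + x\<^sup>2))) (at x)"
        unfolding g_def using pos[of x]
        by (auto intro!: derivative_eq_intros simp: field_simps)
      also have "(sqrt (1 + x\<^sup>2) - x * (2 * x / (2 * sqrt (1 + x\<^sup>2)))) / (sqrt (1 + x\<^sup>2) * sqrt (1 + x\<^sup>2)) = h x"
        using pos[of x] sq[of x] by (simp add: h_def field_simps power2_eq_square power3_eq_cube)
      finally show ?thesis .
    qed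
    show "set_integrable lborel (g ` UNIV) w"
    proof -
      have "set_integrable lborel {-1..1::real} w"
        unfolding w_def by (intro borel_integrable_atLeastAtMost') (auto intro!: continuous_intros)
      thus ?thesis unfolding im by (rule set_integrable_subset) auto
    qed
    show "0 \<le> w t" if "t \<in> g ` UNIV" for t
    proof -
      have "t\<^sup>2 \<le> 1" using that abs_square_le_1[of t] unfolding im by (auto simp: abs_le_iff)
      thus ?thesis by (simp add: w_def)
    qed
    show "g \<in> borel_measurable borel" "h \<in> borel_measurable borel" "w \<in> borel_measurable borel"
      unfolding g_def h_def w_def by measurable
  qed auto
  also have "\<dots> = (\<integral>\<^sup>+k. ennreal ((1 / sqrt (1 + k\<^sup>2)) ^ (2 * d + 1)) * f (g k) \<partial>lborel)"
  proof (rule nn_integral_cong)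
    fix k
    have "1 - (g k)\<^sup>2 = (1 / sqrt (1 + k\<^sup>2)) ^ 2"
      using pos[of k] by (simp add: g_def power_divide field_simps)
    hence "\<bar>h k\<bar> * w (g k) = (1 / sqrt (1 + k\<^sup>2)) ^ (3 + 2 * (d - 1))"
      using pos[of k] by (simp add: h_def w_def power_add power_mult)
    also have "3 + 2 * (d - 1) = 2 * d + 1" using d by simp
    finally show "ennreal (\<bar>h k\<bar> * w (g k)) * indicator UNIV k * f (g k) =
      ennreal ((1 / sqrt (1 + k\<^sup>2)) ^ (2 * d + 1)) * f (g k)" by simp
  qed
  finally have "(\<integral>\<^sup>+t. ennreal (w t) * indicator {-1<..<1} t * f t \<partial>lborel) =
    (\<integral>\<^sup>+k. ennreal ((1 / sqrt (1 + k\<^sup>2)) ^ (2 * d + 1)) * f (g k) \<partial>lborel)"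
    unfolding im .
  thus ?thesis unfolding w_def g_def .
qed

section \<open>Invariance under isometries, and slicing by height\<close>

lemma sgn_linear_isometry:
  assumes "linear f" "\<And>x. norm (f x) = norm x"
  shows "sgn (f x) = f (sgn x)"
  using assms by (simp add: sgn_div_norm linear_cmul)

lemma nn_integral_lborel_isometry:
  fixes f :: "'a::euclidean_space \<Rightarrow> 'a"
  assumes f: "linear f" "\<And>x. norm (f x) = norm x"
    and [measurable]: "g \<in> borel_measurable borel"
  shows "(\<integral>\<^sup>+x. g (f x) \<partial>lborel) = (\<integral>\<^sup>+x. g x \<partial>lborel)"
proof -
  have [measurable]: "f \<in> borel_measurable borel"
    by (intro borel_measurable_continuous_onI linear_continuous_on linear_conv_bounded_linear[THEN iffD1] f)
  have "(\<integral>\<^sup>+x. g x \<partial>lborel) = (\<integral>\<^sup>+x. g x \<partial>distr lborel borel f)"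
    by (simp add: lborel_distr_linear_isometry[OF f])
  also have "\<dots> = (\<integral>\<^sup>+x. g (f x) \<partial>lborel)"
    by (subst nn_integral_distr) auto
  finally show ?thesis ..
qed

lemma nn_integral_sphere_isometry:
  fixes f :: "'a::euclidean_space \<Rightarrow> 'a"
  assumes f: "linear f" "\<And>x. norm (f x) = norm x"
    and [measurable]: "g \<in> borel_measurable borel"
  shows "(\<integral>\<^sup>+u. g (f u) \<partial>sphere_measure) = (\<integral>\<^sup>+u. g u \<partial>sphere_measure)"
proof -
  have [measurable]: "f \<in> borel_measurable borel"
    by (intro borel_measurable_continuous_onI linear_continuous_on linear_conv_bounded_linear[THEN iffD1] f)
  have [measurable]: "ball (0::'a) 1 - {0} \<in> sets borel" by simp
  have z: "f x = 0 \<longleftrightarrow> x = 0" for x by (metis f(2) norm_eq_zero)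
  have "(\<integral>\<^sup>+x. indicator (ball 0 1 - {0}) x * g (f (sgn x)) \<partial>lborel) =
    (\<integral>\<^sup>+x. indicator (ball 0 1 - {0}) (f x) * g (sgn (f x)) \<partial>lborel)"
    by (intro nn_integral_cong) (simp add: sgn_linear_isometry[OF f] indicator_def z f(2))
  also have "\<dots> = (\<integral>\<^sup>+x. indicator (ball 0 1 - {0}) x * g (sgn x) \<partial>lborel)"
    by (rule nn_integral_lborel_isometry[OF f, of "\<lambda>x. indicator (ball 0 1 - {0}) x * g (sgn x)"]) measurable
  finally show ?thesis by (simp add: nn_integral_sphere)
qed

lemma nn_integral_power_below:
  assumes "b \<ge> 0"
  shows "(\<integral>\<^sup>+r. ennreal (r ^ n) * indicator {0<..<b} r \<partial>lborel) = ennreal (b ^ Suc n / real (Suc n))"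
proof -
  have "(\<integral>\<^sup>+r. ennreal (r ^ n) * indicator {0<..<b} r \<partial>lborel) = (\<integral>\<^sup>+r. ennreal (r ^ n) * indicator {0..b} r \<partial>lborel)"
    by (rule nn_integral_cong_AE, rule AE_mp[OF AE_lborel_singleton[of 0]], rule AE_mp[OF AE_lborel_singleton[of b]])
       (auto split: split_indicator)
  also have "\<dots> = ennreal (b ^ Suc n / real (Suc n) - 0 ^ Suc n / real (Suc n))"
    by (rule nn_integral_FTC_Icc) (use assms in \<open>auto intro!: derivative_eq_intros simp del: power_Suc\<close>)
  finally show ?thesis by simp
qed

text \<open>Fubini and polar coordinates in the first factor; for a fixed radius \<open>r\<close> the height is written
  as \<open>h = r * k\<close>, after which \<open>r\<close> is integrated out (gnomonic projection).\<close>

lemma nn_integral_sphere_slice: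
  fixes f :: "'a::euclidean_space \<times> real \<Rightarrow> ennreal"
  assumes [measurable]: "f \<in> borel_measurable borel" and d: "DIM('a) = 2 * d"
  shows "(\<integral>\<^sup>+p. f p \<partial>sphere_measure) =
    (\<integral>\<^sup>+u. \<integral>\<^sup>+t. ennreal ((1 - t\<^sup>2) ^ (d - 1)) * indicator {-1<..<1} t * f (sqrt (1 - t\<^sup>2) *\<^sub>R u, t) \<partial>lborel \<partial>sphere_measure)"
proof -
  let ?n = "DIM('a)"
  have d1: "d \<ge> 1" using d DIM_positive[where 'a='a] by linarith
  interpret S: finite_measure "sphere_measure :: 'a measure" by (rule finite_measure_sphere_measure)
  define G :: "'a \<times> real \<Rightarrow> ennreal" where "G = (\<lambda>x. indicator (ball 0 1 - {0}) x * f (sgn x))"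
  have [measurable]: "ball (0::'a \<times> real) 1 - {0} \<in> sets borel" by simp
  have [measurable]: "G \<in> borel_measurable borel" unfolding G_def by measurable
  have [measurable]: "G \<in> borel_measurable (borel \<Otimes>\<^sub>M borel)" by (simp add: borel_prod)
  have [measurable]: "f \<in> borel_measurable (borel \<Otimes>\<^sub>M borel)" by (simp add: borel_prod)
  have [measurable]: "(\<lambda>p. sgn p) \<in> borel_measurable (borel \<Otimes>\<^sub>M borel :: ('a \<times> real) measure)"
    by (simp add: borel_prod)
  have id [measurable]: "(\<lambda>u. u) \<in> borel_measurable (sphere_measure :: 'a measure)"
    by (rule borel_measurable_sphere_measureI) simp
  \<comment> \<open>At height \<open>r * k\<close> the direction of the point is
    \<open>sgn (u, k)\<close>, free of \<open>r\<close>. Only membership in the unit ball still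
    involves \<open>r\<close>, as the condition \<open>r < 1 / sqrt (1 + k^2)\<close>.\<close>
  have scale: "(\<integral>\<^sup>+h. G (r *\<^sub>R u, h) \<partial>lborel) =
      (\<integral>\<^sup>+k. ennreal r * indicator {0<..<1 / sqrt (1 + k\<^sup>2)} r * f (sgn (u, k)) \<partial>lborel)"
    if "r > 0" "norm u = 1" for r u
  proof -
    have "(\<integral>\<^sup>+h. G (r *\<^sub>R u, h) \<partial>lborel) = ennreal r * (\<integral>\<^sup>+k. G (r *\<^sub>R u, r * k) \<partial>lborel)"
      using nn_integral_real_affine[of "\<lambda>h. G (r *\<^sub>R u, h)" r 0] that by simp
    also have "\<dots> = (\<integral>\<^sup>+k. ennreal r * G (r *\<^sub>R u, r * k) \<partial>lborel)"
      by (subst nn_integral_cmult) auto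
    also have "\<dots> = (\<integral>\<^sup>+k. ennreal r * indicator {0<..<1 / sqrt (1 + k\<^sup>2)} r * f (sgn (u, k)) \<partial>lborel)"
    proof (rule nn_integral_cong)
      fix k :: real
      have e: "(r *\<^sub>R u, r * k) = r *\<^sub>R (u, k)" by simp
      have nz: "(u, k) \<noteq> 0" using that by (auto simp: zero_prod_def)
      have "norm (r *\<^sub>R (u, k)) < 1 \<longleftrightarrow> r < 1 / sqrt (1 + k\<^sup>2)"
      proof -
        have "norm (r *\<^sub>R (u, k)) = r * sqrt (1 + k\<^sup>2)"
          using that by (simp add: norm_Pair del: scaleR_Pair)
        moreover have "sqrt (1 + k\<^sup>2) > 0" by (simp add: add_pos_nonneg)
        ultimately show ?thesis by (simp only: pos_less_divide_eq)
      qed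
      thus "ennreal r * G (r *\<^sub>R u, r * k) = ennreal r * indicator {0<..<1 / sqrt (1 + k\<^sup>2)} r * f (sgn (u, k))"
        using that nz unfolding e G_def by (auto simp: indicator_def sgn_scaleR simp del: scaleR_Pair)
    qed
    finally show ?thesis .
  qed
  have "(\<integral>\<^sup>+p. f p \<partial>sphere_measure) = of_nat (Suc ?n) * (\<integral>\<^sup>+x. G x \<partial>lborel)"
    by (subst nn_integral_sphere) (auto simp: G_def)
  also have "(\<integral>\<^sup>+x. G x \<partial>lborel) = (\<integral>\<^sup>+y. \<integral>\<^sup>+h. G (y, h) \<partial>lborel \<partial>lborel)"
    by (subst lborel_prod[symmetric], subst lborel.nn_integral_fst[symmetric]) auto
  also have "\<dots> = (\<integral>\<^sup>+u. \<integral>\<^sup>+r. ennreal (r ^ (?n - 1)) * indicator {0<..} r * (\<integral>\<^sup>+h. G (r *\<^sub>R u, h) \<partial>lborel) \<partial>lborel \<partial>sphere_measure)"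
    by (subst nn_integral_polar) auto
  also have "\<dots> = (\<integral>\<^sup>+u. \<integral>\<^sup>+r. \<integral>\<^sup>+k. ennreal (r ^ ?n) * indicator {0<..<1 / sqrt (1 + k\<^sup>2)} r * f (sgn (u, k)) \<partial>lborel \<partial>lborel \<partial>sphere_measure)"
  proof (intro nn_integral_cong)
    fix u :: 'a and r :: real assume "u \<in> space sphere_measure"
    hence u: "norm u = 1" by simp
    have m [measurable]: "(\<lambda>k. indicator {0<..<1 / sqrt (1 + k\<^sup>2)} r :: ennreal) \<in> borel_measurable borel"
      unfolding indicator_def by simp
    show "ennreal (r ^ (?n - 1)) * indicator {0<..} r * (\<integral>\<^sup>+h. G (r *\<^sub>R u, h) \<partial>lborel) =
      (\<integral>\<^sup>+k. ennreal (r ^ ?n) * indicator {0<..<1 / sqrt (1 + k\<^sup>2)} r * f (sgn (u, k)) \<partial>lborel)"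
    proof (cases "r > 0")
      case True
      have "ennreal (r ^ ?n) = ennreal (r ^ (?n - 1)) * ennreal r"
        using True power_minus_mult[of ?n r] by (subst ennreal_mult[symmetric]) auto
      thus ?thesis using True
        by (simp add: scale[OF True u] mult.assoc nn_integral_cmult)
    qed (auto simp: indicator_def intro!: nn_integral_zero'[symmetric])
  qed
  also have "\<dots> = (\<integral>\<^sup>+u. \<integral>\<^sup>+k. \<integral>\<^sup>+r. ennreal (r ^ ?n) * indicator {0<..<1 / sqrt (1 + k\<^sup>2)} r * f (sgn (u, k)) \<partial>lborel \<partial>lborel \<partial>sphere_measure)"
  proof (rule nn_integral_cong)
    fix u :: 'a
    have [measurable]: "(\<lambda>p. indicator {0<..<1 / sqrt (1 + (fst p)\<^sup>2)} (snd p) :: ennreal) \<in> borel_measurable (borel \<Otimes>\<^sub>M borel)"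
      unfolding indicator_def by simp
    show "(\<integral>\<^sup>+r. \<integral>\<^sup>+k. ennreal (r ^ ?n) * indicator {0<..<1 / sqrt (1 + k\<^sup>2)} r * f (sgn (u, k)) \<partial>lborel \<partial>lborel) =
      (\<integral>\<^sup>+k. \<integral>\<^sup>+r. ennreal (r ^ ?n) * indicator {0<..<1 / sqrt (1 + k\<^sup>2)} r * f (sgn (u, k)) \<partial>lborel \<partial>lborel)"
      by (rule lborel_pair.Fubini') (auto simp: measurable_split_conv)
  qed
  also have "\<dots> = (\<integral>\<^sup>+u. \<integral>\<^sup>+k. ennreal (1 / Suc ?n) * (ennreal ((1 / sqrt (1 + k\<^sup>2)) ^ (2 * d + 1)) * f (sgn (u, k))) \<partial>lborel \<partial>sphere_measure)"
  proof (intro nn_integral_cong)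
    fix u :: 'a and k :: real
    have "(\<integral>\<^sup>+r. ennreal (r ^ ?n) * indicator {0<..<1 / sqrt (1 + k\<^sup>2)} r * f (sgn (u, k)) \<partial>lborel) =
      ennreal ((1 / sqrt (1 + k\<^sup>2)) ^ Suc ?n / Suc ?n) * f (sgn (u, k))"
      by (subst nn_integral_multc, simp, subst nn_integral_power_below) auto
    also have "(1 / sqrt (1 + k\<^sup>2)) ^ Suc ?n / Suc ?n = (1 / Suc ?n) * (1 / sqrt (1 + k\<^sup>2)) ^ (2 * d + 1)"
      using d by simp
    also have "ennreal \<dots> = ennreal (1 / Suc ?n) * ennreal ((1 / sqrt (1 + k\<^sup>2)) ^ (2 * d + 1))"
      by (intro ennreal_mult) auto
    finally show "(\<integral>\<^sup>+r. ennreal (r ^ ?n) * indicator {0<..<1 / sqrt (1 + k\<^sup>2)} r * f (sgn (u, k)) \<partial>lborel) =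
       ennreal (1 / Suc ?n) * (ennreal ((1 / sqrt (1 + k\<^sup>2)) ^ (2 * d + 1)) * f (sgn (u, k)))"
      by (simp add: mult.assoc)
  qed
  also have "\<dots> = ennreal (1 / Suc ?n) * (\<integral>\<^sup>+u. \<integral>\<^sup>+k. ennreal ((1 / sqrt (1 + k\<^sup>2)) ^ (2 * d + 1)) * f (sgn (u, k)) \<partial>lborel \<partial>sphere_measure)"
  proof -
    have "(\<integral>\<^sup>+k. ennreal (1 / Suc ?n) * (ennreal ((1 / sqrt (1 + k\<^sup>2)) ^ (2 * d + 1)) * f (sgn (u, k))) \<partial>lborel) =
      ennreal (1 / Suc ?n) * (\<integral>\<^sup>+k. ennreal ((1 / sqrt (1 + k\<^sup>2)) ^ (2 * d + 1)) * f (sgn (u, k)) \<partial>lborel)" for u :: 'a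
      by (rule nn_integral_cmult) simp
    thus ?thesis by (simp, subst nn_integral_cmult) auto
  qed
  also have "of_nat (Suc ?n) * \<dots> = (\<integral>\<^sup>+u. \<integral>\<^sup>+k. ennreal ((1 / sqrt (1 + k\<^sup>2)) ^ (2 * d + 1)) * f (sgn (u, k)) \<partial>lborel \<partial>sphere_measure)"
    by (simp only: mult.assoc[symmetric] ennreal_of_nat_eq_real_of_nat ennreal_mult'[symmetric]) simp
  also have "\<dots> = (\<integral>\<^sup>+u. \<integral>\<^sup>+t. ennreal ((1 - t\<^sup>2) ^ (d - 1)) * indicator {-1<..<1} t * f (sqrt (1 - t\<^sup>2) *\<^sub>R u, t) \<partial>lborel \<partial>sphere_measure)"
  proof (rule nn_integral_cong)
    fix u :: 'a assume "u \<in> space sphere_measure"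
    hence u: "norm u = 1" by simp
    have e: "sgn (u, k) = (sqrt (1 - (k / sqrt (1 + k\<^sup>2))\<^sup>2) *\<^sub>R u, k / sqrt (1 + k\<^sup>2))" for k :: real
    proof -
      have "1 + k\<^sup>2 > 0" by (simp add: add_pos_nonneg)
      hence "1 - (k / sqrt (1 + k\<^sup>2))\<^sup>2 = 1 / (1 + k\<^sup>2)"
        by (simp add: power_divide field_simps)
      thus ?thesis using u
        by (simp add: sgn_div_norm norm_Pair real_sqrt_inverse divide_inverse mult.commute)
    qed
    show "(\<integral>\<^sup>+k. ennreal ((1 / sqrt (1 + k\<^sup>2)) ^ (2 * d + 1)) * f (sgn (u, k)) \<partial>lborel) =
      (\<integral>\<^sup>+t. ennreal ((1 - t\<^sup>2) ^ (d - 1)) * indicator {-1<..<1} t * f (sqrt (1 - t\<^sup>2) *\<^sub>R u, t) \<partial>lborel)"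
      unfolding e by (rule nn_integral_gnomonic[symmetric, OF _ d1]) simp
  qed
  finally show ?thesis .
qed

section \<open>Slices of the sphere\<close>

text \<open>Up to the factor \<open>sphere_vol\<close>, the area of the part of the sphere in
  dimension \<open>2 * d + 1\<close> with last coordinate at most \<open>a\<close>.\<close>

definition slice_integral :: "nat \<Rightarrow> real \<Rightarrow> real" where
  "slice_integral d a = integral {-1..a} (\<lambda>t. (1 - t\<^sup>2) ^ (d - 1))"

lemma has_integral_slice:
  "((\<lambda>t. (1 - t\<^sup>2) ^ (d - 1)) has_integral integral {a..b} (\<lambda>t::real. (1 - t\<^sup>2) ^ (d - 1))) {a..b}"
  by (intro integrable_integral integrable_continuous_real continuous_intros)

lemma slice_integral_has_derivative:
  assumes "t \<in> {-1<..<1}"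
  shows "(slice_integral d has_real_derivative (1 - t\<^sup>2) ^ (d - 1)) (at t)"
proof -
  have "(slice_integral d has_vector_derivative (1 - t\<^sup>2) ^ (d - 1)) (at t within {-1..1})"
    unfolding slice_integral_def using assms
    by (intro integral_has_vector_derivative) (auto intro!: continuous_intros)
  thus ?thesis using assms
    by (simp add: has_real_derivative_iff_has_vector_derivative at_within_Icc_at)
qed

lemma continuous_on_slice_integral: "continuous_on {-1..1} (slice_integral d)"
  unfolding slice_integral_def
  by (intro indefinite_integral_continuous_1 integrable_continuous_real continuous_intros)

lemma slice_integral_left [simp]: "slice_integral d (-1) = 0"
  by (simp add: slice_integral_def)

lemma slice_integral_strict_mono:
  assumes "-1 \<le> a" "a < b" "b \<le> 1"
  shows "slice_integral d a < slice_integral d b"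
proof (rule DERIV_pos_imp_increasing_open[OF \<open>a < b\<close>])
  fix x assume x: "a < x" "x < b"
  have "x\<^sup>2 < 1" using x assms abs_square_less_1[of x] by (auto simp: abs_less_iff)
  thus "\<exists>y. DERIV (slice_integral d) x :> y \<and> 0 < y"
    using slice_integral_has_derivative[of x d] x assms by force
qed (rule continuous_on_subset[OF continuous_on_slice_integral], use assms in auto)

lemma slice_integral_1_pos: "0 < slice_integral d 1"
  using slice_integral_strict_mono[of "-1" 1 d] by simp

text \<open>A Wallis recursion: the derivative of \<open>t * (1 - t^2)^d\<close> is integrated, and
  this function vanishes at both ends.\<close>

lemma slice_integral_Suc:
  assumes "d \<ge> 1"
  shows "(2 * real d + 1) * slice_integral (Suc d) 1 = 2 * real d * slice_integral d 1"
proof -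
  have "((\<lambda>t. (2 * real d + 1) * (1 - t\<^sup>2) ^ d - 2 * real d * (1 - t\<^sup>2) ^ (d - 1)) has_integral
      (2 * real d + 1) * slice_integral (Suc d) 1 - 2 * real d * slice_integral d 1) {-1..1}"
    unfolding slice_integral_def
    using has_integral_slice[of "Suc d" "-1" 1] has_integral_slice[of d "-1" 1]
    by (intro has_integral_diff has_integral_mult_right) simp_all
  moreover have "((\<lambda>t. (2 * real d + 1) * (1 - t\<^sup>2) ^ d - 2 * real d * (1 - t\<^sup>2) ^ (d - 1)) has_integral
      1 * (1 - 1\<^sup>2) ^ d - (-1) * (1 - (-1)\<^sup>2) ^ d) {-1..1::real}"
  proof (rule fundamental_theorem_of_calculus)
    fix t :: real
    have e: "(1 - t\<^sup>2) ^ d = (1 - t\<^sup>2) * (1 - t\<^sup>2) ^ (d - 1)"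
      using assms by (simp flip: power_Suc)
    have "((\<lambda>t. t * (1 - t\<^sup>2) ^ d) has_real_derivative
        (1 - t\<^sup>2) ^ d + t * (real d * (1 - t\<^sup>2) ^ (d - 1) * (- 2 * t))) (at t within {-1..1})"
      by (auto intro!: derivative_eq_intros)
    also have "(1 - t\<^sup>2) ^ d + t * (real d * (1 - t\<^sup>2) ^ (d - 1) * (- 2 * t)) =
      (2 * real d + 1) * (1 - t\<^sup>2) ^ d - 2 * real d * (1 - t\<^sup>2) ^ (d - 1)"
      unfolding e by algebra
    finally show "((\<lambda>t. t * (1 - t\<^sup>2) ^ d) has_vector_derivative
        (2 * real d + 1) * (1 - t\<^sup>2) ^ d - 2 * real d * (1 - t\<^sup>2) ^ (d - 1)) (at t within {-1..1})"
      by (simp add: has_real_derivative_iff_has_vector_derivative)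
  qed auto
  ultimately show ?thesis
    using assms by (auto dest: has_integral_unique simp: power_0_left)
qed

text \<open>Induction along the recursion. The bound is an equality for \<open>d = 1\<close>, and in
  the induction step the two sides of the polynomial inequality differ by \<open>d\<close> only. The
  true order is \<open>pi * d\<close>, so the slope 3 loses little.\<close>

lemma slice_integral_lower:
  assumes "d \<ge> 1"
  shows "3 * real d + 1 \<le> (real d * slice_integral d 1)\<^sup>2"
  using assms
proof (induction d rule: dec_induct)
  case base
  show ?case by (simp add: slice_integral_def)
next
  case (step d)
  define W where "W = slice_integral d 1"
  have W: "slice_integral (Suc d) 1 = 2 * real d * W / (2 * real d + 1)"
    using slice_integral_Suc[OF step(1)] by (simp add: field_simps W_def)
  have "(3 * real d + 4) * (2 * real d + 1)\<^sup>2 \<le> 4 * (real d + 1)\<^sup>2 * (3 * real d + 1)"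
    by (simp add: power2_eq_square algebra_simps)
  also have "\<dots> \<le> 4 * (real d + 1)\<^sup>2 * (real d * W)\<^sup>2"
    using step.IH by (intro mult_left_mono) (auto simp: W_def)
  finally have "3 * real d + 4 \<le> 4 * (real d + 1)\<^sup>2 * (real d * W)\<^sup>2 / (2 * real d + 1)\<^sup>2"
    by (subst pos_le_divide_eq) auto
  also have "\<dots> = (real (Suc d) * slice_integral (Suc d) 1)\<^sup>2"
    unfolding W by (simp add: power2_eq_square field_simps)
  finally show ?case by simp
qed

lemma nn_integral_slice:
  assumes "-1 \<le> a" "a \<le> b" "b \<le> 1"
  shows "(\<integral>\<^sup>+t. ennreal ((1 - t\<^sup>2) ^ (d - 1)) * indicator {a..b} t \<partial>lborel) =
    ennreal (slice_integral d b - slice_integral d a)"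
proof (rule nn_integral_has_integral_lebesgue')
  show "0 \<le> (1 - x\<^sup>2) ^ (d - 1)" if "x \<in> {a..b}" for x
    using that assms abs_square_le_1[of x] by (auto simp: abs_le_iff)
  have "slice_integral d a + integral {a..b} (\<lambda>t. (1 - t\<^sup>2) ^ (d - 1)) = slice_integral d b"
    unfolding slice_integral_def using assms
    by (intro Henstock_Kurzweil_Integration.integral_combine integrable_continuous_real continuous_intros) auto
  hence "slice_integral d b - slice_integral d a = integral {a..b} (\<lambda>t. (1 - t\<^sup>2) ^ (d - 1))"
    by simp
  thus "((\<lambda>t. (1 - t\<^sup>2) ^ (d - 1)) has_integral slice_integral d b - slice_integral d a) {a..b}"
    by (simp only: has_integral_slice)
qed

text \<open>As for a Gaussian tail, the factor \<open>t / a \<ge> 1\<close> turns the integrand into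
  an exact derivative. With \<open>a = 1 / sqrt d\<close> its value is at most
  \<open>exp (-1) / (2 * sqrt d)\<close>, because \<open>(1 - 1 / d)^d \<le> exp (-1)\<close>, and
  \<open>1 / sqrt d\<close> is at most the full integral by
  \<open>slice_integral_lower\<close>.\<close>

lemma slice_tail_bound:
  assumes "d \<ge> 2"
  shows "slice_integral d 1 - slice_integral d (1 / sqrt d) \<le> slice_integral d 1 * (exp (-1) / 2)"
proof -
  define a where "a = 1 / sqrt (real d)"
  have a: "0 < a" "a \<le> 1" and a2: "a\<^sup>2 = 1 / d"
    using assms by (auto simp: a_def power_divide)
  have "slice_integral d 1 - slice_integral d a = integral {a..1} (\<lambda>t. (1 - t\<^sup>2) ^ (d - 1))"
  proof -
    have "slice_integral d a + integral {a..1} (\<lambda>t. (1 - t\<^sup>2) ^ (d - 1)) = slice_integral d 1"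
      unfolding slice_integral_def using a
      by (intro Henstock_Kurzweil_Integration.integral_combine integrable_continuous_real continuous_intros) auto
    thus ?thesis by simp
  qed
  also have "\<dots> \<le> (1 - a\<^sup>2) ^ d / (2 * d * a)"
  proof (rule has_integral_le[OF has_integral_slice])
    have "((\<lambda>t. t * (1 - t\<^sup>2) ^ (d - 1) / a) has_integral
      - ((1 - 1\<^sup>2) ^ d / (2 * d * a)) - - ((1 - a\<^sup>2) ^ d / (2 * d * a))) {a..1}"
    proof (rule fundamental_theorem_of_calculus)
      fix t assume "t \<in> {a..1}"
      have "((\<lambda>t. - ((1 - t\<^sup>2) ^ d / (2 * d * a))) has_real_derivative
        - ((real d * (1 - t\<^sup>2) ^ (d - 1) * (- (2 * t))) / (2 * d * a))) (at t within {a..1})"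
        using a assms by (auto intro!: derivative_eq_intros)
      also have "- ((real d * (1 - t\<^sup>2) ^ (d - 1) * (- (2 * t))) / (2 * d * a)) = t * (1 - t\<^sup>2) ^ (d - 1) / a"
        using a assms by (simp add: field_simps)
      finally show "((\<lambda>t. - ((1 - t\<^sup>2) ^ d / (2 * d * a))) has_vector_derivative t * (1 - t\<^sup>2) ^ (d - 1) / a)
         (at t within {a..1})"
        by (simp add: has_real_derivative_iff_has_vector_derivative)
    qed (use a in auto)
    thus "((\<lambda>t. t * (1 - t\<^sup>2) ^ (d - 1) / a) has_integral (1 - a\<^sup>2) ^ d / (2 * d * a)) {a..1}"
      using assms by (simp add: power_0_left)
    fix t assume t: "t \<in> {a..1}"
    have "t\<^sup>2 \<le> 1" using t a abs_square_le_1[of t] by auto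
    hence "1 * (1 - t\<^sup>2) ^ (d - 1) \<le> (t / a) * (1 - t\<^sup>2) ^ (d - 1)"
      using t a by (intro mult_right_mono) auto
    thus "(1 - t\<^sup>2) ^ (d - 1) \<le> t * (1 - t\<^sup>2) ^ (d - 1) / a" by simp
  qed
  also have "\<dots> \<le> exp (-1) / (2 * d * a)"
  proof -
    have "(1 - a\<^sup>2) ^ d \<le> exp (- (1 / d)) ^ d"
      using exp_ge_add_one_self[of "- (1 / d)"] assms unfolding a2 by (intro power_mono) auto
    also have "\<dots> = exp (-1)" using assms by (simp add: exp_of_nat_mult[symmetric])
    finally show ?thesis using a by (intro divide_right_mono) auto
  qed
  also have "\<dots> \<le> slice_integral d 1 * (exp (-1) / 2)"
  proof -
    have "1 / (d * a) \<le> slice_integral d 1"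
    proof (rule power2_le_imp_le)
      have "(1 / (d * a))\<^sup>2 = 1 / d"
        using assms by (simp add: a_def power_mult_distrib power_divide field_simps power2_eq_square)
      also have "\<dots> \<le> (slice_integral d 1)\<^sup>2"
      proof -
        have "(real d * slice_integral d 1)\<^sup>2 = real d * (real d * (slice_integral d 1)\<^sup>2)"
          by (simp add: power2_eq_square)
        hence "real d * 1 \<le> real d * (real d * (slice_integral d 1)\<^sup>2)"
          using slice_integral_lower[of d] assms by linarith
        hence "1 \<le> real d * (slice_integral d 1)\<^sup>2" using assms by simp
        thus ?thesis using assms by (simp add: field_simps)
      qed
      finally show "(1 / (d * a))\<^sup>2 \<le> (slice_integral d 1)\<^sup>2" .
    qed (use slice_integral_1_pos[of d] in simp)
    hence "(1 / (d * a)) * (exp (-1) / 2) \<le> slice_integral d 1 * (exp (-1) / 2)"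
      by (rule mult_right_mono) simp
    thus ?thesis by (simp add: field_simps)
  qed
  finally show ?thesis unfolding a_def .
qed

section \<open>Zonal functions and Riesz potentials\<close>

lemma nn_integral_sphere_zonal:
  fixes f :: "real \<Rightarrow> ennreal"
  assumes [measurable]: "f \<in> borel_measurable borel" and d: "DIM('a::euclidean_space) = 2 * d"
  shows "(\<integral>\<^sup>+p. f (snd p) \<partial>(sphere_measure :: ('a \<times> real) measure)) =
    ennreal (sphere_vol TYPE('a)) * (\<integral>\<^sup>+t. ennreal ((1 - t\<^sup>2) ^ (d - 1)) * indicator {-1<..<1} t * f t \<partial>lborel)"
proof -
  have "(\<lambda>p::'a \<times> real. f (snd p)) \<in> borel_measurable (borel \<Otimes>\<^sub>M borel)" by measurable
  hence "(\<lambda>p::'a \<times> real. f (snd p)) \<in> borel_measurable borel" by (simp add: borel_prod)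
  from nn_integral_sphere_slice[OF this d] show ?thesis
    by (simp add: emeasure_sphere_vol mult.commute)
qed

lemma indicator_Ioo_Icc_AE: "AE t in lborel. (indicator {a<..<b} t :: ennreal) = indicator {a..b} (t::real)"
  by (rule AE_mp[OF AE_lborel_singleton[of a]], rule AE_mp[OF AE_lborel_singleton[of b]])
     (auto split: split_indicator)

lemma sphere_measure_lower_cap:
  assumes d: "DIM('a::euclidean_space) = 2 * d" and a: "-1 \<le> a" "a \<le> 1"
  shows "(\<integral>\<^sup>+p. indicator {..a} (snd p) \<partial>(sphere_measure :: ('a \<times> real) measure)) =
    ennreal (sphere_vol TYPE('a) * slice_integral d a)"
proof -
  have "(\<integral>\<^sup>+p. indicator {..a} (snd p) \<partial>(sphere_measure :: ('a \<times> real) measure)) =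
    ennreal (sphere_vol TYPE('a)) * (\<integral>\<^sup>+t. ennreal ((1 - t\<^sup>2) ^ (d - 1)) * indicator {-1<..<1} t * indicator {..a} t \<partial>lborel)"
    by (rule nn_integral_sphere_zonal[OF _ d]) simp
  also have "(\<integral>\<^sup>+t. ennreal ((1 - t\<^sup>2) ^ (d - 1)) * indicator {-1<..<1} t * indicator {..a} t \<partial>lborel) =
    (\<integral>\<^sup>+t. ennreal ((1 - t\<^sup>2) ^ (d - 1)) * indicator {-1..a} t \<partial>lborel)"
    by (rule nn_integral_cong_AE, rule AE_mp[OF indicator_Ioo_Icc_AE[of "-1" 1]])
       (use a in \<open>auto split: split_indicator_asm split: split_indicator\<close>)
  also have "\<dots> = ennreal (slice_integral d a)"
    using nn_integral_slice[of "-1" a d] a by simp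
  finally show ?thesis
    using sphere_vol_pos[where 'a='a] by (simp add: ennreal_mult')
qed

lemma sphere_vol_slice:
  assumes d: "DIM('a::euclidean_space) = 2 * d"
  shows "sphere_vol TYPE('a \<times> real) = sphere_vol TYPE('a) * slice_integral d 1"
proof -
  have "ennreal (sphere_vol TYPE('a \<times> real)) = (\<integral>\<^sup>+p. 1 \<partial>(sphere_measure :: ('a \<times> real) measure))"
    by (simp add: emeasure_sphere_vol)
  also have "\<dots> = (\<integral>\<^sup>+p. indicator {..1} (snd p) \<partial>(sphere_measure :: ('a \<times> real) measure))"
  proof (rule nn_integral_cong)
    fix p :: "'a \<times> real" assume "p \<in> space sphere_measure"
    hence "snd p \<le> 1" using norm_snd_le[of "snd p" "fst p"] by (auto simp: abs_le_iff)
    thus "1 = (indicator {..1} (snd p) :: ennreal)" by simp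
  qed
  also have "\<dots> = ennreal (sphere_vol TYPE('a) * slice_integral d 1)"
    by (rule sphere_measure_lower_cap[OF d]) auto
  finally show ?thesis
    using sphere_vol_pos[where 'a='a] sphere_vol_pos[where 'a="'a \<times> real"] slice_integral_1_pos[of d]
    by (simp add: ennreal_inj)
qed

text \<open>The reflection in the hyperplane orthogonal to \<open>p - e\<close>; as \<open>p\<close>
  and \<open>e\<close> have equal norms it takes one to the other.\<close>

lemma ex_linear_isometry_swap:
  fixes p e :: "'a::euclidean_space"
  assumes "norm p = 1" "norm e = 1"
  obtains f where "linear f" "\<And>x y. f x \<bullet> f y = x \<bullet> y" "\<And>x. norm (f x) = norm x" "f p = e"
proof (cases "p = e")
  case True
  thus ?thesis using that[of "\<lambda>x. x"] by (simp add: linear_iff)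
next
  case False
  define w where "w = p - e"
  have w: "w \<bullet> w \<noteq> 0" using False by (simp add: w_def)
  define f where "f = (\<lambda>x. x - (2 * (x \<bullet> w) / (w \<bullet> w)) *\<^sub>R w)"
  have lin: "linear f"
  proof (rule linearI)
    show "f (x + y) = f x + f y" for x y
      by (simp add: f_def inner_add_left distrib_left add_divide_distrib scaleR_add_left)
    show "f (c *\<^sub>R x) = c *\<^sub>R f x" for c x
      by (simp add: f_def scaleR_diff_right mult_ac)
  qed
  have inn: "f x \<bullet> f y = x \<bullet> y" for x y
  proof -
    define a where "a = 2 * (x \<bullet> w) / (w \<bullet> w)"
    define b where "b = 2 * (y \<bullet> w) / (w \<bullet> w)"
    have "f x \<bullet> f y = x \<bullet> y - b * (x \<bullet> w) - a * (y \<bullet> w) + a * (b * (w \<bullet> w))"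
      unfolding f_def a_def[symmetric] b_def[symmetric]
      by (simp add: inner_diff_left inner_diff_right inner_commute[of w y] right_diff_distrib)
    also have "b * (w \<bullet> w) = 2 * (y \<bullet> w)" using w by (simp add: b_def)
    also have "b * (x \<bullet> w) = a * (y \<bullet> w)" by (simp add: a_def b_def)
    finally show ?thesis by simp
  qed
  have "2 * (p \<bullet> w) = w \<bullet> w"
    using assms by (simp add: w_def inner_diff_left inner_diff_right inner_commute[of e p] norm_eq_1)
  hence "f p = e" using w by (simp add: f_def w_def)
  thus ?thesis using that lin inn by (simp add: norm_eq_sqrt_inner)
qed

text \<open>Rotating \<open>p\<close> to the pole makes functions of the distance zonal:
  \<open>2 - 2 * snd q\<close> is the squared distance of a unit vector \<open>q\<close> from the
  pole.\<close>

lemma nn_integral_sphere_rotate: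
  fixes p :: "'a::euclidean_space \<times> real"
  assumes [measurable]: "f \<in> borel_measurable borel" and p: "norm p = 1"
  shows "(\<integral>\<^sup>+q. f (norm (p - q)) \<partial>sphere_measure) =
    (\<integral>\<^sup>+q. f (sqrt (2 - 2 * snd q)) \<partial>(sphere_measure :: ('a \<times> real) measure))"
proof -
  obtain r :: "'a \<times> real \<Rightarrow> 'a \<times> real" where r: "linear r" "\<And>x y. r x \<bullet> r y = x \<bullet> y" "\<And>x. norm (r x) = norm x" "r p = (0, 1)"
  proof -
    have "norm ((0, 1) :: 'a \<times> real) = 1" by (simp add: norm_Pair)
    from ex_linear_isometry_swap[OF p this] show thesis using that by blast
  qed
  have dist: "norm ((0, 1) - q) = sqrt (2 - 2 * snd q)" if "norm q = 1" for q :: "'a \<times> real"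
  proof -
    have "(0, 1) \<bullet> q = snd q" by (cases q) simp
    moreover have "norm ((0, 1) :: 'a \<times> real) = 1" by (simp add: norm_Pair)
    ultimately have "(norm ((0, 1) - q))\<^sup>2 = 2 - 2 * snd q"
      using dot_norm_neg[of "(0, 1)" q] by (simp only: that) simp
    thus ?thesis by (metis norm_ge_zero real_sqrt_abs abs_of_nonneg)
  qed
  have "(\<integral>\<^sup>+q. f (norm (p - q)) \<partial>sphere_measure) = (\<integral>\<^sup>+q. f (norm ((0, 1) - r q)) \<partial>sphere_measure)"
    using r by (simp add: linear_diff[symmetric] flip: r(4))
  also have "\<dots> = (\<integral>\<^sup>+q. f (norm ((0, 1) - q)) \<partial>(sphere_measure :: ('a \<times> real) measure))"
    by (rule nn_integral_sphere_isometry[OF r(1,3), of "\<lambda>q. f (norm ((0, 1) - q))"]) simp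
  also have "\<dots> = (\<integral>\<^sup>+q. f (sqrt (2 - 2 * snd q)) \<partial>(sphere_measure :: ('a \<times> real) measure))"
    by (rule nn_integral_cong) (simp add: dist)
  finally show ?thesis .
qed

text \<open>The substitution \<open>v = 2 - 2 * t\<close> is the squared distance from the pole. It
  is applied with \<open>a = d - s / 2\<close>, and positivity of \<open>a\<close> is the condition
  \<open>s < 2 * d\<close>.\<close>

lemma nn_integral_powr_cap:
  assumes "a > 0" "0 \<le> b"
  shows "(\<integral>\<^sup>+t. ennreal ((2 - 2 * t) powr (a - 1)) * indicator {1 - b / 2..1} t \<partial>lborel) =
    ennreal (b powr a / (2 * a))"
proof -
  have "ennreal (b powr a / a) = (\<integral>\<^sup>+v. ennreal (v powr (a - 1)) * indicator {0..b} v \<partial>lborel)"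
    using has_integral_powr_from_0[of "a - 1" b] assms
    by (intro nn_integral_has_integral_lebesgue'[symmetric]) auto
  also have "\<dots> = 2 * (\<integral>\<^sup>+t. ennreal ((2 - 2 * t) powr (a - 1)) * indicator {0..b} (2 - 2 * t) \<partial>lborel)"
    using nn_integral_real_affine[of "\<lambda>v. ennreal (v powr (a - 1)) * indicator {0..b} v" "-2" 2] by simp
  also have "(\<lambda>t::real. indicator {0..b} (2 - 2 * t) :: ennreal) = indicator {1 - b / 2..1}"
    by (auto simp: indicator_def fun_eq_iff)
  finally have "ennreal (1/2) * ennreal (b powr a / a) = ennreal (1/2) * (2 * (\<integral>\<^sup>+t. ennreal ((2 - 2 * t) powr (a - 1)) * indicator {1 - b / 2..1} t \<partial>lborel))"
    by simp
  also have "\<dots> = (\<integral>\<^sup>+t. ennreal ((2 - 2 * t) powr (a - 1)) * indicator {1 - b / 2..1} t \<partial>lborel)"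
  proof -
    have "ennreal (1/2) * 2 = ennreal (1/2 * 2)"
      by (subst ennreal_mult) (auto simp: ennreal_numeral)
    thus ?thesis by (simp only: mult.assoc[symmetric]) simp
  qed
  also have "ennreal (1/2) * ennreal (b powr a / a) = ennreal (1/2 * (b powr a / a))"
    using assms by (intro ennreal_mult[symmetric]) auto
  also have "1/2 * (b powr a / a) = b powr a / (2 * a)" by simp
  finally show ?thesis ..
qed

text \<open>In terms of \<open>v = 2 - 2 * t\<close> one has
  \<open>1 - t^2 = v * (1 - v / 4)\<close>, so the slice density and the Riesz kernel combine to a
  pure power of \<open>v\<close> times a factor bounded by 1.\<close>

lemma slice_riesz:
  fixes t :: real
  assumes "-1 < t" "t < 1" "d \<ge> 1"
  shows "(1 - t\<^sup>2) ^ (d - 1) * sqrt (2 - 2 * t) powr (- s) =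
    (1 - (2 - 2 * t) / 4) ^ (d - 1) * (2 - 2 * t) powr (real d - s / 2 - 1)"
proof -
  define v where "v = 2 - 2 * t"
  have v: "v > 0" using assms by (simp add: v_def)
  have "1 - t\<^sup>2 = v * (1 - v / 4)" by (simp add: v_def power2_eq_square field_simps)
  moreover have "sqrt v powr (- s) = v powr (- s / 2)"
    using v by (simp add: powr_half_sqrt[symmetric] powr_powr)
  moreover have "v ^ (d - 1) * v powr (- s / 2) = v powr (real d - s / 2 - 1)"
    using v assms(3) by (simp add: powr_realpow[symmetric] powr_add[symmetric] of_nat_diff algebra_simps)
  ultimately show ?thesis
    unfolding v_def[symmetric] by (simp add: power_mult_distrib mult_ac)
qed

text \<open>The factor \<open>1 - v / 4\<close> is bounded by 1 and the pure power of
  \<open>v\<close> is integrated over the whole sphere, that is up to squared distance 4.\<close>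

lemma sphere_riesz_potential_finite:
  fixes p :: "'a::euclidean_space \<times> real"
  assumes d: "DIM('a) = 2 * d" and p: "norm p = 1" and s: "s < 2 * real d"
  shows "(\<integral>\<^sup>+q. ennreal (norm (p - q) powr (- s)) \<partial>sphere_measure) \<le>
    ennreal (sphere_vol TYPE('a) * (4 powr (real d - s / 2) / (2 * (real d - s / 2))))"
proof -
  have d1: "d \<ge> 1" using d DIM_positive[where 'a='a] by linarith
  let ?a = "real d - s / 2"
  have eq: "(\<integral>\<^sup>+q. ennreal (norm (p - q) powr (- s)) \<partial>sphere_measure) =
    ennreal (sphere_vol TYPE('a)) * (\<integral>\<^sup>+t. ennreal ((1 - t\<^sup>2) ^ (d - 1)) * indicator {-1<..<1} t * ennreal (sqrt (2 - 2 * t) powr (- s)) \<partial>lborel)"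
    by (subst nn_integral_sphere_rotate[OF _ p], simp, subst nn_integral_sphere_zonal[OF _ d]) auto
  have "(\<integral>\<^sup>+t. ennreal ((1 - t\<^sup>2) ^ (d - 1)) * indicator {-1<..<1} t * ennreal (sqrt (2 - 2 * t) powr (- s)) \<partial>lborel) \<le>
    (\<integral>\<^sup>+t. ennreal ((2 - 2 * t) powr (?a - 1)) * indicator {1 - 4 / 2..1} t \<partial>lborel)"
  proof (rule nn_integral_mono)
    fix t :: real
    show "ennreal ((1 - t\<^sup>2) ^ (d - 1)) * indicator {-1<..<1} t * ennreal (sqrt (2 - 2 * t) powr (- s)) \<le>
      ennreal ((2 - 2 * t) powr (?a - 1)) * indicator {1 - 4 / 2..1} t"
    proof (cases "t \<in> {-1<..<1}")
      case True
      hence t: "-1 < t" "t < 1" by auto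
      have "t\<^sup>2 \<le> 1" using t abs_square_le_1[of t] by (auto simp: abs_le_iff)
      hence "ennreal ((1 - t\<^sup>2) ^ (d - 1)) * ennreal (sqrt (2 - 2 * t) powr (- s)) =
        ennreal ((1 - (2 - 2 * t) / 4) ^ (d - 1) * (2 - 2 * t) powr (?a - 1))"
        using slice_riesz[OF t d1, of s] by (simp add: ennreal_mult[symmetric])
      also have "\<dots> \<le> ennreal (1 * (2 - 2 * t) powr (?a - 1))"
        using t by (intro ennreal_leI mult_right_mono power_le_one) auto
      finally show ?thesis using True by simp
    qed auto
  qed
  also have "\<dots> = ennreal (4 powr ?a / (2 * ?a))"
    by (rule nn_integral_powr_cap) (use s in auto)
  finally have "(\<integral>\<^sup>+q. ennreal (norm (p - q) powr (- s)) \<partial>sphere_measure) \<le>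
    ennreal (sphere_vol TYPE('a)) * ennreal (4 powr ?a / (2 * ?a))"
    unfolding eq by (rule mult_left_mono) simp
  also have "\<dots> = ennreal (sphere_vol TYPE('a) * (4 powr ?a / (2 * ?a)))"
    using sphere_vol_pos[where 'a='a] s by (intro ennreal_mult[symmetric]) auto
  finally show ?thesis .
qed

text \<open>On the cap \<open>v < \<tau>^2\<close>, hence \<open>1 - v / 4\<close> is at least
  \<open>1 - \<tau>^2 / 4\<close>, the origin of that factor in the theorem; the remaining power of
  \<open>v\<close> is integrated exactly.\<close>

lemma sphere_riesz_potential_cap:
  fixes p :: "'a::euclidean_space \<times> real"
  assumes d: "DIM('a) = 2 * d" and p: "norm p = 1" and s: "s < 2 * real d" and \<tau>: "0 < \<tau>" "\<tau> < 2"
  shows "ennreal (sphere_vol TYPE('a) / (2 * real d - s) * (1 - \<tau>\<^sup>2 / 4) ^ (d - 1) * \<tau> powr (2 * real d - s)) \<le>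
    (\<integral>\<^sup>+q. ennreal (norm (p - q) powr (- s)) * indicator {..<\<tau>} (norm (p - q)) \<partial>sphere_measure)"
proof -
  have d1: "d \<ge> 1" using d DIM_positive[where 'a='a] by linarith
  let ?a = "real d - s / 2" and ?c = "(1 - \<tau>\<^sup>2 / 4) ^ (d - 1)"
  have \<tau>2: "\<tau>\<^sup>2 < 4" using \<tau> power_strict_mono[of \<tau> 2 2] by simp
  have eq: "ennreal (sphere_vol TYPE('a) / (2 * real d - s) * ?c * \<tau> powr (2 * real d - s)) =
    ennreal (sphere_vol TYPE('a)) * (ennreal ?c * ennreal (\<tau>\<^sup>2 powr ?a / (2 * ?a)))"
  proof -
    have "\<tau>\<^sup>2 powr ?a = \<tau> powr (2 * real d - s)"
      using \<tau> by (simp add: powr_realpow[symmetric] powr_powr algebra_simps flip: powr_numeral)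
    moreover have "2 * ?a = 2 * real d - s" by simp
    ultimately show ?thesis
      using sphere_vol_pos[where 'a='a] \<tau>2 s
      by (simp add: ennreal_mult[symmetric] mult_ac)
  qed
  have "ennreal ?c * ennreal (\<tau>\<^sup>2 powr ?a / (2 * ?a)) =
    (\<integral>\<^sup>+t. ennreal ?c * (ennreal ((2 - 2 * t) powr (?a - 1)) * indicator {1 - \<tau>\<^sup>2 / 2..1} t) \<partial>lborel)"
    using s by (subst nn_integral_cmult, simp, subst nn_integral_powr_cap) auto
  also have "\<dots> = (\<integral>\<^sup>+t. ennreal ?c * (ennreal ((2 - 2 * t) powr (?a - 1)) * indicator {1 - \<tau>\<^sup>2 / 2<..<1} t) \<partial>lborel)"
    by (rule nn_integral_cong_AE, rule AE_mp[OF indicator_Ioo_Icc_AE[of "1 - \<tau>\<^sup>2 / 2" 1]]) auto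
  also have "\<dots> \<le> (\<integral>\<^sup>+t. ennreal ((1 - t\<^sup>2) ^ (d - 1)) * indicator {-1<..<1} t *
      (ennreal (sqrt (2 - 2 * t) powr (- s)) * indicator {..<\<tau>} (sqrt (2 - 2 * t))) \<partial>lborel)"
  proof (rule nn_integral_mono)
    fix t :: real
    show "ennreal ?c * (ennreal ((2 - 2 * t) powr (?a - 1)) * indicator {1 - \<tau>\<^sup>2 / 2<..<1} t) \<le>
      ennreal ((1 - t\<^sup>2) ^ (d - 1)) * indicator {-1<..<1} t *
      (ennreal (sqrt (2 - 2 * t) powr (- s)) * indicator {..<\<tau>} (sqrt (2 - 2 * t)))"
    proof (cases "t \<in> {1 - \<tau>\<^sup>2 / 2<..<1}")
      case True
      hence t: "-1 < t" "t < 1" and v: "2 - 2 * t < \<tau>\<^sup>2" using \<tau>2 by auto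
      have "sqrt (2 - 2 * t) < \<tau>" using v \<tau> by (simp add: real_less_lsqrt)
      have t2: "t\<^sup>2 \<le> 1" using t abs_square_le_1[of t] by (auto simp: abs_le_iff)
      have "ennreal ?c * ennreal ((2 - 2 * t) powr (?a - 1)) = ennreal (?c * (2 - 2 * t) powr (?a - 1))"
        using \<tau>2 by (simp add: ennreal_mult[symmetric])
      also have "\<dots> \<le> ennreal ((1 - (2 - 2 * t) / 4) ^ (d - 1) * (2 - 2 * t) powr (?a - 1))"
        using t v \<tau>2 by (intro ennreal_leI mult_right_mono power_mono) auto
      also have "\<dots> = ennreal ((1 - t\<^sup>2) ^ (d - 1)) * ennreal (sqrt (2 - 2 * t) powr (- s))"
        using slice_riesz[OF t d1, of s] t2 by (simp add: ennreal_mult[symmetric])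
      finally show ?thesis using True t \<open>sqrt (2 - 2 * t) < \<tau>\<close> by simp
    qed auto
  qed
  finally have le: "ennreal (sphere_vol TYPE('a) / (2 * real d - s) * ?c * \<tau> powr (2 * real d - s)) \<le>
    ennreal (sphere_vol TYPE('a)) * (\<integral>\<^sup>+t. ennreal ((1 - t\<^sup>2) ^ (d - 1)) * indicator {-1<..<1} t *
      (ennreal (sqrt (2 - 2 * t) powr (- s)) * indicator {..<\<tau>} (sqrt (2 - 2 * t))) \<partial>lborel)"
    unfolding eq by (rule mult_left_mono) simp
  also have "\<dots> = (\<integral>\<^sup>+q. ennreal (norm (p - q) powr (- s)) * indicator {..<\<tau>} (norm (p - q)) \<partial>sphere_measure)"
    by (subst nn_integral_sphere_rotate[OF _ p, of "\<lambda>x. ennreal (x powr (- s)) * indicator {..<\<tau>} x"], simp,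
        subst nn_integral_sphere_zonal[OF _ d, of "\<lambda>x. ennreal (sqrt (2 - 2 * x) powr (- s)) * indicator {..<\<tau>} (sqrt (2 - 2 * x))"]) auto
  finally show ?thesis .
qed

section \<open>The radial contraction\<close>

text \<open>Distribution function of the last coordinate of a uniform point of the sphere; also the
  regularized Beta function with parameters \<open>d, d\<close> after the change of variable
  \<open>x = (1 + t) / 2\<close>.\<close>

definition slice_cdf :: "nat \<Rightarrow> real \<Rightarrow> real" where
  "slice_cdf d t = slice_integral d t / slice_integral d 1"

lemma slice_integral_minus:
  assumes "-1 \<le> t" "t \<le> 1"
  shows "slice_integral d (- t) = slice_integral d 1 - slice_integral d t"
proof -
  have "slice_integral d (- t) = integral {t..1} (\<lambda>t. (1 - t\<^sup>2) ^ (d - 1))"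
    unfolding slice_integral_def
    using Henstock_Kurzweil_Integration.integral_reflect_real[of 1 t "\<lambda>t. (1 - t\<^sup>2) ^ (d - 1)"] by simp
  moreover have "slice_integral d t + integral {t..1} (\<lambda>t. (1 - t\<^sup>2) ^ (d - 1)) = slice_integral d 1"
    unfolding slice_integral_def using assms
    by (intro Henstock_Kurzweil_Integration.integral_combine integrable_continuous_real continuous_intros) auto
  ultimately show ?thesis by simp
qed

lemma slice_cdf_minus:
  assumes "-1 \<le> t" "t \<le> 1"
  shows "slice_cdf d (- t) = 1 - slice_cdf d t"
  using slice_integral_minus[OF assms, of d] slice_integral_1_pos[of d]
  by (simp add: slice_cdf_def field_simps)

lemma slice_cdf_0: "slice_cdf d 0 = 1 / 2"
  using slice_cdf_minus[of 0 d] by simp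

lemma slice_cdf_left [simp]: "slice_cdf d (-1) = 0"
  by (simp add: slice_cdf_def)

lemma slice_cdf_right [simp]: "slice_cdf d 1 = 1"
  using slice_integral_1_pos[of d] by (simp add: slice_cdf_def)

lemma slice_cdf_strict_mono:
  "-1 \<le> a \<Longrightarrow> a < b \<Longrightarrow> b \<le> 1 \<Longrightarrow> slice_cdf d a < slice_cdf d b"
  using slice_integral_strict_mono[of a b d] slice_integral_1_pos[of d]
  by (simp add: slice_cdf_def divide_strict_right_mono)

lemma slice_cdf_bounds:
  assumes "-1 < t" "t < 1"
  shows "0 < slice_cdf d t" "slice_cdf d t < 1"
  using slice_cdf_strict_mono[of "-1" t d] slice_cdf_strict_mono[of t 1 d] assms by auto

lemma slice_cdf_has_derivative:
  assumes "-1 < t" "t < 1"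
  shows "(slice_cdf d has_real_derivative (1 - t\<^sup>2) ^ (d - 1) / slice_integral d 1) (at t)"
  unfolding slice_cdf_def
  by (rule DERIV_cdivide, rule slice_integral_has_derivative) (use assms in auto)

lemma continuous_on_slice_cdf: "continuous_on {-1..1} (slice_cdf d)"
  unfolding slice_cdf_def
  by (intro continuous_intros continuous_on_slice_integral) (use slice_integral_1_pos[of d] in auto)

section \<open>Elementary bounds for the height distribution\<close>

lemma one_minus_square_pos: "-1 < t \<Longrightarrow> t < 1 \<Longrightarrow> 0 < 1 - (t::real)\<^sup>2"
  using abs_square_less_1[of t] by auto

text \<open>With \<open>c\<close> for this constant the derivative of \<open>slice_cdf d\<close> is
  \<open>2 * d * c * (1 - t^2)^(d - 1)\<close>, and that of its \<open>2 * d\<close>-th root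
  \<open>n\<close> is \<open>c * (1 - t^2)^(d - 1) * n / slice_cdf d t\<close>.\<close>

definition slice_const :: "nat \<Rightarrow> real" where
  "slice_const d = 1 / (2 * real d * slice_integral d 1)"

lemma slice_const_pos: "d \<ge> 1 \<Longrightarrow> slice_const d > 0"
  using slice_integral_1_pos[of d] by (simp add: slice_const_def)

text \<open>The form of \<open>slice_integral_lower\<close> that enters the radius estimates. The
  value 1/12 suffices there: 8/12 is below \<open>ln 2\<close>, and 1/12 is below 3/32.\<close>

lemma slice_const_bound:
  assumes "d \<ge> 1"
  shows "real d * (slice_const d)\<^sup>2 \<le> 1 / 12"
proof -
  have W: "real d * slice_integral d 1 > 0" using slice_integral_1_pos[of d] assms by simp
  have "(slice_const d)\<^sup>2 = 1 / (4 * (real d * slice_integral d 1)\<^sup>2)"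
    by (simp add: slice_const_def power_divide power_mult_distrib)
  also have "\<dots> \<le> 1 / (4 * (3 * real d + 1))"
    using slice_integral_lower[OF assms] zero_less_power[OF W, of 2]
    by (intro divide_left_mono mult_pos_pos) auto
  finally have "real d * (slice_const d)\<^sup>2 \<le> real d * (1 / (4 * (3 * real d + 1)))"
    by (intro mult_left_mono) auto
  also have "\<dots> \<le> 1 / 12" by (simp add: field_simps)
  finally show ?thesis .
qed

text \<open>Near \<open>t = -1\<close> the distribution function behaves like
  \<open>c * (1 - t^2)^d / \<bar>t\<bar>\<close>. Replacing \<open>\<bar>t\<bar>\<close> by
  \<open>sqrt (t^2 + 1 / d)\<close> removes the pole at 0 and makes the derivative of the difference
  nonnegative everywhere; both functions vanish at -1.\<close>

lemma slice_cdf_lower: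
  assumes d: "d \<ge> 1" and t: "-1 < t" "t < 1"
  shows "slice_const d * (1 - t\<^sup>2) ^ d / sqrt (t\<^sup>2 + 1 / d) \<le> slice_cdf d t"
proof -
  define H where "H = (\<lambda>t. (1 - t\<^sup>2) ^ d / sqrt (t\<^sup>2 + 1 / real d))"
  define c where "c = slice_const d"
  have c: "c > 0" using slice_const_pos[OF d] by (simp add: c_def)
  have b: "1 / real d > 0" using d by simp
  have "slice_cdf d (-1) - c * H (-1) \<le> slice_cdf d t - c * H t"
  proof (rule DERIV_nonneg_imp_increasing_open[where f = "\<lambda>t. slice_cdf d t - c * H t"])
    show "-1 \<le> t" using t by simp
    show "continuous_on {-1..t} (\<lambda>t. slice_cdf d t - c * H t)"
    proof -
      have "sqrt (x\<^sup>2 + 1 / real d) \<noteq> 0" for x :: real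
        using b by (metis add_nonneg_pos less_irrefl real_sqrt_eq_zero_cancel_iff zero_le_power2)
      thus ?thesis unfolding H_def
        by (intro continuous_intros continuous_on_subset[OF continuous_on_slice_cdf]) (use t in auto)
    qed
    fix x assume x: "-1 < x" "x < t"
    define q where "q = sqrt (x\<^sup>2 + 1 / real d)"
    define y where "y = 1 - x\<^sup>2"
    have q2: "q\<^sup>2 = x\<^sup>2 + 1 / real d" using b by (simp add: q_def)
    have pos: "x\<^sup>2 + 1 / real d > 0" using b by (simp add: add_nonneg_pos)
    have q: "q > 0" using pos by (simp add: q_def)
    have y: "0 < y" "y \<le> 1" using one_minus_square_pos[of x] x t by (auto simp: y_def)
    have xq: "\<bar>x\<bar> \<le> q" unfolding q_def using b by (intro real_le_rsqrt) simp
    have DH: "(H has_real_derivative (real d * y ^ (d - 1) * (- (2 * x)) * q - y ^ d * (x / q)) / q\<^sup>2) (at x)"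
      unfolding H_def y_def q_def using pos
      by (auto intro!: derivative_eq_intros simp: field_simps power2_eq_square)
    \<comment> \<open>After division by \<open>y ^ (d - 1)\<close> and multiplication by
      \<open>q ^ 3\<close> this is a polynomial inequality in \<open>x\<close>, \<open>y\<close> and
      \<open>q\<close>. Its left side is nonpositive for \<open>x \<ge> 0\<close>.\<close>
    have key: "(real d * y ^ (d - 1) * (- (2 * x)) * q - y ^ d * (x / q)) / q\<^sup>2 \<le> 2 * real d * y ^ (d - 1)"
    proof -
      have "- (x * q) \<le> q\<^sup>2" "- (x * y) \<le> q"
      proof -
        show "- (x * q) \<le> q\<^sup>2"
          using xq q mult_right_mono[of "-x" q q] by (simp add: power2_eq_square)
        have "- (x * y) \<le> \<bar>x\<bar> * y" using y abs_le_iff[of x] by (metis abs_ge_minus_self abs_mult abs_of_pos)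
        also have "\<dots> \<le> \<bar>x\<bar> * 1" using y by (intro mult_left_mono) auto
        finally show "- (x * y) \<le> q" using xq by simp
      qed
      have "- (2 * real d * x * q\<^sup>2) - y * x \<le> 2 * real d * q ^ 3"
      proof (cases "x \<ge> 0")
        case True
        thus ?thesis using y q by (smt (verit) mult_nonneg_nonneg of_nat_0_le_iff zero_le_power2 zero_le_power)
      next
        case False
        define C where "C = - x"
        have C: "0 < C" "C \<le> q" using False xq by (auto simp: C_def)
        \<comment> \<open>This identity is what the summand \<open>1 / d\<close> under the root is
          chosen for; it turns the bound \<open>C * (q + C) \<le> 2 * q^2\<close> into the required
          one.\<close>
        have e: "(q - C) * (q + C) * real d = 1"
        proof -
          have "(q - C) * (q + C) = q\<^sup>2 - x\<^sup>2" by (simp add: C_def power2_eq_square algebra_simps)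
          also have "\<dots> = 1 / real d" using q2 by simp
          finally show ?thesis using d by simp
        qed
        have "C * (q + C) \<le> 2 * q\<^sup>2"
          using C by (simp add: power2_eq_square) (smt (verit) mult_mono mult_left_mono distrib_left)
        hence "(q - C) * real d * (C * (q + C)) \<le> (q - C) * real d * (2 * q\<^sup>2)"
          using C by (intro mult_left_mono) auto
        moreover have "(q - C) * real d * (C * (q + C)) = C * ((q - C) * (q + C) * real d)" by (simp only: mult_ac)
        ultimately have "C \<le> (q - C) * real d * (2 * q\<^sup>2)" by (simp only: e)
        hence "2 * real d * C * q\<^sup>2 + C \<le> 2 * real d * q ^ 3"
          by (simp add: power2_eq_square power3_eq_cube algebra_simps)
        moreover have "y * C \<le> C" using y C by simp
        ultimately show ?thesis by (simp add: C_def)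
      qed
      hence "y ^ (d - 1) * (- (2 * real d * x * q\<^sup>2) - y * x) \<le> y ^ (d - 1) * (2 * real d * q ^ 3)"
        using y by (intro mult_left_mono) auto
      moreover have "y ^ d = y * y ^ (d - 1)" using d by (simp flip: power_Suc)
      ultimately show ?thesis using q
        by (simp add: field_simps power2_eq_square power3_eq_cube)
    qed
    have "((\<lambda>t. slice_cdf d t - c * H t) has_real_derivative
        y ^ (d - 1) / slice_integral d 1 - c * ((real d * y ^ (d - 1) * (- (2 * x)) * q - y ^ d * (x / q)) / q\<^sup>2)) (at x)"
      unfolding y_def using slice_cdf_has_derivative[of x d] x t DH[unfolded y_def]
      by (intro DERIV_diff DERIV_cmult) auto
    moreover have "y ^ (d - 1) / slice_integral d 1 = c * (2 * real d * y ^ (d - 1))"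
      using d slice_integral_1_pos[of d] by (simp add: c_def slice_const_def field_simps)
    ultimately show "\<exists>z. ((\<lambda>t. slice_cdf d t - c * H t) has_real_derivative z) (at x) \<and> 0 \<le> z"
      using mult_left_mono[OF key, of c] c by force
  qed
  moreover have "H (-1) = 0" using d by (simp add: H_def power_0_left)
  ultimately have "c * H t \<le> slice_cdf d t" by simp
  thus ?thesis by (simp add: H_def c_def)
qed

text \<open>The difference \<open>D\<close> of the two sides vanishes at -1 and, by symmetry of the
  distribution, at 0. Its derivative changes sign only once in between, at
  \<open>- 1 / (d * W)\<close>, from positive to negative, so \<open>D\<close> is nonnegative on the
  whole interval.\<close>

lemma slice_cdf_upper:
  assumes d: "d \<ge> 1" and t: "-1 < t" "t \<le> 0"
  shows "slice_cdf d t \<le> (1 - t\<^sup>2) ^ d / 2"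
proof -
  define W where "W = slice_integral d 1"
  define D where "D = (\<lambda>t. (1 - t\<^sup>2) ^ d / 2 - slice_cdf d t)"
  have W: "W > 0" using slice_integral_1_pos[of d] by (simp add: W_def)
  have dW: "real d * W > 1"
  proof (rule power2_less_imp_less)
    show "1\<^sup>2 < (real d * W)\<^sup>2" using slice_integral_lower[OF d] d by (simp add: W_def)
  qed (use W in simp)
  have cont: "continuous_on {-1..1} D" unfolding D_def by (intro continuous_intros continuous_on_slice_cdf) auto
  have DD: "(D has_real_derivative (1 - x\<^sup>2) ^ (d - 1) * (- x * real d - 1 / W)) (at x)" if x: "-1 < x" "x < 1" for x
    unfolding D_def W_def
    by (auto intro!: derivative_eq_intros slice_cdf_has_derivative x simp: field_simps)
  show ?thesis
  proof (cases "t \<le> - 1 / (real d * W)")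
    case True
    have "D (-1) \<le> D t"
    proof (rule DERIV_nonneg_imp_increasing_open[where f = D])
      fix x assume x: "-1 < x" "x < t"
      have "x * (real d * W) \<le> -1" using x True W d dW by (simp add: pos_le_divide_eq[symmetric])
      hence "0 \<le> - x * real d - 1 / W" using W by (simp add: field_simps)
      thus "\<exists>y. (D has_real_derivative y) (at x) \<and> 0 \<le> y"
        using DD[of x] x t one_minus_square_pos[of x] by force
    qed (use t in \<open>auto intro: continuous_on_subset[OF cont]\<close>)
    thus ?thesis using d by (simp add: D_def power_0_left)
  next
    case False
    have "- D t \<le> - D 0"
    proof (rule DERIV_nonneg_imp_increasing_open[where f = "\<lambda>x. - D x"])
      fix x assume x: "t < x" "x < 0"
      have "-1 \<le> x * (real d * W)" using x False W d dW by (simp add: pos_divide_le_eq[symmetric])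
      hence "0 \<le> - (- x * real d - 1 / W)" using W by (simp add: field_simps)
      hence "0 \<le> (1 - x\<^sup>2) ^ (d - 1) * (- (- x * real d - 1 / W))"
        using one_minus_square_pos[of x] x t by (intro mult_nonneg_nonneg) auto
      thus "\<exists>y. ((\<lambda>x. - D x) has_real_derivative y) (at x) \<and> 0 \<le> y"
        using DERIV_minus[OF DD[of x]] x t by (metis (no_types, lifting) less_trans mult_minus_right zero_less_one)
    qed (use t in \<open>auto intro!: continuous_on_minus continuous_on_subset[OF cont]\<close>)
    thus ?thesis by (simp add: D_def slice_cdf_0)
  qed
qed

text \<open>Put \<open>n^2 = k * y\<close> with \<open>y = 1 - t^2\<close>, so that
  \<open>k ^ d = \<rho>\<close> is the quotient of \<open>slice_cdf d t\<close> by
  \<open>y ^ d\<close>. The powers of \<open>y\<close> cancel and the claim becomes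
  \<open>c^2 / \<rho>^2 + y \<le> 1 / k\<close>. Since \<open>1 / k = exp (- ln \<rho> / d)\<close>
  is at least \<open>1 - ln \<rho> / d\<close>, it is enough to prove \<open>ratio\<close>.\<close>

lemma radius_estimate_lower_half:
  assumes d: "d \<ge> 2" and t: "-1 < t" "t \<le> 0" and n: "0 < n" "n ^ (2 * d) = slice_cdf d t"
  shows "(slice_const d)\<^sup>2 * (1 - t\<^sup>2) ^ (2 * d - 1) \<le> n ^ (4 * d - 2) * (1 - n\<^sup>2)"
proof -
  define y where "y = 1 - t\<^sup>2"
  define c where "c = slice_const d"
  define \<rho> where "\<rho> = slice_cdf d t / y ^ d"
  define k where "k = n\<^sup>2 / y"
  have d1: "d \<ge> 1" using d by simp
  have y: "0 < y" "y \<le> 1" using one_minus_square_pos[of t] t by (auto simp: y_def)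
  have c: "c > 0" using slice_const_pos[OF d1] by (simp add: c_def)
  have \<rho>: "0 < \<rho>" "\<rho> \<le> 1 / 2"
    using slice_cdf_bounds[of t d] slice_cdf_upper[OF d1 t] t y
    by (auto simp: \<rho>_def y_def[symmetric] field_simps)
  have k: "k > 0" using n y by (simp add: k_def)
  have kd: "k ^ d = \<rho>" using n by (simp add: k_def \<rho>_def power_divide power_mult)
  have inv_k: "1 - ln \<rho> / d \<le> 1 / k"
  proof -
    have "real d * ln k = ln \<rho>" unfolding kd[symmetric] using k by (simp add: ln_realpow)
    hence "ln \<rho> / d = ln k" using d by (simp add: field_simps)
    moreover have "1 / k = exp (- ln k)" using k by (simp add: exp_minus divide_inverse)
    ultimately show ?thesis using exp_ge_add_one_self[of "- ln k"] by simp
  qed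
  \<comment> \<open>The split is at \<open>\<rho> = 1 / e\<close>. Above it
    \<open>1 / \<rho>^2 \<le> e^2 \<le> 8\<close>, and
    \<open>8 / 12 \<le> ln 2 \<le> - ln \<rho>\<close> because \<open>\<rho> \<le> 1 / 2\<close>.
    Below it \<open>- ln \<rho> \<ge> 1\<close>, which pays for exactly the \<open>1 / d\<close> in
    \<open>slice_cdf_lower\<close>.\<close>
  have ratio: "c\<^sup>2 / \<rho>\<^sup>2 \<le> t\<^sup>2 - ln \<rho> / d"
  proof (cases "\<rho> \<ge> exp (-1)")
    case True
    have e2: "exp 1 ^ 2 \<le> (8 :: real)"
    proof -
      have "exp 1 ^ 2 \<le> (272 / 100 :: real) ^ 2" using e_less_272 by (intro power_mono) auto
      thus ?thesis by (simp add: power2_eq_square)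
    qed
    have "1 / \<rho>\<^sup>2 \<le> 1 / (exp (-1))\<^sup>2"
      using True \<rho> by (intro divide_left_mono power_mono mult_pos_pos zero_less_power) auto
    also have "\<dots> = exp 1 ^ 2" by (simp add: exp_minus power_inverse divide_inverse)
    finally have "1 / \<rho>\<^sup>2 \<le> 8" using e2 by linarith
    hence "c\<^sup>2 * (1 / \<rho>\<^sup>2) \<le> c\<^sup>2 * 8" by (intro mult_left_mono) auto
    hence "real d * (c\<^sup>2 / \<rho>\<^sup>2) \<le> real d * (c\<^sup>2 * 8)" by (intro mult_left_mono) auto
    also have "\<dots> \<le> 2 / 3" using slice_const_bound[OF d1] by (simp add: c_def)
    also have "\<dots> \<le> ln 2" by (rule ln2_ge_two_thirds)
    also have "\<dots> \<le> - ln \<rho>"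
    proof -
      have "ln \<rho> \<le> ln (1 / 2)" using \<rho> by (subst ln_le_cancel_iff) auto
      thus ?thesis by (simp add: ln_div)
    qed
    finally have "c\<^sup>2 / \<rho>\<^sup>2 \<le> - ln \<rho> / d" using d by (simp add: field_simps)
    thus ?thesis using zero_le_power2[of t] by linarith
  next
    case False
    hence "ln \<rho> \<le> -1" using \<rho> by (metis exp_le_cancel_iff exp_ln linear)
    hence "1 / d \<le> - ln \<rho> / d" by (intro divide_right_mono) auto
    moreover have "c\<^sup>2 / \<rho>\<^sup>2 \<le> t\<^sup>2 + 1 / d"
    proof -
      have pos: "t\<^sup>2 + 1 / d > 0" using d by (simp add: add_nonneg_pos)
      have "c * y ^ d / sqrt (t\<^sup>2 + 1 / d) \<le> \<rho> * y ^ d"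
        using slice_cdf_lower[OF d1, of t] t y by (simp add: c_def y_def \<rho>_def)
      hence "c / sqrt (t\<^sup>2 + 1 / d) \<le> \<rho>" using y pos by (simp add: field_simps)
      hence "c / \<rho> \<le> sqrt (t\<^sup>2 + 1 / d)" using pos \<rho> by (simp add: field_simps)
      hence "(c / \<rho>)\<^sup>2 \<le> (sqrt (t\<^sup>2 + 1 / d))\<^sup>2" using c \<rho> by (intro power_mono) auto
      thus ?thesis using pos by (simp add: power_divide)
    qed
    ultimately show ?thesis by linarith
  qed
  hence "c\<^sup>2 / \<rho>\<^sup>2 + y \<le> 1 / k" using inv_k by (simp add: y_def)
  hence "k * \<rho>\<^sup>2 * (c\<^sup>2 / \<rho>\<^sup>2 + y) \<le> k * \<rho>\<^sup>2 * (1 / k)" using k by (intro mult_left_mono) auto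
  moreover have "k * \<rho>\<^sup>2 * (c\<^sup>2 / \<rho>\<^sup>2 + y) = k * (c\<^sup>2 + \<rho>\<^sup>2 * y)" using \<rho> by (simp add: field_simps)
  ultimately have "k * c\<^sup>2 \<le> \<rho>\<^sup>2 * (1 - k * y)" using k by (simp add: field_simps)
  also have "\<rho>\<^sup>2 = k * k ^ (2 * d - 1)"
    using d by (simp add: kd[symmetric] power_mult[symmetric] mult.commute flip: power_Suc)
  finally have "k * c\<^sup>2 \<le> k * (k ^ (2 * d - 1) * (1 - k * y))" by (simp only: mult.assoc)
  hence "c\<^sup>2 \<le> k ^ (2 * d - 1) * (1 - k * y)" using k by simp
  hence "c\<^sup>2 * y ^ (2 * d - 1) \<le> k ^ (2 * d - 1) * (1 - k * y) * y ^ (2 * d - 1)"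
    using y by (intro mult_right_mono) auto
  also have "\<dots> = (k * y) ^ (2 * d - 1) * (1 - k * y)" by (simp add: power_mult_distrib mult_ac)
  also have "k * y = n\<^sup>2" using y by (simp add: k_def)
  also have "(n\<^sup>2) ^ (2 * d - 1) = n ^ (4 * d - 2)"
    by (simp add: power_mult[symmetric] diff_mult_distrib2)
  finally show ?thesis by (simp add: c_def y_def)
qed

text \<open>Now \<open>F \<ge> 1 / 2\<close>, and \<open>n\<close> is eliminated: Bernoulli's
  inequality gives \<open>1 - F \<le> d * (1 - n^2)\<close>, and \<open>n < 1\<close> gives
  \<open>F^2 = n^(4 * d) \<le> n^(4 * d - 2)\<close>. What remains is \<open>main\<close>, which
  involves \<open>F\<close> and \<open>y\<close> only.\<close>

lemma radius_estimate_upper_half: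
  assumes d: "d \<ge> 2" and t: "0 \<le> t" "t < 1" and n: "0 < n" "n ^ (2 * d) = slice_cdf d t"
  shows "(slice_const d)\<^sup>2 * (1 - t\<^sup>2) ^ (2 * d - 1) \<le> n ^ (4 * d - 2) * (1 - n\<^sup>2)"
proof -
  define y where "y = 1 - t\<^sup>2"
  define c where "c = slice_const d"
  define F where "F = slice_cdf d t"
  have d1: "d \<ge> 1" using d by simp
  have y: "0 < y" "y \<le> 1" using one_minus_square_pos[of t] t by (auto simp: y_def)
  have c: "c > 0" using slice_const_pos[OF d1] by (simp add: c_def)
  have F: "1 / 2 \<le> F" "F < 1"
    using slice_cdf_bounds[of t d] slice_cdf_strict_mono[of 0 t d] slice_cdf_0[of d] t
    by (cases "t = 0"; auto simp: F_def)+
  have n1: "n < 1"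
    using power_less_imp_less_base[of n "2 * d" 1] n F by (simp add: F_def)
  have F2: "F\<^sup>2 \<le> n ^ (4 * d - 2)"
  proof -
    have "F\<^sup>2 = n ^ (4 * d)"
      unfolding F_def n(2)[symmetric] by (simp flip: power_mult)
    also have "\<dots> \<le> n ^ (4 * d - 2)" using n n1 by (intro power_decreasing) auto
    finally show ?thesis .
  qed
  have F1: "1 - F \<le> d * (1 - n\<^sup>2)"
  proof -
    have "1 + real d * (n\<^sup>2 - 1) \<le> (1 + (n\<^sup>2 - 1)) ^ d"
      by (rule Bernoulli_inequality) simp
    also have "\<dots> = F" using n by (simp add: F_def power_mult)
    finally show ?thesis by (simp add: algebra_simps)
  qed
  \<comment> \<open>For \<open>F \<le> 3 / 4\<close> the right side is at least
    \<open>1 / 2 * 3 / 16\<close>, above the uniform bound 1/12. For larger \<open>F\<close> the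
    small factor \<open>1 - F\<close> is the value of the distribution function at
    \<open>- t\<close>, so \<open>slice_cdf_lower\<close> applies to it, and
    \<open>F^2 \<ge> 9 / 16\<close>.\<close>
  have main: "d * c\<^sup>2 * y ^ (2 * d - 1) \<le> F\<^sup>2 * (1 - F)"
  proof (cases "F \<le> 3 / 4")
    case True
    have "d * c\<^sup>2 * y ^ (2 * d - 1) \<le> (1 / 12) * 1"
      using slice_const_bound[OF d1] y by (intro mult_mono power_le_one) (auto simp: c_def)
    also have "\<dots> \<le> (1 / 2) * (3 / 16 :: real)" by simp
    also have "\<dots> \<le> F * (F * (1 - F))"
    proof (rule mult_mono)
      have "0 \<le> (F - 1 / 4) * (3 / 4 - F)" using F True by (intro mult_nonneg_nonneg) auto
      thus "3 / 16 \<le> F * (1 - F)" by (simp add: field_simps)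
    qed (use F in auto)
    finally show ?thesis by (simp add: power2_eq_square)
  next
    case False
    define q where "q = sqrt (t\<^sup>2 + 1 / d)"
    have pos: "t\<^sup>2 + 1 / d > 0" using d by (simp add: add_nonneg_pos)
    hence q: "q > 0" by (simp add: q_def)
    have low: "c * y ^ d / q \<le> 1 - F"
      using slice_cdf_lower[OF d1, of "-t"] slice_cdf_minus[of t d] t by (simp add: c_def y_def q_def F_def)
    \<comment> \<open>The square is \<open>d * c^2\<close> times
      \<open>y^(2 * d - 2) * (1 + d * t^2)\<close>. The second factor is at most
      \<open>(y * (1 + t^2))^d \<le> 1\<close>, which uses \<open>2 * d - 2 \<ge> d\<close>.\<close>
    have "real d * c * y ^ (d - 1) * q \<le> 9 / 16"
    proof (rule power2_le_imp_le)
      have "y ^ (2 * d - 2) * (1 + real d * t\<^sup>2) \<le> 1"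
      proof -
        have "y ^ (2 * d - 2) * (1 + real d * t\<^sup>2) \<le> y ^ d * (1 + t\<^sup>2) ^ d"
          using y d Bernoulli_inequality[of "t\<^sup>2" d]
          by (intro mult_mono power_decreasing) (auto simp: order.trans[of "-1" 0])
        also have "\<dots> = (y * (1 + t\<^sup>2)) ^ d" by (simp add: power_mult_distrib)
        also have "\<dots> \<le> 1"
        proof (rule power_le_one)
          have "y * (1 + t\<^sup>2) = 1 - (t\<^sup>2)\<^sup>2" by (simp add: y_def power2_eq_square algebra_simps)
          thus "y * (1 + t\<^sup>2) \<le> 1" by simp
        qed (use y in auto)
        finally show ?thesis .
      qed
      hence le: "(d * c\<^sup>2) * (y ^ (2 * d - 2) * (1 + real d * t\<^sup>2)) \<le> (1 / 12) * 1"
        using slice_const_bound[OF d1] y by (intro mult_mono) (auto simp: c_def)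
      have "q\<^sup>2 = t\<^sup>2 + 1 / d" using pos by (simp add: q_def)
      hence "real d * q\<^sup>2 = 1 + real d * t\<^sup>2" using d by (simp add: field_simps)
      moreover have "(y ^ (d - 1))\<^sup>2 = y ^ (2 * d - 2)"
        by (simp add: power_mult[symmetric] diff_mult_distrib2 mult.commute)
      ultimately have "(real d * c * y ^ (d - 1) * q)\<^sup>2 = (d * c\<^sup>2) * (y ^ (2 * d - 2) * (1 + real d * t\<^sup>2))"
        by (simp add: power_mult_distrib power2_eq_square mult_ac)
      also have "\<dots> \<le> (9 / 16)\<^sup>2" using le by (simp add: power2_eq_square)
      finally show "(real d * c * y ^ (d - 1) * q)\<^sup>2 \<le> (9 / 16)\<^sup>2" .
    qed simp
    hence "(real d * c * y ^ (d - 1) * q) * (c * y ^ d / q) \<le> (9 / 16) * (1 - F)"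
      using low c y q by (intro mult_mono) auto
    also have "\<dots> \<le> F\<^sup>2 * (1 - F)"
      using False F power_mono[of "3/4" F 2] by (intro mult_right_mono) (auto simp: power2_eq_square)
    also have "(real d * c * y ^ (d - 1) * q) * (c * y ^ d / q) = d * c\<^sup>2 * y ^ (2 * d - 1)"
    proof -
      have "y ^ (2 * d - 1) = y ^ (d - 1) * y ^ d"
      proof -
        have "2 * d - 1 = (d - 1) + d" using d by simp
        thus ?thesis by (simp only: power_add)
      qed
      thus ?thesis using q by (simp add: power2_eq_square)
    qed
    finally show ?thesis .
  qed
  have "F\<^sup>2 * (1 - F) \<le> n ^ (4 * d - 2) * (d * (1 - n\<^sup>2))"
    using F2 F1 F n by (intro mult_mono) auto
  hence "d * (c\<^sup>2 * y ^ (2 * d - 1)) \<le> d * (n ^ (4 * d - 2) * (1 - n\<^sup>2))"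
    using main by (simp add: mult_ac)
  thus ?thesis using d by (simp add: c_def y_def)
qed

text \<open>With \<open>n = sin a\<close> and \<open>t = - cos \<theta>\<close> this says \<open>da/d\<theta> \<le> 1\<close>: the map \<open>\<theta> \<mapsto> a\<close> comparing
  the polar angle on the sphere with the one in projective space is a contraction.\<close>

lemma radius_contraction:
  assumes d: "d \<ge> 2" and t: "-1 < t" "t < 1" and t': "-1 < t'" "t' < 1"
    and n: "0 \<le> n" "n ^ (2 * d) = slice_cdf d t" and n': "0 \<le> n'" "n' ^ (2 * d) = slice_cdf d t'"
  shows "t * t' + sqrt (1 - t\<^sup>2) * sqrt (1 - t'\<^sup>2) \<le> n * n' + sqrt (1 - n\<^sup>2) * sqrt (1 - n'\<^sup>2)"
proof -
  define \<nu> where "\<nu> = (\<lambda>t. slice_cdf d t powr (1 / (2 * d)))"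
  \<comment> \<open>For \<open>t = - cos \<theta>\<close> the angle \<open>arcsin t\<close> is
    \<open>\<theta>\<close> up to a constant, so monotonicity of \<open>D\<close> says that the
    angle of \<open>\<nu> t\<close> grows no faster than \<open>\<theta>\<close>.\<close>
  define D where "D = (\<lambda>t. arcsin t - arcsin (\<nu> t))"
  have nu_pos: "0 < \<nu> x" and nu_pow: "\<nu> x ^ (2 * d) = slice_cdf d x" and nu_lt: "\<nu> x < 1"
    if x: "-1 < x" "x < 1" for x
  proof -
    note F = slice_cdf_bounds[OF x, of d]
    show "0 < \<nu> x" using F by (simp add: \<nu>_def)
    show pow: "\<nu> x ^ (2 * d) = slice_cdf d x"
      using F d by (simp add: \<nu>_def powr_realpow[symmetric] powr_powr)
    show "\<nu> x < 1"
      using power_less_imp_less_base[of "\<nu> x" "2 * d" 1] F \<open>0 < \<nu> x\<close> pow by simp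
  qed
  have nu_eq: "m = \<nu> x" if "-1 < x" "x < 1" "0 \<le> m" "m ^ (2 * d) = slice_cdf d x" for m x
    using power_eq_imp_eq_base[of m "2 * d" "\<nu> x"] nu_pow[of x] nu_pos[of x] that d by simp
  have DD: "\<exists>z. (D has_real_derivative z) (at x) \<and> 0 \<le> z" if x: "-1 < x" "x < 1" for x
  proof -
    define F where "F = slice_cdf d x"
    define y where "y = 1 - x\<^sup>2"
    define m where "m = \<nu> x"
    note F = slice_cdf_bounds[OF x, of d, folded F_def]
    have y: "y > 0" using one_minus_square_pos[OF x] by (simp add: y_def)
    have m: "0 < m" "m < 1" "m ^ (2 * d) = F" using nu_pos[OF x] nu_lt[OF x] nu_pow[OF x] by (auto simp: m_def F_def)
    have m2: "0 < 1 - m\<^sup>2" using one_minus_square_pos[of m] m by simp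
    define r where "r = slice_const d * y ^ (d - 1) * m / F"
    have "(\<nu> has_real_derivative (1 / (2 * d)) * F powr (1 / (2 * d) - 1) * (y ^ (d - 1) / slice_integral d 1)) (at x)"
      unfolding \<nu>_def F_def y_def
      by (rule DERIV_chain2[OF has_real_derivative_powr slice_cdf_has_derivative[OF x]]) (use F in \<open>simp add: F_def\<close>)
    also have "(1 / (2 * d)) * F powr (1 / (2 * d) - 1) * (y ^ (d - 1) / slice_integral d 1) = r"
      using F by (simp add: r_def slice_const_def powr_diff m_def \<nu>_def F_def mult_ac)
    finally have D\<nu>: "(\<nu> has_real_derivative r) (at x)" .
    have "(D has_real_derivative inverse (sqrt (1 - x\<^sup>2)) - inverse (sqrt (1 - (\<nu> x)\<^sup>2)) * r) (at x)"
      unfolding D_def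
      by (intro DERIV_diff DERIV_chain2[OF DERIV_arcsin D\<nu>] DERIV_arcsin) (use x m in \<open>auto simp: m_def\<close>)
    \<comment> \<open>Multiplied by \<open>m^2 / F^2\<close>, the radius estimate reads
      \<open>r^2 * y \<le> 1 - m^2\<close>, where \<open>r\<close> is the derivative of
      \<open>\<nu>\<close>.\<close>
    moreover have "inverse (sqrt (1 - (\<nu> x)\<^sup>2)) * r \<le> inverse (sqrt (1 - x\<^sup>2))"
    proof -
      have "(slice_const d)\<^sup>2 * y ^ (2 * d - 1) \<le> m ^ (4 * d - 2) * (1 - m\<^sup>2)"
        using radius_estimate_lower_half[OF d x(1) _ m(1)] radius_estimate_upper_half[OF d _ x(2) m(1)] m(3)
        by (cases "x \<le> 0") (auto simp: F_def y_def)
      hence "m\<^sup>2 * ((slice_const d)\<^sup>2 * y ^ (2 * d - 1)) \<le> m\<^sup>2 * (m ^ (4 * d - 2) * (1 - m\<^sup>2))"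
        by (intro mult_left_mono) auto
      also have "m\<^sup>2 * (m ^ (4 * d - 2) * (1 - m\<^sup>2)) = F\<^sup>2 * (1 - m\<^sup>2)"
      proof -
        have "m\<^sup>2 * m ^ (4 * d - 2) = F\<^sup>2"
        proof -
          have "2 + (4 * d - 2) = 2 * d * 2" using d by simp
          thus ?thesis by (simp only: m(3)[symmetric] power_add[symmetric] power_mult[symmetric])
        qed
        thus ?thesis by (simp only: mult.assoc[symmetric])
      qed
      also have "m\<^sup>2 * ((slice_const d)\<^sup>2 * y ^ (2 * d - 1)) = (F * r)\<^sup>2 * y"
      proof -
        have "y ^ (2 * d - 1) = (y ^ (d - 1))\<^sup>2 * y"
        proof -
          have "2 * d - 1 = (d - 1) * 2 + 1" using d by simp
          thus ?thesis by (simp only: power_add power_mult power_one_right)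
        qed
        thus ?thesis using F by (simp add: r_def power_mult_distrib power_divide mult_ac)
      qed
      finally have "F\<^sup>2 * (r\<^sup>2 * y) \<le> F\<^sup>2 * (1 - m\<^sup>2)" by (simp add: power_mult_distrib mult_ac)
      hence "r\<^sup>2 * y \<le> 1 - m\<^sup>2" using F by simp
      hence "sqrt (r\<^sup>2 * y) \<le> sqrt (1 - m\<^sup>2)" by simp
      moreover have "r \<ge> 0" using slice_const_pos[of d] d y m F by (simp add: r_def)
      ultimately have "r * sqrt y \<le> sqrt (1 - m\<^sup>2)" by (simp add: real_sqrt_mult)
      thus ?thesis using y m2 by (simp add: y_def[symmetric] m_def[symmetric] field_simps)
    qed
    ultimately show ?thesis by (intro exI conjI) auto
  qed
  have le: "x * x' + sqrt (1 - x\<^sup>2) * sqrt (1 - x'\<^sup>2) \<le> \<nu> x * \<nu> x' + sqrt (1 - (\<nu> x)\<^sup>2) * sqrt (1 - (\<nu> x')\<^sup>2)"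
    if x: "-1 < x" "x \<le> x'" "x' < 1" for x x'
  proof -
    have x1: "x < 1" "-1 < x'" using x by auto
    have "D x \<le> D x'"
      by (rule DERIV_nonneg_imp_nondecreasing[OF x(2)]) (use DD x in auto)
    hence "arcsin (\<nu> x') - arcsin (\<nu> x) \<le> arcsin x' - arcsin x" by (simp add: D_def)
    moreover have "\<nu> x \<le> \<nu> x'"
    proof (rule power_le_imp_le_base)
      have "slice_cdf d x \<le> slice_cdf d x'" using slice_cdf_strict_mono[of x x' d] x by (cases "x = x'") auto
      moreover have "Suc (2 * d - 1) = 2 * d" using d by simp
      ultimately show "\<nu> x ^ Suc (2 * d - 1) \<le> \<nu> x' ^ Suc (2 * d - 1)"
        using nu_pow[of x] nu_pow[of x'] x x1 by (simp only:)
    qed (use nu_pos[of x'] x x1 in simp)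
    hence "0 \<le> arcsin (\<nu> x') - arcsin (\<nu> x)"
      using nu_pos[of x] nu_lt[of x'] x x1 by (simp add: arcsin_le_mono)
    moreover have "arcsin x' - arcsin x \<le> pi"
      using arcsin_bounded[of x'] arcsin_bounded[of x] x by linarith
    \<comment> \<open>Cosine is decreasing on the interval from 0 to \<open>pi\<close>; its addition
      formula turns the comparison of angle differences into the stated inequality.\<close>
    ultimately have "cos (arcsin x' - arcsin x) \<le> cos (arcsin (\<nu> x') - arcsin (\<nu> x))"
      by (intro cos_monotone_0_pi_le) auto
    thus ?thesis
      using nu_pos[of x] nu_lt[of x] nu_pos[of x'] nu_lt[of x'] x x1
      by (simp add: cos_diff cos_arcsin mult_ac)
  qed
  have "n = \<nu> t" "n' = \<nu> t'" using nu_eq t t' n n' by auto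
  thus ?thesis using le[of t t'] le[of t' t] t t' by (cases "t \<le> t'") (auto simp: mult_ac)
qed

text \<open>On the lower half \<open>slice_cdf_upper\<close> already gives
  \<open>n^2 \<le> 1 - t^2\<close>. On the upper half \<open>n \<le> 1\<close>, and
  \<open>t \<le> T\<close> makes the right-hand side at least 1.\<close>

lemma radius_slice_bound:
  assumes d: "d \<ge> 1" and t: "-1 < t" "t \<le> T" and T: "0 \<le> T" "T < 1"
    and n: "0 \<le> n" "n ^ (2 * d) = slice_cdf d t"
  shows "n \<le> sqrt (1 - t\<^sup>2) / sqrt (1 - T\<^sup>2)"
proof -
  have T2: "0 < 1 - T\<^sup>2" "1 - T\<^sup>2 \<le> 1" using one_minus_square_pos[of T] T by auto
  have y: "0 < 1 - t\<^sup>2" using one_minus_square_pos[of t] t T by auto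
  have "n\<^sup>2 \<le> (1 - t\<^sup>2) / (1 - T\<^sup>2)"
  proof (cases "t \<le> 0")
    case True
    have "(n\<^sup>2) ^ Suc (d - 1) \<le> (1 - t\<^sup>2) ^ Suc (d - 1)"
      using slice_cdf_upper[OF d t(1) True] n d zero_less_power[OF y, of d]
      by (simp add: power_mult del: power_Suc)
    hence "n\<^sup>2 \<le> 1 - t\<^sup>2" by (rule power_le_imp_le_base) (use y in simp)
    also have "\<dots> \<le> (1 - t\<^sup>2) / (1 - T\<^sup>2)" using T2 y by (simp add: pos_le_divide_eq mult_left_le)
    finally show ?thesis .
  next
    case False
    have "n ^ Suc (2 * d - 1) \<le> 1 ^ Suc (2 * d - 1)"
      using slice_cdf_bounds[of t d] n t T d by (simp del: power_Suc)
    hence "n \<le> 1" by (rule power_le_imp_le_base) simp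
    hence "n\<^sup>2 \<le> 1" using n by (simp add: power_le_one)
    also have "\<dots> \<le> (1 - t\<^sup>2) / (1 - T\<^sup>2)"
      using False t T T2 power_mono[of t T 2] by (simp add: pos_le_divide_eq)
    finally show ?thesis .
  qed
  hence "sqrt (n\<^sup>2) \<le> sqrt ((1 - t\<^sup>2) / (1 - T\<^sup>2))" by (rule real_sqrt_le_mono)
  thus ?thesis using n by (simp add: real_sqrt_divide)
qed

section \<open>Integration by parts\<close>

text \<open>The common dominating function on real dimension \<open>2 * d\<close>: the exponent is
  the least integer for which the power of \<open>1 / sqrt (1 + norm x ^ 2)\<close> is integrable
  there.\<close>

definition decay :: "nat \<Rightarrow> 'a::euclidean_space \<Rightarrow> real" where
  "decay d x = (1 / sqrt (1 + (norm x)\<^sup>2)) ^ (2 * d + 1)"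

lemma decay_nonneg: "0 \<le> decay d x"
  by (simp add: decay_def)

lemma borel_measurable_decay [measurable]: "decay d \<in> borel_measurable borel"
  unfolding decay_def[abs_def] by measurable

lemma nn_integral_radial:
  fixes f :: "real \<Rightarrow> ennreal"
  assumes [measurable]: "f \<in> borel_measurable borel"
  shows "(\<integral>\<^sup>+x. f (norm x) \<partial>(lborel :: 'a::euclidean_space measure)) =
    ennreal (sphere_vol TYPE('a)) * (\<integral>\<^sup>+r. ennreal (r ^ (DIM('a) - 1)) * indicator {0<..} r * f r \<partial>lborel)"
proof -
  have "(\<integral>\<^sup>+x. f (norm x) \<partial>(lborel :: 'a measure)) =
    (\<integral>\<^sup>+u. \<integral>\<^sup>+r. ennreal (r ^ (DIM('a) - 1)) * indicator {0<..} r * f (norm (r *\<^sub>R u)) \<partial>lborel \<partial>(sphere_measure :: 'a measure))"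
    by (rule nn_integral_polar) simp
  also have "\<dots> = (\<integral>\<^sup>+u. \<integral>\<^sup>+r. ennreal (r ^ (DIM('a) - 1)) * indicator {0<..} r * f r \<partial>lborel \<partial>(sphere_measure :: 'a measure))"
    by (intro nn_integral_cong) (auto simp: indicator_def)
  finally show ?thesis by (simp add: emeasure_sphere_vol mult.commute)
qed

text \<open>In polar coordinates \<open>r \<le> sqrt (1 + r^2)\<close> reduces every
  \<open>d\<close> to the integrand \<open>r / sqrt (1 + r^2) ^ 3\<close>, which has an explicit
  primitive.\<close>

lemma integrable_decay:
  assumes d: "DIM('a::euclidean_space) = 2 * d"
  shows "integrable lborel (decay d :: 'a \<Rightarrow> real)"
proof (rule integrableI_bounded)
  have d1: "d \<ge> 1" using d DIM_positive[where 'a='a] by linarith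
  have "(\<integral>\<^sup>+x. ennreal (norm (decay d x)) \<partial>(lborel :: 'a measure)) =
    (\<integral>\<^sup>+x. ennreal ((1 / sqrt (1 + (norm x)\<^sup>2)) ^ (2 * d + 1)) \<partial>(lborel :: 'a measure))"
    by (simp add: decay_nonneg) (simp add: decay_def)
  also have "\<dots> = ennreal (sphere_vol TYPE('a)) * (\<integral>\<^sup>+r. ennreal (r ^ (2 * d - 1)) * indicator {0<..} r * ennreal ((1 / sqrt (1 + r\<^sup>2)) ^ (2 * d + 1)) \<partial>lborel)"
    by (subst nn_integral_radial) (auto simp: d)
  finally have eq: "(\<integral>\<^sup>+x. ennreal (norm (decay d x)) \<partial>(lborel :: 'a measure)) = \<dots>" .
  have "(\<integral>\<^sup>+r. ennreal (r ^ (2 * d - 1)) * indicator {0<..} r * ennreal ((1 / sqrt (1 + r\<^sup>2)) ^ (2 * d + 1)) \<partial>lborel) \<le>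
    (\<integral>\<^sup>+r. ennreal (r / (sqrt (1 + r\<^sup>2)) ^ 3) * indicator {0..} r \<partial>lborel)"
  proof (rule nn_integral_mono)
    fix r :: real
    show "ennreal (r ^ (2 * d - 1)) * indicator {0<..} r * ennreal ((1 / sqrt (1 + r\<^sup>2)) ^ (2 * d + 1)) \<le>
      ennreal (r / (sqrt (1 + r\<^sup>2)) ^ 3) * indicator {0..} r"
    proof (cases "r > 0")
      case True
      define q where "q = sqrt (1 + r\<^sup>2)"
      have q: "q > 0" by (simp add: q_def add_pos_nonneg)
      have rq: "r \<le> q" unfolding q_def by (rule real_le_rsqrt) simp
      have e: "2 * d - 1 = 1 + (2 * d - 2)" "2 * d + 1 = 3 + (2 * d - 2)" using d1 by auto
      have "r ^ (2 * d - 1) * (1 / q) ^ (2 * d + 1) = (r / q ^ 3) * (r / q) ^ (2 * d - 2)"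
        unfolding e power_add by (simp add: power_divide)
      also have "\<dots> \<le> (r / q ^ 3) * 1"
        using True q rq by (intro mult_left_mono power_le_one) auto
      finally have "r ^ (2 * d - 1) * (1 / q) ^ (2 * d + 1) \<le> r / q ^ 3" by simp
      thus ?thesis using True q by (simp add: q_def[symmetric] ennreal_mult[symmetric] ennreal_leI)
    qed auto
  qed
  also have "(\<integral>\<^sup>+r. ennreal (r / (sqrt (1 + r\<^sup>2)) ^ 3) * indicator {0..} r \<partial>lborel) = ennreal (0 - - (1 / sqrt (1 + 0\<^sup>2)))"
  proof (rule nn_integral_FTC_atLeast[where F = "\<lambda>r. - (1 / sqrt (1 + r\<^sup>2))"])
    fix r :: real assume "0 \<le> r"
    have p: "1 + r\<^sup>2 > 0" by (simp add: add_pos_nonneg)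
    define q where "q = sqrt (1 + r\<^sup>2)"
    have q: "q > 0" using p by (simp add: q_def)
    have "((\<lambda>r. - (1 / sqrt (1 + r\<^sup>2))) has_real_derivative - (- ((2 * r) * (inverse q / 2)) / (q * q))) (at r)"
      unfolding q_def using p by (auto intro!: derivative_eq_intros)
    also have "- (- ((2 * r) * (inverse q / 2)) / (q * q)) = r / q ^ 3"
      using q by (simp add: field_simps power3_eq_cube)
    finally show "((\<lambda>r. - (1 / sqrt (1 + r\<^sup>2))) has_real_derivative r / sqrt (1 + r\<^sup>2) ^ 3) (at r)"
      by (simp add: q_def)
    show "0 \<le> r / sqrt (1 + r\<^sup>2) ^ 3" using \<open>0 \<le> r\<close> by simp
  next
    show "((\<lambda>r::real. - (1 / sqrt (1 + r\<^sup>2))) \<longlongrightarrow> 0) at_top" by real_asymp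
  qed simp
  finally have "(\<integral>\<^sup>+r. ennreal (r ^ (2 * d - 1)) * indicator {0<..} r * ennreal ((1 / sqrt (1 + r\<^sup>2)) ^ (2 * d + 1)) \<partial>lborel) < \<infinity>"
    by (rule order.strict_trans1) simp
  thus "(\<integral>\<^sup>+x. ennreal (norm (decay d x)) \<partial>(lborel :: 'a measure)) < \<infinity>"
    unfolding eq by (simp add: ennreal_mult_less_top)
qed simp

text \<open>A bounded shift costs only a constant factor, so a single integrable function dominates
  all the difference quotients.\<close>

lemma decay_translate:
  fixes x v :: "'a::euclidean_space"
  assumes "\<bar>h\<bar> \<le> 1"
  shows "decay d (x + h *\<^sub>R v) \<le> sqrt (2 + 2 * (norm v)\<^sup>2) ^ (2 * d + 1) * decay d x"
proof -
  define A where "A = 2 + 2 * (norm v)\<^sup>2"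
  let ?y = "x + h *\<^sub>R v"
  have "norm x \<le> norm ?y + norm (h *\<^sub>R v)" using norm_triangle_ineq4[of ?y "h *\<^sub>R v"] by simp
  also have "norm (h *\<^sub>R v) \<le> norm v" using assms by (simp add: mult_left_le_one_le)
  finally have "(norm x)\<^sup>2 \<le> (norm ?y + norm v)\<^sup>2" by (intro power_mono) auto
  also have "\<dots> \<le> 2 * (norm ?y)\<^sup>2 + 2 * (norm v)\<^sup>2"
    using sum_squares_bound[of "norm ?y" "norm v"] by (simp add: power2_sum)
  finally have "1 + (norm x)\<^sup>2 \<le> 2 * (1 + (norm ?y)\<^sup>2) + 2 * (norm v)\<^sup>2 * 1" by simp
  also have "\<dots> \<le> 2 * (1 + (norm ?y)\<^sup>2) + 2 * (norm v)\<^sup>2 * (1 + (norm ?y)\<^sup>2)"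
    by (intro add_left_mono mult_left_mono) auto
  also have "\<dots> = A * (1 + (norm ?y)\<^sup>2)" by (simp add: A_def algebra_simps)
  finally have "sqrt (1 + (norm x)\<^sup>2) \<le> sqrt A * sqrt (1 + (norm ?y)\<^sup>2)"
    by (simp flip: real_sqrt_mult)
  moreover have p: "sqrt (1 + (norm y)\<^sup>2) > 0" for y :: 'a by (simp add: add_pos_nonneg)
  ultimately have "1 / sqrt (1 + (norm ?y)\<^sup>2) \<le> sqrt A * (1 / sqrt (1 + (norm x)\<^sup>2))"
    using p[of x] p[of ?y] by (simp add: field_simps)
  hence "decay d ?y \<le> (sqrt A * (1 / sqrt (1 + (norm x)\<^sup>2))) ^ (2 * d + 1)"
    unfolding decay_def by (intro power_mono) auto
  also have "\<dots> = sqrt A ^ (2 * d + 1) * decay d x"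
    unfolding decay_def by (rule power_mult_distrib)
  finally show ?thesis by (simp only: A_def)
qed

lemma integral_lborel_translate:
  fixes f :: "'a::euclidean_space \<Rightarrow> complex"
  assumes [measurable]: "f \<in> borel_measurable borel"
  shows "(\<integral>x. f (x + a) \<partial>lborel) = (\<integral>x. f x \<partial>lborel)"
    and "integrable lborel f \<Longrightarrow> integrable lborel (\<lambda>x. f (x + a))"
proof -
  have "(\<integral>x. f x \<partial>lborel) = (\<integral>x. f x \<partial>distr lborel borel ((+) a))"
    by (simp add: lborel_distr_plus)
  also have "\<dots> = (\<integral>x. f (x + a) \<partial>lborel)"
    by (subst integral_distr) (auto simp: add.commute)
  finally show "(\<integral>x. f (x + a) \<partial>lborel) = (\<integral>x. f x \<partial>lborel)" ..
  assume "integrable lborel f"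
  hence "integrable (distr lborel borel ((+) a)) f" by (simp add: lborel_distr_plus)
  thus "integrable lborel (\<lambda>x. f (x + a))"
    by (subst (asm) integrable_distr_eq) (auto simp: add.commute)
qed

text \<open>Dominated convergence for the difference quotients, whose integrals are zero by
  translation invariance.\<close>

lemma integral_directional_derivative:
  fixes f f' :: "'a::euclidean_space \<Rightarrow> complex"
  assumes d: "DIM('a) = 2 * d"
    and [measurable]: "f \<in> borel_measurable borel" "f' \<in> borel_measurable borel"
    and deriv: "\<And>x. ((\<lambda>h. f (x + h *\<^sub>R v)) has_vector_derivative f' x) (at 0)"
    and bf: "\<And>x. norm (f x) \<le> C * decay d x" and bf': "\<And>x. norm (f' x) \<le> C * decay d x"
  shows "integrable lborel f'" "(\<integral>x. f' x \<partial>lborel) = 0"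
proof -
  have C: "C \<ge> 0"
  proof -
    have "0 \<le> C * decay d (0::'a)" using bf[of 0] norm_ge_zero order_trans by blast
    thus ?thesis by (simp add: decay_def)
  qed
  have int_dec: "integrable lborel (\<lambda>x::'a. C * decay d x)"
    by (intro integrable_mult_right integrable_decay d)
  have intf: "integrable lborel f"
    by (rule Bochner_Integration.integrable_bound[OF int_dec]) (use bf C in \<open>auto simp: abs_mult abs_of_nonneg[OF decay_nonneg]\<close>)
  show intf': "integrable lborel f'"
    by (rule Bochner_Integration.integrable_bound[OF int_dec]) (use bf' C in \<open>auto simp: abs_mult abs_of_nonneg[OF decay_nonneg]\<close>)
  define B where "B = sqrt (2 + 2 * (norm v)\<^sup>2) ^ (2 * d + 1)"
  define g where "g = (\<lambda>(k::nat) x. (f (x + (1 / Suc k) *\<^sub>R v) - f x) /\<^sub>R (1 / Suc k))"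
  \<comment> \<open>The derivative is only assumed at \<open>h = 0\<close>, but at every base point;
    moving the base point gives it along the whole line.\<close>
  have deriv': "((\<lambda>h. f (x + h *\<^sub>R v)) has_vector_derivative f' (x + a *\<^sub>R v)) (at a)" for x a
  proof -
    have "((\<lambda>h. h - a) has_vector_derivative 1) (at a)"
      by (auto intro!: derivative_eq_intros)
    from vector_diff_chain_at[OF this, of "\<lambda>h. f ((x + a *\<^sub>R v) + h *\<^sub>R v)" "f' (x + a *\<^sub>R v)"]
    have "((\<lambda>h. f ((x + a *\<^sub>R v) + (h - a) *\<^sub>R v)) has_vector_derivative f' (x + a *\<^sub>R v)) (at a)"
      using deriv[of "x + a *\<^sub>R v"] by (simp add: o_def)
    thus ?thesis by (simp add: algebra_simps)
  qed
  have zero: "(\<integral>x. g k x \<partial>lborel) = 0" for k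
  proof -
    have "integrable lborel (\<lambda>x. f (x + (1 / Suc k) *\<^sub>R v))" by (rule integral_lborel_translate(2)[OF _ intf]) simp
    thus ?thesis unfolding g_def
      by (simp add: intf integral_lborel_translate(1))
  qed
  have "(\<lambda>k. \<integral>x. g k x \<partial>lborel) \<longlonglongrightarrow> (\<integral>x. f' x \<partial>lborel)"
  proof (rule integral_dominated_convergence)
    show "integrable lborel (\<lambda>x::'a. C * B * decay d x)"
      by (intro integrable_mult_right integrable_decay d)
    show "g k \<in> borel_measurable lborel" for k unfolding g_def by measurable
    show "AE x in lborel. (\<lambda>k. g k x) \<longlonglongrightarrow> f' x"
    proof (rule AE_I2)
      fix x
      have "((\<lambda>h. (f (x + h *\<^sub>R v) - f x) /\<^sub>R h) \<longlongrightarrow> f' x) (at 0)"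
      proof (rule LIM_zero_cancel, rule tendsto_norm_zero_cancel, rule Lim_transform_eventually)
        show "((\<lambda>h. norm ((f (x + h *\<^sub>R v) - f x - h *\<^sub>R f' x) /\<^sub>R \<bar>h\<bar>)) \<longlongrightarrow> 0) (at 0)"
          using deriv[of x] by (intro tendsto_norm_zero) (simp add: has_vector_derivative_def has_derivative_at_within)
        have "norm ((f (x + h *\<^sub>R v) - f x - h *\<^sub>R f' x) /\<^sub>R \<bar>h\<bar>) = norm ((f (x + h *\<^sub>R v) - f x) /\<^sub>R h - f' x)"
          if "h \<noteq> 0" for h
        proof -
          have "(f (x + h *\<^sub>R v) - f x) /\<^sub>R h - f' x = (f (x + h *\<^sub>R v) - f x - h *\<^sub>R f' x) /\<^sub>R h"
            using that by (simp add: scaleR_diff_right)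
          thus ?thesis by simp
        qed
        thus "\<forall>\<^sub>F h in at 0. norm ((f (x + h *\<^sub>R v) - f x - h *\<^sub>R f' x) /\<^sub>R \<bar>h\<bar>) =
            norm ((f (x + h *\<^sub>R v) - f x) /\<^sub>R h - f' x)"
          by (simp add: eventually_at_filter)
      qed
      moreover have "filterlim (\<lambda>k. 1 / real (Suc k)) (at 0) sequentially"
        using LIMSEQ_inverse_real_of_nat
        by (auto simp: filterlim_at divide_inverse)
      ultimately show "(\<lambda>k. g k x) \<longlonglongrightarrow> f' x"
        unfolding g_def by (rule filterlim_compose)
    qed
    show "AE x in lborel. norm (g k x) \<le> C * B * decay d x" for k
    proof (rule AE_I2)
      fix x
      define e where "e = 1 / real (Suc k)"
      have e: "0 < e" "e \<le> 1" by (auto simp: e_def)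
      \<comment> \<open>Mean value inequality on the segment from 0 to \<open>e\<close>, along which
        \<open>decay_translate\<close> bounds the derivative uniformly.\<close>
      have "norm (f (x + e *\<^sub>R v) - f (x + 0 *\<^sub>R v)) \<le> norm (e - 0) * (C * B * decay d x)"
      proof (rule differentiable_bound[where S = "{0..e}" and f' = "\<lambda>a h. h *\<^sub>R f' (x + a *\<^sub>R v)" and f = "\<lambda>h. f (x + h *\<^sub>R v)", THEN order_trans])
        fix a assume a: "a \<in> {0..e}"
        show "((\<lambda>h. f (x + h *\<^sub>R v)) has_derivative (\<lambda>h. h *\<^sub>R f' (x + a *\<^sub>R v))) (at a within {0..e})"
          using deriv'[of x a] has_derivative_at_withinI unfolding has_vector_derivative_def by blast
        have "norm (f' (x + a *\<^sub>R v)) \<le> C * decay d (x + a *\<^sub>R v)" by (rule bf')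
        also have "\<dots> \<le> C * (B * decay d x)"
          unfolding B_def using a e C by (intro mult_left_mono decay_translate) auto
        finally have le: "norm (f' (x + a *\<^sub>R v)) \<le> C * B * decay d x" by simp
        show "onorm (\<lambda>h. h *\<^sub>R f' (x + a *\<^sub>R v)) \<le> C * B * decay d x"
          using mult_right_mono[OF le abs_ge_zero] by (intro onorm_le) (simp add: mult.commute)
      qed (use e in auto)
      moreover have "norm (g k x) = norm (f (x + e *\<^sub>R v) - f x) / e"
        unfolding g_def e_def[symmetric] norm_scaleR using e by (simp add: divide_inverse mult.commute)
      ultimately show "norm (g k x) \<le> C * B * decay d x"
        using e by (simp add: pos_divide_le_eq mult_ac)
    qed
  qed simp_all
  hence "(\<lambda>k::nat. 0) \<longlonglongrightarrow> (\<integral>x. f' x \<partial>lborel)" by (simp add: zero)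
  thus "(\<integral>x. f' x \<partial>lborel) = 0" by (metis LIMSEQ_unique tendsto_const)
qed

section \<open>Integrals against the Fubini-Study weight\<close>

definition herm :: "complex ^ 'n::finite \<Rightarrow> complex ^ 'n \<Rightarrow> complex" where
  "herm z y = (\<Sum>i\<in>UNIV. z $ i * cnj (y $ i))"

definition monom_fun :: "('n::finite \<Rightarrow> nat) \<Rightarrow> complex ^ 'n \<Rightarrow> complex" where
  "monom_fun \<alpha> z = (\<Prod>i\<in>UNIV. (z $ i) ^ \<alpha> i)"

text \<open>For \<open>j = L\<close> and \<open>k = d + L + 1\<close> this is, up to a constant, a
  weighted monomial times the conjugated kernel. General \<open>j\<close> and \<open>k\<close> are
  needed because derivatives lower \<open>\<alpha>\<close> or \<open>j\<close> and raise
  \<open>k\<close>.\<close>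

definition fs_integrand :: "complex ^ 'n::finite \<Rightarrow> ('n \<Rightarrow> nat) \<Rightarrow> nat \<Rightarrow> nat \<Rightarrow> complex ^ 'n \<Rightarrow> complex" where
  "fs_integrand y \<alpha> j k z =
     monom_fun \<alpha> z * cnj (1 + herm z y) ^ j * of_real (1 / (1 + (norm z)\<^sup>2) ^ k)"

lemma continuous_on_herm [continuous_intros]:
  "continuous_on S f \<Longrightarrow> continuous_on S (\<lambda>x. herm (f x) y)"
  unfolding herm_def by (intro continuous_intros)

lemma continuous_on_monom_fun [continuous_intros]:
  "continuous_on S f \<Longrightarrow> continuous_on S (\<lambda>x. monom_fun \<alpha> (f x))"
  unfolding monom_fun_def by (intro continuous_intros)

lemma one_plus_norm_pos: "0 < 1 + (norm z)\<^sup>2"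
  by (simp add: add_pos_nonneg)

lemma one_plus_norm_neq_0: "1 + (norm z)\<^sup>2 \<noteq> 0"
  using one_plus_norm_pos[of z] by linarith

lemma borel_measurable_fs_integrand [measurable]: "fs_integrand y \<alpha> j k \<in> borel_measurable borel"
  unfolding fs_integrand_def[abs_def]
  by (intro borel_measurable_continuous_onI continuous_intros)
     (auto simp: one_plus_norm_neq_0)

lemma norm_vec_square: "(norm z)\<^sup>2 = (\<Sum>i\<in>UNIV. (cmod (z $ i))\<^sup>2)" for z :: "complex ^ 'n::finite"
  by (simp add: norm_vec_def L2_set_def sum_nonneg)

lemma herm_self: "herm z z = of_real ((norm z)\<^sup>2)"
  unfolding norm_vec_square herm_def by (simp add: complex_norm_square del: of_real_power)

lemma norm_herm_le: "cmod (herm z y) \<le> norm z * norm y"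
proof -
  have "cmod (herm z y) \<le> (\<Sum>i\<in>UNIV. \<bar>norm (z $ i)\<bar> * \<bar>norm (y $ i)\<bar>)"
    unfolding herm_def by (rule order.trans[OF norm_sum]) (simp add: norm_mult)
  also have "\<dots> \<le> L2_set (\<lambda>i. norm (z $ i)) UNIV * L2_set (\<lambda>i. norm (y $ i)) UNIV"
    by (rule L2_set_mult_ineq)
  finally show ?thesis by (simp add: norm_vec_def)
qed

abbreviation radius_weight :: "complex ^ 'n::finite \<Rightarrow> real" where
  "radius_weight z \<equiv> sqrt (1 + (norm z)\<^sup>2)"

lemma radius_weight_ge: "1 \<le> radius_weight z" "norm z \<le> radius_weight z"
  by (simp, rule real_le_rsqrt) simp

lemma norm_monom_fun_le: "cmod (monom_fun \<alpha> z) \<le> radius_weight z ^ sum \<alpha> UNIV"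
proof -
  have "cmod (monom_fun \<alpha> z) = (\<Prod>i\<in>UNIV. cmod (z $ i) ^ \<alpha> i)"
    by (simp add: monom_fun_def prod_norm[symmetric] norm_power)
  also have "\<dots> \<le> (\<Prod>i\<in>UNIV. radius_weight z ^ \<alpha> i)"
  proof (intro prod_mono conjI power_mono)
    show "cmod (z $ i) \<le> radius_weight z" for i
      using Finite_Cartesian_Product.norm_nth_le[of z i] radius_weight_ge(2)[of z] by linarith
  qed auto
  also have "\<dots> = radius_weight z ^ sum \<alpha> UNIV" by (simp add: power_sum)
  finally show ?thesis .
qed

lemma norm_one_plus_herm_le: "cmod (1 + herm z y) \<le> (1 + norm y) * radius_weight z"
proof -
  have "cmod (1 + herm z y) \<le> 1 + norm z * norm y"
    using norm_triangle_ineq[of 1 "herm z y"] norm_herm_le[of z y] by simp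
  also have "\<dots> \<le> 1 * radius_weight z + norm y * radius_weight z"
    using radius_weight_ge[of z] by (intro add_mono) (auto simp: mult.commute mult_left_mono)
  finally show ?thesis by (simp add: distrib_right)
qed

text \<open>A count of degrees: the numerator grows with degree at most
  \<open>sum \<alpha> UNIV + j\<close>, the weight contributes \<open>- 2 * k\<close>, and the
  hypothesis leaves \<open>2 * d + 1\<close> degrees for \<open>decay\<close>.\<close>

lemma norm_fs_integrand_le:
  fixes z y :: "complex ^ 'n::finite"
  assumes "sum \<alpha> UNIV + j + (2 * d + 1) \<le> 2 * k"
  shows "cmod (fs_integrand y \<alpha> j k z) \<le> (1 + norm y) ^ j * decay d z"
proof -
  let ?\<nu> = "radius_weight z" and ?a = "sum \<alpha> UNIV"
  have \<nu>: "?\<nu> \<ge> 1" "?\<nu> > 0" using radius_weight_ge(1)[of z] by linarith+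
  have "cmod (fs_integrand y \<alpha> j k z) = cmod (monom_fun \<alpha> z) * cmod (1 + herm z y) ^ j * (1 / (1 + (norm z)\<^sup>2) ^ k)"
  proof -
    have "\<bar>1 / (1 + (norm z)\<^sup>2) ^ k\<bar> = 1 / (1 + (norm z)\<^sup>2) ^ k"
      by (rule abs_of_nonneg) simp
    thus ?thesis unfolding fs_integrand_def norm_mult norm_power complex_mod_cnj norm_of_real by simp
  qed
  also have "(1 + (norm z)\<^sup>2) ^ k = ?\<nu> ^ (2 * k)"
    by (simp add: power_mult add_nonneg_nonneg)
  also have "cmod (monom_fun \<alpha> z) * cmod (1 + herm z y) ^ j * (1 / ?\<nu> ^ (2 * k)) \<le>
    ?\<nu> ^ ?a * ((1 + norm y) * ?\<nu>) ^ j * (1 / ?\<nu> ^ (2 * k))"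
    using \<nu> by (intro mult_right_mono mult_mono norm_monom_fun_le power_mono norm_one_plus_herm_le) auto
  also have "\<dots> = (1 + norm y) ^ j * (?\<nu> ^ (?a + j) * (1 / ?\<nu> ^ (2 * k)))"
    by (simp add: power_mult_distrib power_add)
  also have "?\<nu> ^ (?a + j) * (1 / ?\<nu> ^ (2 * k)) \<le> (1 / ?\<nu>) ^ (2 * d + 1)"
  proof -
    have "?\<nu> ^ (?a + j) * ?\<nu> ^ (2 * d + 1) \<le> ?\<nu> ^ (2 * k)"
      unfolding power_add[symmetric] by (rule power_increasing[OF assms \<nu>(1)])
    thus ?thesis using \<nu> by (simp add: field_simps)
  qed
  finally show ?thesis by (simp add: decay_def mult_left_mono)
qed

lemma DIM_complex_vec: "DIM(complex ^ 'n::finite) = 2 * CARD('n)"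
  by simp

lemma integrable_decay_bound:
  fixes f :: "complex ^ 'n::finite \<Rightarrow> complex"
  assumes [measurable]: "f \<in> borel_measurable borel" and b: "\<And>z. cmod (f z) \<le> C * decay CARD('n) z"
  shows "integrable lborel f"
proof (rule Bochner_Integration.integrable_bound)
  show "integrable lborel (\<lambda>x::complex ^ 'n. C * decay CARD('n) x)"
    by (intro integrable_mult_right integrable_decay DIM_complex_vec)
  show "AE z in lborel. norm (f z) \<le> norm (C * decay CARD('n) z)"
    using b by (intro AE_I2) (metis abs_ge_self order.trans real_norm_def)
qed simp

lemma integrable_fs_integrand:
  fixes y :: "complex ^ 'n::finite"
  assumes "sum \<alpha> UNIV + j + (2 * CARD('n) + 1) \<le> 2 * k"
  shows "integrable lborel (fs_integrand y \<alpha> j k)"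
  by (rule integrable_decay_bound[OF _ norm_fs_integrand_le[OF assms]]) simp

lemma monom_fun_split:
  "monom_fun \<alpha> z = (z $ i) ^ \<alpha> i * (\<Prod>k\<in>UNIV-{i}. (z $ k) ^ \<alpha> k)"
  unfolding monom_fun_def by (subst prod.remove[of UNIV i]) auto

lemma monom_fun_upd:
  "monom_fun (\<alpha>(i := m)) z = (z $ i) ^ m * (\<Prod>k\<in>UNIV-{i}. (z $ k) ^ \<alpha> k)"
  unfolding monom_fun_split[of "\<alpha>(i := m)" z i] by (intro arg_cong2[where f = times] prod.cong) auto

lemma monom_fun_Suc: "monom_fun (\<alpha>(i := Suc (\<alpha> i))) z = z $ i * monom_fun \<alpha> z"
  by (simp add: monom_fun_upd monom_fun_split[of \<alpha> z i])

lemma sum_upd_Suc: "sum (\<alpha>(i := Suc (\<alpha> i))) UNIV = Suc (sum \<alpha> UNIV)" for \<alpha> :: "'n::finite \<Rightarrow> nat"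
  by (subst (1 2) sum.remove[of UNIV i]) auto

lemma sum_upd_pred: "sum (\<alpha>(i := \<alpha> i - 1)) UNIV \<le> sum \<alpha> UNIV" for \<alpha> :: "'n::finite \<Rightarrow> nat"
  by (rule sum_mono) auto

text \<open>Derivative of \<open>fs_integrand\<close> in the complex direction \<open>c\<close> of
  the coordinate \<open>i\<close>; the terms come from the monomial, the conjugated affine factor
  and the weight. If \<open>\<alpha> i = 0\<close> or \<open>j = 0\<close>, the truncated
  subtraction is harmless because the coefficient is 0.\<close>

definition fs_derivative ::
  "complex ^ 'n::finite \<Rightarrow> ('n \<Rightarrow> nat) \<Rightarrow> nat \<Rightarrow> nat \<Rightarrow> 'n \<Rightarrow> complex \<Rightarrow> complex ^ 'n \<Rightarrow> complex" where
  "fs_derivative y \<alpha> j m i c z =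
     c * (of_nat (\<alpha> i) * fs_integrand y (\<alpha>(i := \<alpha> i - 1)) j m z) +
     cnj c * (of_nat j * (y $ i) * fs_integrand y \<alpha> (j - 1) m z) -
     2 * of_nat m * (of_real (Re (c * cnj (z $ i))) * fs_integrand y \<alpha> j (Suc m) z)"

lemma fs_integrand_has_derivative:
  fixes y z :: "complex ^ 'n::finite"
  shows "((\<lambda>h. fs_integrand y \<alpha> j m (z + h *\<^sub>R axis i c)) has_vector_derivative fs_derivative y \<alpha> j m i c z) (at 0)"
proof -
  define P where "P = (\<Prod>k\<in>UNIV-{i}. (z $ k) ^ \<alpha> k)"
  define q where "q = cnj (1 + herm z y)"
  define S where "S = 1 + (norm z)\<^sup>2"
  have S: "S > 0" by (simp add: S_def add_pos_nonneg)
  have comp: "(z + h *\<^sub>R axis i c) $ k = (if k = i then z $ i + of_real h * c else z $ k)" for h k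
    by (auto simp: axis_def) (simp add: scaleR_conv_of_real)
  have mon: "monom_fun \<alpha> (z + h *\<^sub>R axis i c) = (z $ i + of_real h * c) ^ \<alpha> i * P" for h
    unfolding monom_fun_split[of \<alpha> _ i] P_def
    by (intro arg_cong2[where f = times] prod.cong) (auto simp: comp simp del: vector_add_component)
  have herm: "cnj (1 + herm (z + h *\<^sub>R axis i c) y) = q + of_real h * (cnj c * y $ i)" for h
  proof -
    have "herm (z + h *\<^sub>R axis i c) y = herm z y + of_real h * (c * cnj (y $ i))"
      unfolding herm_def
      by (subst (1 2) sum.remove[of UNIV i]) (auto simp: comp algebra_simps simp del: vector_add_component)
    thus ?thesis by (simp add: q_def algebra_simps)
  qed
  have nrm: "1 + (norm (z + h *\<^sub>R axis i c))\<^sup>2 = S + h * (2 * Re (c * cnj (z $ i))) + h\<^sup>2 * (cmod c)\<^sup>2" for h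
  proof -
    have e: "(cmod (z $ i + of_real h * c))\<^sup>2 = (cmod (z $ i))\<^sup>2 + h * (2 * Re (c * cnj (z $ i))) + h\<^sup>2 * (cmod c)\<^sup>2"
      unfolding cmod_power2 by (simp add: power2_eq_square algebra_simps)
    have "(\<Sum>k\<in>UNIV. (cmod ((z + h *\<^sub>R axis i c) $ k))\<^sup>2) =
       (\<Sum>k\<in>UNIV. (cmod (z $ k))\<^sup>2) + h * (2 * Re (c * cnj (z $ i))) + h\<^sup>2 * (cmod c)\<^sup>2"
      by (subst (1 2) sum.remove[of UNIV i]) (auto simp: comp e simp del: vector_add_component)
    thus ?thesis unfolding S_def norm_vec_square by simp
  qed
  have D1: "((\<lambda>h. (z $ i + of_real h * c) ^ \<alpha> i * P) has_vector_derivative of_nat (\<alpha> i) * c * (z $ i) ^ (\<alpha> i - 1) * P) (at 0)"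
  proof -
    have "((\<lambda>u. (z $ i + u * c) ^ \<alpha> i * P) has_field_derivative of_nat (\<alpha> i) * c * (z $ i) ^ (\<alpha> i - 1) * P) (at (of_real 0))"
      by (auto intro!: derivative_eq_intros)
    from has_vector_derivative_real_field[OF this] show ?thesis by simp
  qed
  have D2: "((\<lambda>h. (q + of_real h * (cnj c * y $ i)) ^ j) has_vector_derivative of_nat j * (cnj c * y $ i) * q ^ (j - 1)) (at 0)"
  proof -
    have "((\<lambda>u. (q + u * (cnj c * y $ i)) ^ j) has_field_derivative of_nat j * (cnj c * y $ i) * q ^ (j - 1)) (at (of_real 0))"
      by (auto intro!: derivative_eq_intros)
    from has_vector_derivative_real_field[OF this] show ?thesis by simp
  qed
  have D3: "((\<lambda>h. of_real (1 / (S + h * (2 * Re (c * cnj (z $ i))) + h\<^sup>2 * (cmod c)\<^sup>2) ^ m) :: complex) has_vector_derivative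
      of_real (- (real m * (2 * Re (c * cnj (z $ i))) / S ^ Suc m))) (at 0)"
  proof (rule has_vector_derivative_of_real)
    have "((\<lambda>h. 1 / (S + h * (2 * Re (c * cnj (z $ i))) + h\<^sup>2 * (cmod c)\<^sup>2) ^ m) has_real_derivative
      - ((real m * S ^ (m - 1)) * (2 * Re (c * cnj (z $ i)))) / (S ^ m * S ^ m)) (at 0)"
      using S by (auto intro!: derivative_eq_intros)
    also have "- ((real m * S ^ (m - 1)) * (2 * Re (c * cnj (z $ i)))) / (S ^ m * S ^ m) =
        - (real m * (2 * Re (c * cnj (z $ i))) / S ^ Suc m)"
      using S by (cases m) (auto simp: field_simps)
    finally show "((\<lambda>h. 1 / (S + h * (2 * Re (c * cnj (z $ i))) + h\<^sup>2 * (cmod c)\<^sup>2) ^ m) has_real_derivative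
        - (real m * (2 * Re (c * cnj (z $ i))) / S ^ Suc m)) (at 0)" .
  qed
  have "((\<lambda>h. fs_integrand y \<alpha> j m (z + h *\<^sub>R axis i c)) has_vector_derivative
      ((z $ i) ^ \<alpha> i * P * q ^ j) * of_real (- (real m * (2 * Re (c * cnj (z $ i))) / S ^ Suc m)) +
      ((z $ i) ^ \<alpha> i * P * (of_nat j * (cnj c * y $ i) * q ^ (j - 1)) +
       of_nat (\<alpha> i) * c * (z $ i) ^ (\<alpha> i - 1) * P * q ^ j) * of_real (1 / S ^ m)) (at 0)"
    unfolding fs_integrand_def mon herm nrm
    using has_vector_derivative_mult[OF has_vector_derivative_mult[OF D1 D2] D3] by simp
  also have "((z $ i) ^ \<alpha> i * P * q ^ j) * of_real (- (real m * (2 * Re (c * cnj (z $ i))) / S ^ Suc m)) +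
      ((z $ i) ^ \<alpha> i * P * (of_nat j * (cnj c * y $ i) * q ^ (j - 1)) +
       of_nat (\<alpha> i) * c * (z $ i) ^ (\<alpha> i - 1) * P * q ^ j) * of_real (1 / S ^ m) = fs_derivative y \<alpha> j m i c z"
  proof -
    have e: "of_real (- (real m * (2 * Re (c * cnj (z $ i))) / S ^ Suc m)) =
      - (2 * of_nat m * (of_real (Re (c * cnj (z $ i))) * of_real (1 / S ^ Suc m)) :: complex)"
      by simp
    show ?thesis
      unfolding fs_derivative_def fs_integrand_def monom_fun_upd monom_fun_split[of \<alpha> z i]
        P_def[symmetric] q_def[symmetric] S_def[symmetric] e
      by (simp only: distrib_left distrib_right mult_ac minus_mult_right[symmetric] minus_mult_left[symmetric])
         (simp add: mult_ac)
  qed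
  finally show ?thesis .
qed

lemma integral_fs_derivative:
  fixes y :: "complex ^ 'n::finite"
  assumes le: "sum \<alpha> UNIV + j + (2 * CARD('n) + 1) \<le> 2 * m" and c: "cmod c = 1"
  shows "(\<integral>z. fs_derivative y \<alpha> j m i c z \<partial>lborel) = 0"
proof -
  define C where "C = real (\<alpha> i) * (1 + norm y) ^ j + real j * norm (y $ i) * (1 + norm y) ^ (j - 1) +
     2 * real m * (1 + norm y) ^ j + (1 + norm y) ^ j"
  have d0: "0 \<le> decay CARD('n) z" for z :: "complex ^ 'n" by (rule decay_nonneg)
  have b1: "cmod (fs_integrand y \<alpha> j m z) \<le> (1 + norm y) ^ j * decay CARD('n) z" for z
    by (rule norm_fs_integrand_le[OF le])
  have b2: "cmod (fs_integrand y (\<alpha>(i := \<alpha> i - 1)) j m z) \<le> (1 + norm y) ^ j * decay CARD('n) z" for z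
    by (rule norm_fs_integrand_le) (use le sum_upd_pred[of \<alpha> i] in linarith)
  have b3: "cmod (fs_integrand y \<alpha> (j - 1) m z) \<le> (1 + norm y) ^ (j - 1) * decay CARD('n) z" for z
    by (rule norm_fs_integrand_le) (use le in linarith)
  \<comment> \<open>The extra factor costs one degree, which can be booked on the monomial; the
    exponent \<open>Suc m\<close> of the weight supplies two.\<close>
  have b4: "cmod (of_real (Re (c * cnj (z $ i))) * fs_integrand y \<alpha> j (Suc m) z) \<le> (1 + norm y) ^ j * decay CARD('n) z" for z
  proof -
    have "cmod (of_real (Re (c * cnj (z $ i))) * fs_integrand y \<alpha> j (Suc m) z) \<le>
      cmod (z $ i * fs_integrand y \<alpha> j (Suc m) z)"
    proof -
      have "\<bar>Re (c * cnj (z $ i))\<bar> \<le> cmod (z $ i)"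
        using abs_Re_le_cmod[of "c * cnj (z $ i)"] by (simp only: norm_mult c complex_mod_cnj mult_1_left)
      thus ?thesis unfolding norm_mult norm_of_real by (rule mult_right_mono) simp
    qed
    also have "z $ i * fs_integrand y \<alpha> j (Suc m) z = fs_integrand y (\<alpha>(i := Suc (\<alpha> i))) j (Suc m) z"
      by (simp add: fs_integrand_def monom_fun_Suc)
    also have "cmod \<dots> \<le> (1 + norm y) ^ j * decay CARD('n) z"
      by (rule norm_fs_integrand_le) (use le in \<open>simp add: sum_upd_Suc del: fun_upd_apply\<close>)
    finally show ?thesis .
  qed
  show ?thesis
  proof (rule integral_directional_derivative(2)[where f = "fs_integrand y \<alpha> j m" and v = "axis i c" and C = C, OF DIM_complex_vec])
    show "fs_derivative y \<alpha> j m i c \<in> borel_measurable borel"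
    proof -
      have [measurable]: "(\<lambda>z::complex ^ 'n. of_real (Re (c * cnj (z $ i))) :: complex) \<in> borel_measurable borel"
        by (intro borel_measurable_continuous_onI continuous_intros)
      show ?thesis unfolding fs_derivative_def[abs_def] by measurable
    qed
    show "((\<lambda>h. fs_integrand y \<alpha> j m (z + h *\<^sub>R axis i c)) has_vector_derivative fs_derivative y \<alpha> j m i c z) (at 0)" for z
      by (rule fs_integrand_has_derivative)
    show "norm (fs_integrand y \<alpha> j m z) \<le> C * decay CARD('n) z" for z
      by (rule order.trans[OF b1 mult_right_mono[OF _ d0]]) (simp add: C_def)
    show "norm (fs_derivative y \<alpha> j m i c z) \<le> C * decay CARD('n) z" for z
    proof -
      have "norm (fs_derivative y \<alpha> j m i c z) \<le>
        cmod (c * (of_nat (\<alpha> i) * fs_integrand y (\<alpha>(i := \<alpha> i - 1)) j m z)) +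
        cmod (cnj c * (of_nat j * (y $ i) * fs_integrand y \<alpha> (j - 1) m z)) +
        cmod (2 * of_nat m * (of_real (Re (c * cnj (z $ i))) * fs_integrand y \<alpha> j (Suc m) z))"
        unfolding fs_derivative_def
        by (rule order.trans[OF norm_triangle_ineq4 add_right_mono[OF norm_triangle_ineq]])
      also have "\<dots> = real (\<alpha> i) * cmod (fs_integrand y (\<alpha>(i := \<alpha> i - 1)) j m z) +
        real j * norm (y $ i) * cmod (fs_integrand y \<alpha> (j - 1) m z) +
        2 * real m * cmod (of_real (Re (c * cnj (z $ i))) * fs_integrand y \<alpha> j (Suc m) z)"
        by (simp only: norm_mult norm_of_nat complex_mod_cnj c norm_numeral mult_1_left mult.assoc)
      also have "\<dots> \<le> real (\<alpha> i) * ((1 + norm y) ^ j * decay CARD('n) z) +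
        real j * norm (y $ i) * ((1 + norm y) ^ (j - 1) * decay CARD('n) z) +
        2 * real m * ((1 + norm y) ^ j * decay CARD('n) z)"
        by (intro add_mono mult_left_mono b2 b3 b4) auto
      also have "\<dots> \<le> C * decay CARD('n) z"
        unfolding C_def distrib_right mult.assoc using d0[of z] by (simp add: mult_nonneg_nonneg)
      finally show ?thesis .
    qed
  qed simp
qed

lemma fs_integrand_times_nth:
  "z $ i * fs_integrand y \<alpha> j k z = fs_integrand y (\<alpha>(i := Suc (\<alpha> i))) j k z"
  by (simp add: fs_integrand_def monom_fun_Suc)

lemma integrable_cnj_nth_fs_integrand:
  fixes y :: "complex ^ 'n::finite"
  assumes le: "sum \<alpha> UNIV + j + (2 * CARD('n) + 1) \<le> 2 * m"
  shows "integrable lborel (\<lambda>z. cnj (z $ i) * fs_integrand y \<alpha> j (Suc m) z)"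
proof (rule integrable_decay_bound)
  have [measurable]: "(\<lambda>z::complex ^ 'n. cnj (z $ i)) \<in> borel_measurable borel"
    by (intro borel_measurable_continuous_onI continuous_intros)
  show "(\<lambda>z. cnj (z $ i) * fs_integrand y \<alpha> j (Suc m) z) \<in> borel_measurable borel" by measurable
  fix z
  have "cmod (cnj (z $ i) * fs_integrand y \<alpha> j (Suc m) z) = cmod (fs_integrand y (\<alpha>(i := Suc (\<alpha> i))) j (Suc m) z)"
    unfolding fs_integrand_times_nth[symmetric] by (simp add: norm_mult)
  also have "\<dots> \<le> (1 + norm y) ^ j * decay CARD('n) z"
    by (rule norm_fs_integrand_le) (use le in \<open>simp add: sum_upd_Suc del: fun_upd_apply\<close>)
  finally show "cmod (cnj (z $ i) * fs_integrand y \<alpha> j (Suc m) z) \<le> (1 + norm y) ^ j * decay CARD('n) z" .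
qed

text \<open>The two identities come from the directions \<open>c = 1\<close> and \<open>c = i\<close>, i.e. from the
  vanishing integrals of the Wirtinger derivatives of the integrand.\<close>

lemma fs_integral_by_parts:
  fixes y :: "complex ^ 'n::finite"
  assumes le: "sum \<alpha> UNIV + j + (2 * CARD('n) + 1) \<le> 2 * m"
  shows "of_nat m * (\<integral>z. fs_integrand y (\<alpha>(i := Suc (\<alpha> i))) j (Suc m) z \<partial>lborel) =
      of_nat j * y $ i * (\<integral>z. fs_integrand y \<alpha> (j - 1) m z \<partial>lborel)" (is ?thesis1)
    and "of_nat m * (\<integral>z. cnj (z $ i) * fs_integrand y \<alpha> j (Suc m) z \<partial>lborel) =
      of_nat (\<alpha> i) * (\<integral>z. fs_integrand y (\<alpha>(i := \<alpha> i - 1)) j m z \<partial>lborel)" (is ?thesis2)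
proof -
  define X where "X = (\<integral>z. fs_integrand y (\<alpha>(i := \<alpha> i - 1)) j m z \<partial>lborel)"
  define Y where "Y = (\<integral>z. fs_integrand y \<alpha> (j - 1) m z \<partial>lborel)"
  define Z where "Z = (\<integral>z. fs_integrand y (\<alpha>(i := Suc (\<alpha> i))) j (Suc m) z \<partial>lborel)"
  define Z' where "Z' = (\<integral>z. cnj (z $ i) * fs_integrand y \<alpha> j (Suc m) z \<partial>lborel)"
  have i1: "integrable lborel (fs_integrand y (\<alpha>(i := \<alpha> i - 1)) j m)"
    by (rule integrable_fs_integrand) (use le sum_upd_pred[of \<alpha> i] in linarith)
  have i2: "integrable lborel (fs_integrand y \<alpha> (j - 1) m)"
    by (rule integrable_fs_integrand) (use le in linarith)
  have i3: "integrable lborel (fs_integrand y (\<alpha>(i := Suc (\<alpha> i))) j (Suc m))"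
    by (rule integrable_fs_integrand) (use le in \<open>simp add: sum_upd_Suc del: fun_upd_apply\<close>)
  have i4: "integrable lborel (\<lambda>z. cnj (z $ i) * fs_integrand y \<alpha> j (Suc m) z)"
    by (rule integrable_cnj_nth_fs_integrand[OF le])
  have key: "c * (of_nat (\<alpha> i) * X) + cnj c * (of_nat j * y $ i * Y) - of_nat m * (cnj c * Z + c * Z') = 0"
    if c: "cmod c = 1" for c
  proof -
    have e: "fs_derivative y \<alpha> j m i c z =
      (c * of_nat (\<alpha> i)) * fs_integrand y (\<alpha>(i := \<alpha> i - 1)) j m z +
      (cnj c * (of_nat j * y $ i)) * fs_integrand y \<alpha> (j - 1) m z -
      ((of_nat m * cnj c) * fs_integrand y (\<alpha>(i := Suc (\<alpha> i))) j (Suc m) z +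
       (of_nat m * c) * (cnj (z $ i) * fs_integrand y \<alpha> j (Suc m) z))" for z
    proof -
      have "2 * complex_of_real (Re (c * cnj (z $ i))) = cnj c * z $ i + c * cnj (z $ i)"
        using complex_add_cnj[of "c * cnj (z $ i)"] by (simp add: mult.commute add.commute)
      hence "2 * of_nat m * (complex_of_real (Re (c * cnj (z $ i))) * fs_integrand y \<alpha> j (Suc m) z) =
        of_nat m * ((cnj c * z $ i + c * cnj (z $ i)) * fs_integrand y \<alpha> j (Suc m) z)"
        by (metis (no_types, lifting) mult.assoc mult.left_commute)
      also have "\<dots> = (of_nat m * cnj c) * fs_integrand y (\<alpha>(i := Suc (\<alpha> i))) j (Suc m) z +
        (of_nat m * c) * (cnj (z $ i) * fs_integrand y \<alpha> j (Suc m) z)"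
        unfolding fs_integrand_times_nth[symmetric] by (simp only: distrib_left distrib_right mult_ac)
      finally show ?thesis unfolding fs_derivative_def by (simp only: mult.assoc)
    qed
    have "(\<integral>z. fs_derivative y \<alpha> j m i c z \<partial>lborel) =
      (c * of_nat (\<alpha> i)) * X + (cnj c * (of_nat j * y $ i)) * Y - ((of_nat m * cnj c) * Z + (of_nat m * c) * Z')"
      unfolding e X_def Y_def Z_def Z'_def
      by (simp add: i1[unfolded One_nat_def] i2[unfolded One_nat_def] i3 i4)
    also have "(\<integral>z. fs_derivative y \<alpha> j m i c z \<partial>lborel) = 0"
      by (rule integral_fs_derivative[OF le c])
    finally show ?thesis by (simp only: distrib_left mult_ac)
  qed
  have a: "of_nat (\<alpha> i) * X + of_nat j * y $ i * Y - of_nat m * (Z + Z') = 0"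
    using key[of 1] by simp
  have b: "of_nat (\<alpha> i) * X - of_nat j * y $ i * Y + of_nat m * (Z - Z') = 0"
  proof -
    have "\<i> * (of_nat (\<alpha> i) * X - of_nat j * y $ i * Y + of_nat m * (Z - Z')) = 0"
      using key[of \<i>] by (simp add: algebra_simps)
    thus ?thesis by simp
  qed
  have "2 * (of_nat m * Z) = 2 * (of_nat j * y $ i * Y)" using a b by (simp add: algebra_simps) algebra
  thus ?thesis1 by (simp add: Z_def Y_def)
  have "2 * (of_nat m * Z') = 2 * (of_nat (\<alpha> i) * X)" using a b by (simp add: algebra_simps) algebra
  thus ?thesis2 by (simp add: Z'_def X_def)
qed

section \<open>Norming constants and the reproducing identity\<close>

definition fs_volume :: "'n::finite itself \<Rightarrow> nat \<Rightarrow> real" where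
  "fs_volume _ k = (\<integral>z. 1 / (1 + (norm (z :: complex ^ 'n))\<^sup>2) ^ k \<partial>lborel)"

lemma fs_integrand_0_0: "fs_integrand y (\<lambda>_. 0) 0 k z = of_real (1 / (1 + (norm z)\<^sup>2) ^ k)"
  by (simp add: fs_integrand_def monom_fun_def)

lemma integrable_fs_weight:
  assumes "2 * CARD('n::finite) + 1 \<le> 2 * k"
  shows "integrable lborel (\<lambda>z :: complex ^ 'n. 1 / (1 + (norm z)\<^sup>2) ^ k)"
proof -
  have "integrable lborel (fs_integrand (0 :: complex ^ 'n) (\<lambda>_. 0) 0 k)"
    by (rule integrable_fs_integrand) (use assms in simp)
  hence "integrable lborel (\<lambda>z. Re (fs_integrand (0 :: complex ^ 'n) (\<lambda>_. 0) 0 k z))"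
    by (rule integrable_Re)
  thus ?thesis by (simp only: fs_integrand_0_0 Re_complex_of_real)
qed

lemma integral_fs_integrand_0_0:
  fixes y :: "complex ^ 'n::finite"
  shows "(\<integral>z. fs_integrand y (\<lambda>_. 0) 0 k z \<partial>lborel) = of_real (fs_volume TYPE('n) k)"
  unfolding fs_integrand_0_0 fs_volume_def by (rule integral_complex_of_real)

text \<open>One factor of the conjugated power is expanded. Each term containing
  \<open>cnj (z $ i)\<close> integrates to 0 by the second integration by parts, since the monomial
  has exponent 0 in that coordinate. The by-parts lemma is used with weight exponent
  \<open>k - 1\<close>, hence \<open>2 * d + 2\<close> in the hypothesis.\<close>

lemma integral_fs_integrand_0:
  fixes y :: "complex ^ 'n::finite"
  assumes "j + (2 * CARD('n) + 2) \<le> 2 * k"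
  shows "(\<integral>z. fs_integrand y (\<lambda>_. 0) j k z \<partial>lborel) = of_real (fs_volume TYPE('n) k)"
  using assms
proof (induction j)
  case 0
  show ?case by (rule integral_fs_integrand_0_0)
next
  case (Suc j)
  obtain m where k: "k = Suc m" using Suc.prems by (cases k) auto
  have le: "sum (\<lambda>_. 0) (UNIV :: 'n set) + j + (2 * CARD('n) + 1) \<le> 2 * m"
    using Suc.prems k by simp
  have m: "m > 0" using le by simp
  have int: "integrable lborel (\<lambda>z. cnj (z $ i) * fs_integrand y (\<lambda>_. 0) j k z)" for i
    unfolding k by (rule integrable_cnj_nth_fs_integrand[OF le])
  have int0: "integrable lborel (fs_integrand y (\<lambda>_. 0) j k)"
    by (rule integrable_fs_integrand) (use Suc.prems in simp)
  have zero: "(\<integral>z. cnj (z $ i) * fs_integrand y (\<lambda>_. 0) j k z \<partial>lborel) = 0" for i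
    using fs_integral_by_parts(2)[OF le, where y = y and i = i] m by (simp add: k)
  have "fs_integrand y (\<lambda>_. 0) (Suc j) k z =
     fs_integrand y (\<lambda>_. 0) j k z + (\<Sum>i\<in>UNIV. y $ i * (cnj (z $ i) * fs_integrand y (\<lambda>_. 0) j k z))" for z
  proof -
    have "cnj (1 + herm z y) = 1 + (\<Sum>i\<in>UNIV. y $ i * cnj (z $ i))"
      by (simp add: herm_def mult.commute)
    moreover have "fs_integrand y (\<lambda>_. 0) (Suc j) k z = cnj (1 + herm z y) * fs_integrand y (\<lambda>_. 0) j k z"
      by (simp add: fs_integrand_def)
    ultimately show ?thesis by (simp add: distrib_right sum_distrib_right mult.assoc)
  qed
  hence "(\<integral>z. fs_integrand y (\<lambda>_. 0) (Suc j) k z \<partial>lborel) =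
    (\<integral>z. fs_integrand y (\<lambda>_. 0) j k z + (\<Sum>i\<in>UNIV. y $ i * (cnj (z $ i) * fs_integrand y (\<lambda>_. 0) j k z)) \<partial>lborel)"
    by simp
  also have "\<dots> = (\<integral>z. fs_integrand y (\<lambda>_. 0) j k z \<partial>lborel)"
    by (subst Bochner_Integration.integral_add) (auto simp: int0 int zero)
  also have "\<dots> = of_real (fs_volume TYPE('n) k)" by (rule Suc.IH) (use Suc.prems in simp)
  finally show ?case .
qed

text \<open>The second integration by parts is applied to each monomial \<open>z $ i\<close> and
  summed over \<open>i\<close>; the sum of the squared moduli is
  \<open>(1 + norm z ^ 2) - 1\<close>, which gives a difference of two consecutive volumes.\<close>

lemma fs_volume_Suc:
  assumes "CARD('n::finite) + 1 \<le> m"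
  shows "real m * fs_volume TYPE('n) (Suc m) = (real m - real CARD('n)) * fs_volume TYPE('n) m"
proof -
  define e :: "'n \<Rightarrow> 'n \<Rightarrow> nat" where "e = (\<lambda>i. (\<lambda>_. 0)(i := Suc 0))"
  let ?F = "fs_integrand (0 :: complex ^ 'n)"
  have le: "sum (e i) UNIV + 0 + (2 * CARD('n) + 1) \<le> 2 * m" for i
    using assms sum_upd_Suc[of "\<lambda>_. 0" i] by (simp add: e_def)
  have le': "sum (\<lambda>_. 0) (UNIV :: 'n set) + 0 + (2 * CARD('n) + 1) \<le> 2 * Suc m"
    using assms by simp
  have "of_nat m * (\<integral>z. cnj (z $ i) * ?F (e i) 0 (Suc m) z \<partial>lborel) = of_real (fs_volume TYPE('n) m)" for i
  proof -
    have "(e i)(i := e i i - 1) = (\<lambda>_. 0)" "e i i = 1" by (auto simp: e_def)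
    thus ?thesis
      using fs_integral_by_parts(2)[OF le[of i], where y = 0 and i = i]
      by (simp only: integral_fs_integrand_0_0) simp
  qed
  hence "of_real (real CARD('n) * fs_volume TYPE('n) m) =
     (\<Sum>i\<in>UNIV. of_nat m * (\<integral>z. cnj (z $ i) * ?F (e i) 0 (Suc m) z \<partial>lborel))"
    by simp
  also have "\<dots> = of_nat m * (\<integral>z. (\<Sum>i\<in>UNIV. cnj (z $ i) * ?F (e i) 0 (Suc m) z) \<partial>lborel)"
    by (subst Bochner_Integration.integral_sum) (auto intro: integrable_cnj_nth_fs_integrand le simp: sum_distrib_left)
  also have "(\<lambda>z. \<Sum>i\<in>UNIV. cnj (z $ i) * ?F (e i) 0 (Suc m) z) = (\<lambda>z. ?F (\<lambda>_. 0) 0 m z - ?F (\<lambda>_. 0) 0 (Suc m) z)"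
  proof
    fix z :: "complex ^ 'n"
    have "?F (e i) 0 (Suc m) z = z $ i * ?F (\<lambda>_. 0) 0 (Suc m) z" for i
      unfolding fs_integrand_times_nth by (simp add: e_def)
    hence "(\<Sum>i\<in>UNIV. cnj (z $ i) * ?F (e i) 0 (Suc m) z) = herm z z * ?F (\<lambda>_. 0) 0 (Suc m) z"
      unfolding herm_def sum_distrib_right by (intro sum.cong) (simp_all add: mult_ac)
    also have "\<dots> = of_real ((norm z)\<^sup>2 * (1 / (1 + (norm z)\<^sup>2) ^ Suc m))"
      by (simp add: herm_self fs_integrand_0_0)
    also have "(norm z)\<^sup>2 * (1 / (1 + (norm z)\<^sup>2) ^ Suc m) = 1 / (1 + (norm z)\<^sup>2) ^ m - 1 / (1 + (norm z)\<^sup>2) ^ Suc m"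
    proof -
      define S where "S = 1 + (norm z)\<^sup>2"
      have "S > 0" "(norm z)\<^sup>2 = S - 1" using one_plus_norm_pos[of z] by (auto simp: S_def)
      thus ?thesis unfolding S_def[symmetric] by (simp add: left_diff_distrib diff_divide_distrib)
    qed
    finally show "(\<Sum>i\<in>UNIV. cnj (z $ i) * ?F (e i) 0 (Suc m) z) = ?F (\<lambda>_. 0) 0 m z - ?F (\<lambda>_. 0) 0 (Suc m) z"
      by (simp only: fs_integrand_0_0 of_real_diff)
  qed
  also have "(\<integral>z. ?F (\<lambda>_. 0) 0 m z - ?F (\<lambda>_. 0) 0 (Suc m) z \<partial>lborel) =
    of_real (fs_volume TYPE('n) m - fs_volume TYPE('n) (Suc m))"
    by (subst Bochner_Integration.integral_diff)
       (use assms in \<open>auto intro!: integrable_fs_integrand simp: integral_fs_integrand_0_0\<close>)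
  also have "of_nat m * complex_of_real (fs_volume TYPE('n) m - fs_volume TYPE('n) (Suc m)) =
    of_real (real m * (fs_volume TYPE('n) m - fs_volume TYPE('n) (Suc m)))" by simp
  finally have "real CARD('n) * fs_volume TYPE('n) m = real m * (fs_volume TYPE('n) m - fs_volume TYPE('n) (Suc m))"
    by (simp only: of_real_eq_iff)
  thus ?thesis by (simp add: algebra_simps)
qed

text \<open>Removing a factor \<open>z $ i\<close> lowers \<open>j\<close> and the weight exponent
  by one each, so the exponent remains \<open>d + j + 1\<close>. The factor
  \<open>j / (d + j)\<close> produced on the way is the ratio of consecutive volumes in
  \<open>fs_volume_Suc\<close>.\<close>

lemma integral_fs_integrand:
  fixes y :: "complex ^ 'n::finite"
  assumes "sum \<alpha> UNIV \<le> j"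
  shows "(\<integral>z. fs_integrand y \<alpha> j (CARD('n) + j + 1) z \<partial>lborel) =
    monom_fun \<alpha> y * of_real (fs_volume TYPE('n) (CARD('n) + j + 1))"
  using assms
proof (induction "sum \<alpha> UNIV" arbitrary: \<alpha> j)
  case 0
  hence "\<alpha> = (\<lambda>_. 0)" by auto
  thus ?case
    using integral_fs_integrand_0[where j = j and y = y and k = "CARD('n) + j + 1"] by (simp add: monom_fun_def)
next
  case (Suc k)
  obtain i where i: "\<alpha> i \<noteq> 0" using Suc.hyps(2) by (metis sum.neutral nat.distinct(1))
  define \<beta> where "\<beta> = \<alpha>(i := \<alpha> i - 1)"
  have \<alpha>: "\<alpha> = \<beta>(i := Suc (\<beta> i))" using i by (auto simp: \<beta>_def)
  have \<beta>: "sum \<beta> UNIV = k" using Suc.hyps(2) sum_upd_Suc[of \<beta> i] unfolding \<alpha>[symmetric] by simp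
  obtain j' where j: "j = Suc j'" using Suc.hyps(2) Suc.prems by (cases j) auto
  let ?m = "CARD('n) + j"
  have le: "sum \<beta> UNIV + j + (2 * CARD('n) + 1) \<le> 2 * ?m"
    using Suc.prems Suc.hyps(2) \<beta> by simp
  have "of_nat ?m * (\<integral>z. fs_integrand y \<alpha> j (?m + 1) z \<partial>lborel) =
    of_nat j * y $ i * (\<integral>z. fs_integrand y \<beta> j' (CARD('n) + j' + 1) z \<partial>lborel)"
    using fs_integral_by_parts(1)[OF le, where y = y and i = i] unfolding \<alpha>[symmetric] by (simp add: j)
  also have "\<dots> = of_nat j * y $ i * (monom_fun \<beta> y * of_real (fs_volume TYPE('n) ?m))"
  proof -
    have "(\<integral>z. fs_integrand y \<beta> j' (CARD('n) + j' + 1) z \<partial>lborel) =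
      monom_fun \<beta> y * of_real (fs_volume TYPE('n) (CARD('n) + j' + 1))"
      by (rule Suc.hyps(1)) (use \<beta> Suc.prems Suc.hyps(2) j in auto)
    thus ?thesis by (simp add: j)
  qed
  also have "\<dots> = monom_fun \<alpha> y * of_real (real j * fs_volume TYPE('n) ?m)"
  proof -
    have "monom_fun \<alpha> y = y $ i * monom_fun \<beta> y" by (subst \<alpha>) (rule monom_fun_Suc)
    thus ?thesis by simp
  qed
  also have "real j * fs_volume TYPE('n) ?m = real ?m * fs_volume TYPE('n) (Suc ?m)"
    using fs_volume_Suc[where 'n = 'n and m = ?m] j by simp
  also have "monom_fun \<alpha> y * of_real (real ?m * fs_volume TYPE('n) (Suc ?m)) =
    of_nat ?m * (monom_fun \<alpha> y * of_real (fs_volume TYPE('n) (?m + 1)))"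
    by (simp only: of_real_mult of_real_of_nat_eq Suc_eq_plus1 mult_ac)
  finally have "of_nat ?m * (\<integral>z. fs_integrand y \<alpha> j (?m + 1) z \<partial>lborel) =
    of_nat ?m * (monom_fun \<alpha> y * of_real (fs_volume TYPE('n) (?m + 1)))" .
  moreover have "of_nat ?m \<noteq> (0 :: complex)" unfolding of_nat_eq_0_iff using j by simp
  ultimately show ?case using mult_cancel_left by blast
qed

text \<open>The recursion of the volumes is inverse to that of the binomial coefficients; hence the
  norming constant of the kernel is the number of points times a quantity free of
  \<open>L\<close>.\<close>

lemma fs_volume_binomial:
  "fs_volume TYPE('n::finite) (CARD('n) + L + 1) * real ((CARD('n) + L) choose CARD('n)) = fs_volume TYPE('n) (CARD('n) + 1)"
proof (induction L)
  case (Suc L)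
  let ?d = "CARD('n)"
  have "real (?d + Suc L) * fs_volume TYPE('n) (Suc (?d + Suc L)) = real (Suc L) * fs_volume TYPE('n) (?d + L + 1)"
    using fs_volume_Suc[where 'n = 'n and m = "?d + Suc L"] by simp
  moreover have "real (Suc L) * real ((?d + Suc L) choose ?d) = real (?d + Suc L) * real ((?d + L) choose ?d)"
  proof -
    have "(?d + Suc L) choose ?d = (?d + Suc L) choose Suc L" "(?d + L) choose ?d = (?d + L) choose L"
      by (subst binomial_symmetric; simp)+
    moreover have "Suc L * (Suc (?d + L) choose Suc L) = Suc (?d + L) * ((?d + L) choose L)"
      using Suc_times_binomial_eq[of "?d + L" L] by (metis mult.commute)
    ultimately have "Suc L * ((?d + Suc L) choose ?d) = (?d + Suc L) * ((?d + L) choose ?d)"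
      by (simp only: add_Suc_right)
    thus ?thesis by (metis of_nat_mult)
  qed
  ultimately have "(real (?d + Suc L) * fs_volume TYPE('n) (Suc (?d + Suc L))) * (real (Suc L) * real ((?d + Suc L) choose ?d)) =
    (real (Suc L) * fs_volume TYPE('n) (?d + L + 1)) * (real (?d + Suc L) * real ((?d + L) choose ?d))"
    by (simp only:)
  hence "(real (?d + Suc L) * real (Suc L)) * (fs_volume TYPE('n) (Suc (?d + Suc L)) * real ((?d + Suc L) choose ?d)) =
    (real (?d + Suc L) * real (Suc L)) * (fs_volume TYPE('n) (?d + L + 1) * real ((?d + L) choose ?d))"
    by (simp only: mult_ac)
  hence "fs_volume TYPE('n) (Suc (?d + Suc L)) * real ((?d + Suc L) choose ?d) = fs_volume TYPE('n) (?d + L + 1) * real ((?d + L) choose ?d)"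
    by (subst (asm) mult_cancel_left) auto
  thus ?case using Suc.IH by simp
qed simp

section \<open>The reproducing kernel\<close>

text \<open>The primitive is, up to the factor \<open>2 * d\<close>, the right-hand side of the
  equation that defines \<open>g_fun\<close>; this is why the map carries the intensity to the
  uniform measure.\<close>

lemma nn_integral_fs_radial:
  assumes d: "d \<ge> 1" and a: "0 \<le> a"
  shows "(\<integral>\<^sup>+r. ennreal (r ^ (2 * d - 1)) * indicator {0<..} r * (ennreal (1 / (1 + r\<^sup>2) ^ (d + 1)) * indicator {..a} r) \<partial>lborel) =
    ennreal ((a\<^sup>2 / (1 + a\<^sup>2)) ^ d / (2 * d))" (is ?bounded)
    and "(\<integral>\<^sup>+r. ennreal (r ^ (2 * d - 1)) * indicator {0<..} r * ennreal (1 / (1 + r\<^sup>2) ^ (d + 1)) \<partial>lborel) =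
    ennreal (1 / (2 * d))" (is ?whole)
proof -
  define F where "F = (\<lambda>r::real. (r\<^sup>2 / (1 + r\<^sup>2)) ^ d / (2 * d))"
  define f where "f = (\<lambda>r::real. r ^ (2 * d - 1) * (1 / (1 + r\<^sup>2) ^ (d + 1)))"
  have DF: "(F has_real_derivative f r) (at r)" for r
  proof -
    define S where "S = 1 + r\<^sup>2"
    have S: "S > 0" by (simp add: S_def add_pos_nonneg)
    have "(F has_real_derivative (d * (r\<^sup>2 / S) ^ (d - 1) * ((2 * r * S - r\<^sup>2 * (2 * r)) / (S * S))) / (2 * d)) (at r)"
    proof -
      have "((\<lambda>r. r\<^sup>2 / (1 + r\<^sup>2)) has_real_derivative (2 * r * S - r\<^sup>2 * (2 * r)) / (S * S)) (at r)"
        unfolding S_def using S[unfolded S_def] by (auto intro!: derivative_eq_intros)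
      from DERIV_cdivide[OF DERIV_power[OF this, of d], of "2 * real d"]
      show ?thesis unfolding F_def by (simp add: S_def mult_ac)
    qed
    also have "(d * (r\<^sup>2 / S) ^ (d - 1) * ((2 * r * S - r\<^sup>2 * (2 * r)) / (S * S))) / (2 * d) = (r\<^sup>2 / S) ^ (d - 1) * (r / (S * S))"
    proof -
      have "2 * r * S - r\<^sup>2 * (2 * r) = 2 * r" by (simp add: S_def power2_eq_square algebra_simps)
      thus ?thesis using d by simp
    qed
    also have "\<dots> = f r"
    proof -
      have e: "2 * d - 1 = 2 * (d - 1) + 1" "d + 1 = (d - 1) + 2" using d by auto
      show ?thesis unfolding f_def S_def[symmetric] e power_add
        using S by (simp add: power_divide power_mult power2_eq_square)
    qed
    finally show ?thesis .
  qed
  have [measurable]: "f \<in> borel_measurable borel" unfolding f_def by measurable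
  have f0: "0 \<le> f r" if "0 \<le> r" for r using that by (simp add: f_def)
  have ff: "ennreal (r ^ (2 * d - 1)) * ennreal (1 / (1 + r\<^sup>2) ^ (d + 1)) = ennreal (f r)" if "r \<ge> 0" for r
    using that unfolding f_def by (intro ennreal_mult[symmetric]) auto
  have F0: "F 0 = 0" using d by (simp add: F_def power_0_left)
  have "(\<integral>\<^sup>+r. ennreal (r ^ (2 * d - 1)) * indicator {0<..} r * (ennreal (1 / (1 + r\<^sup>2) ^ (d + 1)) * indicator {..a} r) \<partial>lborel) =
    (\<integral>\<^sup>+r. ennreal (f r) * indicator {0..a} r \<partial>lborel)"
    by (rule nn_integral_cong_AE, rule AE_mp[OF AE_lborel_singleton[of 0]])
       (auto simp: ff[symmetric] simp del: ennreal_mult' split: split_indicator)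
  also have "\<dots> = ennreal (F a - F 0)"
    using a by (intro nn_integral_FTC_Icc) (auto intro: DF f0 DERIV_subset[OF DF])
  finally show ?bounded by (simp add: F0) (simp add: F_def)
  have "(\<integral>\<^sup>+r. ennreal (r ^ (2 * d - 1)) * indicator {0<..} r * ennreal (1 / (1 + r\<^sup>2) ^ (d + 1)) \<partial>lborel) =
    (\<integral>\<^sup>+r. ennreal (f r) * indicator {0..} r \<partial>lborel)"
    by (rule nn_integral_cong_AE, rule AE_mp[OF AE_lborel_singleton[of 0]])
       (auto simp: ff[symmetric] simp del: ennreal_mult' split: split_indicator)
  also have "\<dots> = ennreal (1 / (2 * d) - F 0)"
  proof (rule nn_integral_FTC_atLeast[OF _ DF])
    have "((\<lambda>r::real. r\<^sup>2 / (1 + r\<^sup>2)) \<longlongrightarrow> 1) at_top" by real_asymp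
    hence "((\<lambda>r::real. (r\<^sup>2 / (1 + r\<^sup>2)) ^ d / (2 * d)) \<longlongrightarrow> 1 ^ d / (2 * d)) at_top"
      by (intro tendsto_intros) (use d in auto)
    thus "(F \<longlongrightarrow> 1 / (2 * d)) at_top" by (simp add: F_def)
  qed (auto intro: f0)
  finally show ?whole by (simp add: F0)
qed

lemma fs_volume_base:
  "fs_volume TYPE('n::finite) (CARD('n) + 1) = sphere_vol TYPE(complex ^ 'n) / (2 * CARD('n))"
proof -
  let ?d = "CARD('n)"
  have "ennreal (fs_volume TYPE('n) (?d + 1)) = (\<integral>\<^sup>+z. ennreal (1 / (1 + (norm z)\<^sup>2) ^ (?d + 1)) \<partial>(lborel :: (complex ^ 'n) measure))"
    unfolding fs_volume_def by (intro nn_integral_eq_integral[symmetric] integrable_fs_weight) auto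
  also have "\<dots> = ennreal (sphere_vol TYPE(complex ^ 'n)) *
      (\<integral>\<^sup>+r. ennreal (r ^ (2 * ?d - 1)) * indicator {0<..} r * ennreal (1 / (1 + r\<^sup>2) ^ (?d + 1)) \<partial>lborel)"
    by (subst nn_integral_radial) (auto simp: mult.commute)
  also have "\<dots> = ennreal (sphere_vol TYPE(complex ^ 'n) * (1 / (2 * ?d)))"
    using sphere_vol_pos[where 'a="complex ^ 'n"] nn_integral_fs_radial(2)[of ?d 0]
    by (subst ennreal_mult) auto
  finally show ?thesis
    using sphere_vol_pos[where 'a="complex ^ 'n"]
    by (subst (asm) ennreal_inj) (auto simp: fs_volume_def intro!: integral_nonneg_AE)
qed

lemma fs_volume_pos: "0 < fs_volume TYPE('n::finite) (CARD('n) + L + 1)"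
proof -
  have "fs_volume TYPE('n) (CARD('n) + L + 1) * real ((CARD('n) + L) choose CARD('n)) > 0"
    unfolding fs_volume_binomial fs_volume_base using sphere_vol_pos[where 'a="complex ^ 'n"] by simp
  thus ?thesis by (simp add: zero_less_mult_iff)
qed

section \<open>Closed form of the kernel\<close>

definition fs_weight :: "nat \<Rightarrow> complex ^ 'n::finite \<Rightarrow> real" where
  "fs_weight L z = (1 + (norm z)\<^sup>2) powr (real (CARD('n) + L + 1) / 2)"

lemma fs_weight_pos: "0 < fs_weight L z"
  using one_plus_norm_pos[of z] by (simp add: fs_weight_def)

lemma fs_weight_square: "(fs_weight L z)\<^sup>2 = (1 + (norm z)\<^sup>2) ^ (CARD('n) + L + 1)" for z :: "complex ^ 'n::finite"
proof -
  have "(fs_weight L z)\<^sup>2 = (1 + (norm z)\<^sup>2) powr (real (CARD('n) + L + 1))"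
    unfolding fs_weight_def power2_eq_square powr_add[symmetric] by simp
  also have "\<dots> = (1 + (norm z)\<^sup>2) ^ (CARD('n) + L + 1)"
    by (rule powr_realpow[OF one_plus_norm_pos])
  finally show ?thesis .
qed

lemma weighted_monomial_altdef:
  "weighted_monomial L \<alpha> z = monom_fun \<alpha> z / of_real (fs_weight L z)"
  by (simp add: weighted_monomial_def monom_fun_def fs_weight_def)

text \<open>The factors depending on \<open>w\<close> alone stand in front, so that for fixed
  \<open>w\<close> the kernel is a scalar multiple of an element of the span.\<close>

definition fs_kernel :: "nat \<Rightarrow> complex ^ 'n::finite \<Rightarrow> complex ^ 'n \<Rightarrow> complex" where
  "fs_kernel L z w = of_real (1 / (fs_volume TYPE('n) (CARD('n) + L + 1) * fs_weight L w)) *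
     ((1 + herm z w) ^ L / of_real (fs_weight L z))"

lemma sum_fun_apply: "(\<Sum>i\<in>A. f i) x = (\<Sum>i\<in>A. f i x)"
  for f :: "'i \<Rightarrow> 'a \<Rightarrow> 'b::comm_monoid_add"
  by (induction A rule: infinite_finite_induct) (auto simp: zero_fun_def plus_fun_def)

text \<open>Multiplication by \<open>1 + herm z y\<close> adds monomials whose degree is larger by
  one, which the budget \<open>sum \<alpha> UNIV + j \<le> L\<close> allows.\<close>

lemma monomial_herm_in_span:
  assumes "sum \<alpha> UNIV + j \<le> L"
  shows "(\<lambda>z. monom_fun \<alpha> z * (1 + herm z y) ^ j / of_real (fs_weight L z)) \<in> weighted_polynomials L"
  using assms
proof (induction j arbitrary: \<alpha>)
  case 0
  have "(\<lambda>z. monom_fun \<alpha> z / of_real (fs_weight L z)) = weighted_monomial L \<alpha>"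
    by (simp add: fun_eq_iff weighted_monomial_altdef)
  thus ?case unfolding weighted_polynomials_def
    using 0 by (auto intro!: cfun.span_base)
next
  case (Suc j)
  let ?F = "\<lambda>\<alpha> z. monom_fun \<alpha> z * (1 + herm z y) ^ j / complex_of_real (fs_weight L z)"
  have e: "(\<lambda>z. monom_fun \<alpha> z * (1 + herm z y) ^ Suc j / of_real (fs_weight L z)) =
    ?F \<alpha> + (\<Sum>i\<in>UNIV. (\<lambda>z. cnj (y $ i) * ?F (\<alpha>(i := Suc (\<alpha> i))) z))"
  proof
    fix z
    have "monom_fun \<alpha> z * (1 + herm z y) ^ Suc j = monom_fun \<alpha> z * (1 + herm z y) ^ j +
      (\<Sum>i\<in>UNIV. cnj (y $ i) * (monom_fun (\<alpha>(i := Suc (\<alpha> i))) z * (1 + herm z y) ^ j))"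
    proof -
      have "monom_fun \<alpha> z * (1 + herm z y) ^ Suc j = monom_fun \<alpha> z * (1 + herm z y) ^ j + herm z y * (monom_fun \<alpha> z * (1 + herm z y) ^ j)"
        by (simp add: algebra_simps)
      also have "herm z y * (monom_fun \<alpha> z * (1 + herm z y) ^ j) =
        (\<Sum>i\<in>UNIV. cnj (y $ i) * (monom_fun (\<alpha>(i := Suc (\<alpha> i))) z * (1 + herm z y) ^ j))"
        unfolding monom_fun_Suc by (subst (1) herm_def, unfold sum_distrib_right) (intro sum.cong, simp_all add: mult_ac)
      finally show ?thesis .
    qed
    thus "monom_fun \<alpha> z * (1 + herm z y) ^ Suc j / of_real (fs_weight L z) =
      (?F \<alpha> + (\<Sum>i\<in>UNIV. (\<lambda>z. cnj (y $ i) * ?F (\<alpha>(i := Suc (\<alpha> i))) z))) z"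
      by (simp add: plus_fun_def sum_fun_apply add_divide_distrib sum_divide_distrib del: power_Suc)
  qed
  show ?case unfolding e weighted_polynomials_def
  proof (intro cfun.span_add cfun.span_sum cfun.span_scale)
    show "?F \<alpha> \<in> cfun.span {weighted_monomial L \<alpha> |\<alpha>. sum \<alpha> UNIV \<le> L}"
      using Suc.IH[of \<alpha>] Suc.prems by (simp add: weighted_polynomials_def)
    show "?F (\<alpha>(i := Suc (\<alpha> i))) \<in> cfun.span {weighted_monomial L \<alpha> |\<alpha>. sum \<alpha> UNIV \<le> L}" for i
      using Suc.IH[of "\<alpha>(i := Suc (\<alpha> i))"] Suc.prems
      by (simp add: weighted_polynomials_def sum_upd_Suc del: fun_upd_apply)
  qed
qed

lemma fs_kernel_in_span: "(\<lambda>z. fs_kernel L z w) \<in> weighted_polynomials L"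
proof -
  have "(\<lambda>z. monom_fun (\<lambda>_. 0) z * (1 + herm z w) ^ L / of_real (fs_weight L z)) \<in> weighted_polynomials L"
    by (rule monomial_herm_in_span) simp
  thus ?thesis unfolding fs_kernel_def weighted_polynomials_def
    by (intro cfun.span_scale) (simp add: monom_fun_def)
qed

lemma fs_kernel_reproducing:
  "reproducing_kernel lborel (weighted_polynomials L) (fs_kernel L :: complex ^ 'n::finite \<Rightarrow> _)"
proof -
  \<comment> \<open>Integrability is carried along in the induction over the span, because
    additivity of the integral needs it.\<close>
  define P where "P = (\<lambda>(y :: complex ^ 'n) f. integrable lborel (\<lambda>x. f x * cnj (fs_kernel L x y)) \<and>
     f y = (\<integral>x. f x * cnj (fs_kernel L x y) \<partial>lborel))"
  have "P y f" if "f \<in> weighted_polynomials L" for y f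
    using that unfolding weighted_polynomials_def
  proof (induction rule: cfun.span_induct)
    case base
    show "cfun.subspace (Collect (P y))"
    proof (rule cfun.subspaceI)
      show "0 \<in> Collect (P y)" by (simp add: P_def)
      show "f + g \<in> Collect (P y)" if "f \<in> Collect (P y)" "g \<in> Collect (P y)" for f g
        using that by (simp add: P_def distrib_right)
      show "(\<lambda>x. c * f x) \<in> Collect (P y)" if "f \<in> Collect (P y)" for c f
        using that by (simp add: P_def mult.assoc)
    qed
  next
    case (step f)
    then obtain \<alpha> where f: "f = weighted_monomial L \<alpha>" and \<alpha>: "sum \<alpha> UNIV \<le> L" by auto
    let ?k = "CARD('n) + L + 1"
    define V where "V = fs_volume TYPE('n) ?k"
    have V: "V > 0" using fs_volume_pos by (simp add: V_def)
    have e: "f x * cnj (fs_kernel L x y) = of_real (1 / (V * fs_weight L y)) * fs_integrand y \<alpha> L ?k x" for x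
    proof -
      have "1 / (of_real (fs_weight L x) * of_real (fs_weight L x)) = complex_of_real (1 / (1 + (norm x)\<^sup>2) ^ ?k)"
        unfolding fs_weight_square[symmetric] by (simp add: power2_eq_square)
      thus ?thesis
        unfolding f weighted_monomial_altdef fs_kernel_def fs_integrand_def V_def[symmetric]
        by (simp add: divide_inverse mult_ac)
    qed
    have int: "integrable lborel (fs_integrand y \<alpha> L ?k)"
      by (rule integrable_fs_integrand) (use \<alpha> in simp)
    show "P y f" unfolding P_def
    proof
      show "integrable lborel (\<lambda>x. f x * cnj (fs_kernel L x y))"
        unfolding e by (intro integrable_mult_right int)
      have "(\<integral>x. f x * cnj (fs_kernel L x y) \<partial>lborel) = of_real (1 / (V * fs_weight L y)) * (monom_fun \<alpha> y * of_real V)"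
        unfolding e V_def by (subst integral_mult_right_zero) (simp only: integral_fs_integrand[OF \<alpha>])
      also have "\<dots> = f y"
        unfolding f weighted_monomial_altdef using V fs_weight_pos[of L y] by simp
      finally show "f y = (\<integral>x. f x * cnj (fs_kernel L x y) \<partial>lborel)" ..
    qed
  qed
  thus ?thesis unfolding reproducing_kernel_def P_def
    using fs_kernel_in_span by auto
qed

text \<open>Testing one kernel section against the other shows that \<open>K z w\<close> is the
  conjugate of \<open>K' w z\<close>. Used for the pair \<open>K\<close>, \<open>K'\<close> and for
  \<open>K'\<close> with itself, this gives equality.\<close>

lemma reproducing_kernel_unique:
  assumes K: "reproducing_kernel \<mu> H K" and K': "reproducing_kernel \<mu> H K'"
    and z: "z \<in> space \<mu>" and w: "w \<in> space \<mu>"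
  shows "K z w = K' z w"
proof -
  have sym: "K1 z w = cnj (K2 w z)"
    if K1: "reproducing_kernel \<mu> H K1" and K2: "reproducing_kernel \<mu> H K2"
      and zw: "z \<in> space \<mu>" "w \<in> space \<mu>" for K1 K2 z w
  proof -
    have r1: "f y = (\<integral>x. f x * cnj (K1 x y) \<partial>\<mu>)" and r2: "f y = (\<integral>x. f x * cnj (K2 x y) \<partial>\<mu>)"
      if "f \<in> H" "y \<in> space \<mu>" for f y
      using K1 K2 that unfolding reproducing_kernel_def by simp_all
    have m1: "(\<lambda>x. K1 x w) \<in> H" and m2: "(\<lambda>x. K2 x z) \<in> H"
      using K1 K2 zw unfolding reproducing_kernel_def by simp_all
    have "K1 z w = (\<integral>x. K1 x w * cnj (K2 x z) \<partial>\<mu>)" by (rule r2[OF m1 zw(1)])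
    also have "\<dots> = cnj (\<integral>x. K2 x z * cnj (K1 x w) \<partial>\<mu>)"
      by (subst Bochner_Integration.integral_cnj[symmetric]) (simp add: mult.commute)
    also have "(\<integral>x. K2 x z * cnj (K1 x w) \<partial>\<mu>) = K2 w z"
      by (rule r1[OF m2 zw(2), symmetric])
    finally show ?thesis .
  qed
  show ?thesis using sym[OF K K' z w] sym[OF K' K' z w] by simp
qed

text \<open>The Fubini-Study volume in the affine chart, normalised to mass 1. The one-point
  intensity is the number of points times this density, whatever \<open>L\<close> is.\<close>

definition fs_density :: "complex ^ 'n::finite \<Rightarrow> real" where
  "fs_density z = 2 * CARD('n) / sphere_vol TYPE(complex ^ 'n) / (1 + (norm z)\<^sup>2) ^ (CARD('n) + 1)"

text \<open>The squared cosine of the Fubini-Study distance of the points of projective space with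
  affine coordinates \<open>z\<close> and \<open>w\<close>.\<close>

definition fs_cos2 :: "complex ^ 'n::finite \<Rightarrow> complex ^ 'n \<Rightarrow> real" where
  "fs_cos2 z w = (cmod (1 + herm z w))\<^sup>2 / ((1 + (norm z)\<^sup>2) * (1 + (norm w)\<^sup>2))"

lemma herm_commute: "herm w z = cnj (herm z w)"
  by (simp add: herm_def mult.commute)

lemma fs_volume_inverse:
  "1 / fs_volume TYPE('n::finite) (CARD('n) + L + 1) =
    real ((CARD('n) + L) choose CARD('n)) * (2 * CARD('n) / sphere_vol TYPE(complex ^ 'n))"
proof -
  have "fs_volume TYPE('n) (CARD('n) + L + 1) * real ((CARD('n) + L) choose CARD('n)) =
     sphere_vol TYPE(complex ^ 'n) / (2 * CARD('n))"
    using fs_volume_binomial[where 'n = 'n and L = L] unfolding fs_volume_base .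
  thus ?thesis
    using fs_volume_pos[where 'n = 'n and L = L] sphere_vol_pos[where 'a="complex ^ 'n"]
    by (simp add: field_simps)
qed

lemma fs_kernel_diag:
  "fs_kernel L z z = of_real (real ((CARD('n) + L) choose CARD('n)) * fs_density z)" for z :: "complex ^ 'n::finite"
proof -
  define V where "V = fs_volume TYPE('n) (CARD('n) + L + 1)"
  define S where "S = 1 + (norm z)\<^sup>2"
  have S: "S > 0" using one_plus_norm_pos by (simp add: S_def)
  have "fs_kernel L z z = of_real ((1 / V) * (S ^ L / (fs_weight L z)\<^sup>2))"
    unfolding fs_kernel_def herm_self V_def[symmetric]
    by (simp add: S_def power2_eq_square)
  also have "(1 / V) * (S ^ L / (fs_weight L z)\<^sup>2) = real ((CARD('n) + L) choose CARD('n)) * fs_density z"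
    unfolding fs_weight_square V_def fs_volume_inverse fs_density_def S_def[symmetric]
    using S by (simp add: power_add)
  finally show ?thesis .
qed

lemma fs_kernel_prod:
  "fs_kernel L z w * fs_kernel L w z =
    of_real ((real ((CARD('n) + L) choose CARD('n)))\<^sup>2 * fs_density z * fs_density w * fs_cos2 z w ^ L)"
  for z :: "complex ^ 'n::finite"
proof -
  define V where "V = fs_volume TYPE('n) (CARD('n) + L + 1)"
  define S where "S = 1 + (norm z)\<^sup>2"
  define T where "T = 1 + (norm w)\<^sup>2"
  have S: "S > 0" "T > 0" using one_plus_norm_pos by (simp_all add: S_def T_def)
  have "(1 + herm z w) * (1 + herm w z) = of_real ((cmod (1 + herm z w))\<^sup>2)"
    unfolding complex_norm_square by (simp add: herm_commute[of w z])
  hence h: "(1 + herm z w) ^ L * (1 + herm w z) ^ L = of_real (((cmod (1 + herm z w))\<^sup>2) ^ L)"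
    unfolding power_mult_distrib[symmetric] by simp
  have "fs_kernel L z w * fs_kernel L w z =
    of_real ((1 / V)\<^sup>2 / ((fs_weight L z)\<^sup>2 * (fs_weight L w)\<^sup>2)) * ((1 + herm z w) ^ L * (1 + herm w z) ^ L)"
    unfolding fs_kernel_def V_def[symmetric] by (simp add: power2_eq_square divide_inverse mult_ac)
  also have "\<dots> = of_real ((1 / V)\<^sup>2 / ((fs_weight L z)\<^sup>2 * (fs_weight L w)\<^sup>2) * ((cmod (1 + herm z w))\<^sup>2) ^ L)"
    unfolding h by simp
  also have "(1 / V)\<^sup>2 / ((fs_weight L z)\<^sup>2 * (fs_weight L w)\<^sup>2) * ((cmod (1 + herm z w))\<^sup>2) ^ L =
    (real ((CARD('n) + L) choose CARD('n)))\<^sup>2 * fs_density z * fs_density w * fs_cos2 z w ^ L"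
    unfolding fs_weight_square V_def fs_volume_inverse fs_density_def fs_cos2_def S_def[symmetric] T_def[symmetric]
    using S by (simp add: power_add power_divide power_mult_distrib power2_eq_square mult_ac)
  finally show ?thesis .
qed

lemma kernel_det_1: "kernel_det K 1 x = K (x 0) (x 0)"
proof -
  have "{p. p permutes {..<1::nat}} = {id}"
    by (simp add: lessThan_Suc)
  thus ?thesis by (simp add: kernel_det_def)
qed

lemma kernel_det_2: "kernel_det K 2 x = K (x 0) (x 0) * K (x 1) (x 1) - K (x 0) (x 1) * K (x 1) (x 0)"
proof -
  have e: "{..<2::nat} = {0, 1}" by auto
  have "{p. p permutes {0, 1::nat}} =
    (\<lambda>(b, p). Transposition.transpose 0 b \<circ> p) ` {(b, p). b \<in> insert 0 {1} \<and> p \<in> {p. p permutes {1}}}"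
    by (rule permutes_insert)
  also have "{(b, p). b \<in> insert 0 {1::nat} \<and> p \<in> {p. p permutes {1}}} = {(0, id), (1, id)}"
    by auto
  finally have "{p. p permutes {0, 1::nat}} = {id, Transposition.transpose 0 1}"
    by simp
  moreover have "id \<noteq> Transposition.transpose 0 (1 :: nat)"
    by (metis id_apply transpose_apply_first zero_neq_one)
  ultimately show ?thesis unfolding kernel_det_def e
    by (simp add: sign_swap_id Transposition.transpose_def lessThan_Suc fun_eq_iff)
qed

section \<open>The two-point intensity\<close>

text \<open>The sum over ordered pairs of distinct points is written as an integral over the
  counting measure; it then makes sense for infinite configurations and obeys the convergence
  theorems.\<close>

definition pair_sum :: "'a set \<Rightarrow> ('a \<times> 'a \<Rightarrow> ennreal) \<Rightarrow> ennreal" where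
  "pair_sum \<omega> f = (\<integral>\<^sup>+p. f p * indicator {p \<in> \<omega> \<times> \<omega>. fst p \<noteq> snd p} p \<partial>count_space UNIV)"

lemma pair_sum_finite:
  assumes "finite \<omega>"
  shows "pair_sum \<omega> f = (\<Sum>x\<in>\<omega>. \<Sum>y\<in>\<omega> - {x}. f (x, y))"
proof -
  let ?D = "Sigma \<omega> (\<lambda>x. \<omega> - {x})"
  have e: "{p \<in> \<omega> \<times> \<omega>. fst p \<noteq> snd p} = ?D" by auto
  have "pair_sum \<omega> f = (\<Sum>p\<in>?D. f p * indicator ?D p)"
    unfolding pair_sum_def e
    by (rule nn_integral_count_space') (use assms in auto)
  also have "\<dots> = (\<Sum>p\<in>?D. f p)" by (intro sum.cong) auto
  also have "\<dots> = (\<Sum>x\<in>\<omega>. \<Sum>y\<in>\<omega> - {x}. f (x, y))"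
    using assms by (subst sum.Sigma) auto
  finally show ?thesis .
qed

lemma pair_sum_rectangle:
  assumes "A \<inter> B = {}" "finite (\<omega> \<inter> A)" "finite (\<omega> \<inter> B)"
  shows "pair_sum \<omega> (indicator (A \<times> B)) = num_points \<omega> A * num_points \<omega> B"
proof -
  have "pair_sum \<omega> (indicator (A \<times> B)) = (\<integral>\<^sup>+p. indicator ((\<omega> \<inter> A) \<times> (\<omega> \<inter> B)) p \<partial>count_space UNIV)"
    unfolding pair_sum_def using assms(1) by (intro nn_integral_cong) (auto simp: indicator_def)
  also have "\<dots> = emeasure (count_space UNIV) ((\<omega> \<inter> A) \<times> (\<omega> \<inter> B))" by simp
  also have "\<dots> = num_points \<omega> A * num_points \<omega> B"
    unfolding num_points_def using assms
    by (simp add: emeasure_count_space_finite card_cartesian_product ennreal_of_nat_eq_real_of_nat ennreal_mult)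
  finally show ?thesis .
qed

text \<open>Off the diagonal the product is covered by countably many products of disjoint bounded sets,
  which is all that the joint intensities determine.\<close>

lemma off_diagonal_cover:
  obtains R :: "nat \<Rightarrow> ('a::euclidean_space \<times> 'a) set" and U V :: "nat \<Rightarrow> 'a set"
  where "\<And>i. R i = U i \<times> V i" "\<And>i. open (U i)" "\<And>i. open (V i)" "\<And>i. bounded (U i)" "\<And>i. bounded (V i)"
    "\<And>i. U i \<inter> V i = {}" "{p. fst p \<noteq> snd p} \<subseteq> (\<Union>i. R i)"
proof -
  obtain B :: "'a set set" where B: "countable B" "topological_basis B"
    using ex_countable_basis by blast
  \<comment> \<open>The empty set is added so that \<open>S\<close> is nonempty and hence the range
    of a sequence.\<close>
  define S where "S = {(U, V). U \<in> insert {} B \<and> V \<in> insert {} B \<and> bounded U \<and> bounded V \<and> U \<inter> V = {}}"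
  have "countable S"
    by (rule countable_subset[of _ "insert {} B \<times> insert {} B"]) (use B in \<open>auto simp: S_def\<close>)
  moreover have "({}, {}) \<in> S" by (simp add: S_def)
  ultimately obtain e :: "nat \<Rightarrow> 'a set \<times> 'a set" where e: "range e = S"
    by (metis empty_iff range_from_nat_into)
  have es: "fst (e i) \<in> insert {} B" "snd (e i) \<in> insert {} B" "bounded (fst (e i))" "bounded (snd (e i))" "fst (e i) \<inter> snd (e i) = {}" for i
  proof -
    have "e i \<in> S" using e by blast
    thus "fst (e i) \<in> insert {} B" "snd (e i) \<in> insert {} B" "bounded (fst (e i))" "bounded (snd (e i))"
      "fst (e i) \<inter> snd (e i) = {}"
      by (cases "e i"; simp add: S_def)+
  qed
  have op: "open U" if "U \<in> insert {} B" for U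
    using that B topological_basis_open by auto
  show thesis
  proof (rule that[of "\<lambda>i. fst (e i) \<times> snd (e i)" "\<lambda>i. fst (e i)" "\<lambda>i. snd (e i)"])
    show "{p. fst p \<noteq> snd p} \<subseteq> (\<Union>i. fst (e i) \<times> snd (e i))"
    proof clarify
      fix x y :: 'a assume "fst (x, y) \<noteq> snd (x, y)"
      hence "x \<noteq> y" by simp
      then obtain U V where UV: "open U" "open V" "x \<in> U" "y \<in> V" "U \<inter> V = {}"
        by (metis hausdorff)
      obtain U' where U': "U' \<in> B" "x \<in> U'" "U' \<subseteq> U \<inter> ball x 1"
        using topological_basisE[OF B(2), of "U \<inter> ball x 1" x] UV by auto
      obtain V' where V': "V' \<in> B" "y \<in> V'" "V' \<subseteq> V \<inter> ball y 1"
        using topological_basisE[OF B(2), of "V \<inter> ball y 1" y] UV by auto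
      have "(U', V') \<in> S"
        using U' V' UV bounded_subset[OF bounded_ball[of x 1], of U'] bounded_subset[OF bounded_ball[of y 1], of V']
        by (auto simp: S_def)
      then obtain i where "e i = (U', V')" using e by (metis imageE)
      thus "(x, y) \<in> (\<Union>i. fst (e i) \<times> snd (e i))" using U' V' by (intro UN_I[of i]) auto
    qed
  qed (use es op in auto)
qed

text \<open>What the expectation of a pair sum takes from the process: the two-point intensity,
  tested on disjoint sets as in \<open>joint_intensity\<close>, and its finite mass, which permits
  subtraction when passing to complements.\<close>

locale two_point =
  fixes P :: "'w measure" and X :: "'w \<Rightarrow> 'a::euclidean_space set" and r :: "'a \<times> 'a \<Rightarrow> ennreal"
  assumes pp: "point_process P lborel X"
    and r [measurable]: "r \<in> borel_measurable (lborel \<Otimes>\<^sub>M lborel)"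
    and fin: "(\<integral>\<^sup>+p. r p \<partial>(lborel \<Otimes>\<^sub>M lborel)) < \<infinity>"
    and intensity: "\<And>A B. A \<in> sets borel \<Longrightarrow> B \<in> sets borel \<Longrightarrow> A \<inter> B = {} \<Longrightarrow>
      (\<integral>\<^sup>+w. num_points (X w) A * num_points (X w) B \<partial>P) =
      (\<integral>\<^sup>+p. r p * indicator (A \<times> B) p \<partial>(lborel \<Otimes>\<^sub>M lborel))"
begin

text \<open>The Campbell formula for pairs. Measurability is included because it has to pass through
  the same limits and differences as the formula itself.\<close>

definition good :: "('a \<times> 'a \<Rightarrow> ennreal) \<Rightarrow> bool" where
  "good f \<longleftrightarrow> (\<lambda>w. pair_sum (X w) f) \<in> borel_measurable P \<and>
    (\<integral>\<^sup>+w. pair_sum (X w) f \<partial>P) = (\<integral>\<^sup>+p. r p * f p \<partial>(lborel \<Otimes>\<^sub>M lborel))"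

lemma finite_points:
  assumes "w \<in> space P" "bounded A"
  shows "finite (X w \<inter> A)"
proof -
  have "compact (closure A)" using assms by simp
  hence "finite (X w \<inter> closure A)" using pp assms unfolding point_process_def by blast
  thus ?thesis by (rule rev_finite_subset) (use closure_subset in blast)
qed

lemma good_rectangle:
  assumes [measurable]: "A \<in> sets borel" "B \<in> sets borel" and AB: "A \<inter> B = {}" "bounded A" "bounded B"
  shows "good (indicator (A \<times> B))"
proof -
  have e: "pair_sum (X w) (indicator (A \<times> B)) = num_points (X w) A * num_points (X w) B" if "w \<in> space P" for w
    by (intro pair_sum_rectangle AB finite_points that)
  have [measurable]: "(\<lambda>w. num_points (X w) A) \<in> borel_measurable P" if "A \<in> sets borel" for A
    using pp that unfolding point_process_def by simp
  show ?thesis unfolding good_def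
  proof
    show "(\<lambda>w. pair_sum (X w) (indicator (A \<times> B))) \<in> borel_measurable P"
      by (subst measurable_cong[OF e]) auto
    show "(\<integral>\<^sup>+w. pair_sum (X w) (indicator (A \<times> B)) \<partial>P) = (\<integral>\<^sup>+p. r p * indicator (A \<times> B) p \<partial>(lborel \<Otimes>\<^sub>M lborel))"
      using intensity[OF assms(1,2) AB(1)] by (simp add: e cong: nn_integral_cong_simp)
  qed
qed

lemma good_suminf:
  assumes "\<And>i::nat. good (f i)" and [measurable]: "\<And>i. f i \<in> borel_measurable (lborel \<Otimes>\<^sub>M lborel)"
  shows "good (\<lambda>p. \<Sum>i. f i p)"
proof -
  have e: "pair_sum \<omega> (\<lambda>p. \<Sum>i. f i p) = (\<Sum>i. pair_sum \<omega> (f i))" for \<omega>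
    unfolding pair_sum_def ennreal_suminf_multc[symmetric]
    by (rule nn_integral_suminf) simp
  have [measurable]: "(\<lambda>w. pair_sum (X w) (f i)) \<in> borel_measurable P" for i
    using assms(1) by (simp add: good_def)
  have "(\<integral>\<^sup>+w. (\<Sum>i. pair_sum (X w) (f i)) \<partial>P) = (\<Sum>i. \<integral>\<^sup>+p. r p * f i p \<partial>(lborel \<Otimes>\<^sub>M lborel))"
    using assms(1) by (subst nn_integral_suminf) (auto simp: good_def)
  also have "\<dots> = (\<integral>\<^sup>+p. r p * (\<Sum>i. f i p) \<partial>(lborel \<Otimes>\<^sub>M lborel))"
    unfolding ennreal_suminf_cmult[symmetric] by (subst nn_integral_suminf) auto
  finally show ?thesis by (simp add: good_def e)
qed

text \<open>The pair sum does not see the diagonal, and neither does the integral, since the fibres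
  of the diagonal are single points and so Lebesgue null.\<close>

lemma good_cong_off_diagonal:
  assumes "\<And>p. fst p \<noteq> snd p \<Longrightarrow> f p = g p" and g: "good g"
    and [measurable]: "f \<in> borel_measurable (lborel \<Otimes>\<^sub>M lborel)" "g \<in> borel_measurable (lborel \<Otimes>\<^sub>M lborel)"
  shows "good f"
proof -
  have e: "pair_sum \<omega> f = pair_sum \<omega> g" for \<omega>
    unfolding pair_sum_def using assms(1) by (intro nn_integral_cong) (auto simp: indicator_def)
  have "(\<integral>\<^sup>+p. r p * f p \<partial>(lborel \<Otimes>\<^sub>M lborel)) = (\<integral>\<^sup>+x. \<integral>\<^sup>+y. r (x, y) * f (x, y) \<partial>lborel \<partial>lborel)"
    by (subst lborel.nn_integral_fst[symmetric]) auto
  also have "\<dots> = (\<integral>\<^sup>+x. \<integral>\<^sup>+y. r (x, y) * g (x, y) \<partial>lborel \<partial>lborel)"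
  proof (rule nn_integral_cong)
    fix x :: 'a
    show "(\<integral>\<^sup>+y. r (x, y) * f (x, y) \<partial>lborel) = (\<integral>\<^sup>+y. r (x, y) * g (x, y) \<partial>lborel)"
      by (rule nn_integral_cong_AE, rule AE_mp[OF AE_lborel_singleton[of x]]) (use assms(1) in auto)
  qed
  also have "\<dots> = (\<integral>\<^sup>+p. r p * g p \<partial>(lborel \<Otimes>\<^sub>M lborel))"
    by (subst lborel.nn_integral_fst[symmetric]) auto
  finally show ?thesis using g by (simp add: good_def e)
qed

text \<open>A Dynkin argument with the products of Borel sets as generator. It is carried out inside
  a product of bounded disjoint sets, where the number of pairs is finite, so that complements can
  be obtained by subtraction.\<close>

lemma good_in_rectangle:
  assumes U: "U \<in> sets borel" "V \<in> sets borel" "U \<inter> V = {}" "bounded U" "bounded V"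
    and C: "C \<in> sets (borel \<Otimes>\<^sub>M borel)"
  shows "good (indicator (C \<inter> U \<times> V))"
proof -
  have sp: "sets (borel \<Otimes>\<^sub>M borel) = sigma_sets UNIV {A \<times> B | A B. A \<in> sets (borel :: 'a measure) \<and> B \<in> sets (borel :: 'a measure)}"
    by (simp add: sets_pair_measure)
  have lp: "sets (lborel \<Otimes>\<^sub>M lborel) = sets (borel \<Otimes>\<^sub>M borel :: ('a \<times> 'a) measure)"
    by (rule sets_pair_measure_cong) auto
  have st: "Int_stable {A \<times> B | A B. A \<in> sets (borel :: 'a measure) \<and> B \<in> sets (borel :: 'a measure)}"
  proof (rule Int_stableI, clarify)
    fix A B A' B' assume "A \<in> sets (borel :: 'a measure)" "B \<in> sets (borel :: 'a measure)" "A' \<in> sets (borel :: 'a measure)" "B' \<in> sets (borel :: 'a measure)"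
    thus "\<exists>A'' B''. A \<times> B \<inter> A' \<times> B' = A'' \<times> B'' \<and> A'' \<in> sets borel \<and> B'' \<in> sets borel"
      by (intro exI[of _ "A \<inter> A'"] exI[of _ "B \<inter> B'"]) auto
  qed
  have C': "C \<in> sigma_sets UNIV {A \<times> B | A B. A \<in> sets (borel :: 'a measure) \<and> B \<in> sets (borel :: 'a measure)}"
    using C unfolding sp .
  have UV [measurable]: "U \<times> V \<in> sets (borel \<Otimes>\<^sub>M borel)" using U by auto
  have gUV: "good (indicator (U \<times> V))" by (rule good_rectangle) (use U in auto)
  show ?thesis
  proof (rule sigma_sets_induct_disjoint[OF st _ C'])
    show "{A \<times> B | A B. A \<in> sets (borel :: 'a measure) \<and> B \<in> sets (borel :: 'a measure)} \<subseteq> Pow UNIV" by simp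
  next
    fix D assume "D \<in> {A \<times> B | A B. A \<in> sets (borel :: 'a measure) \<and> B \<in> sets (borel :: 'a measure)}"
    then obtain A B where D: "D = A \<times> B" "A \<in> sets borel" "B \<in> sets borel" by auto
    have "D \<inter> U \<times> V = (A \<inter> U) \<times> (B \<inter> V)" using D by auto
    moreover have "good (indicator ((A \<inter> U) \<times> (B \<inter> V)))"
      using U D by (intro good_rectangle) (auto intro: bounded_subset)
    ultimately show "good (indicator (D \<inter> U \<times> V))" by simp
  next
    show "good (indicator ({} \<inter> U \<times> V))" by (simp add: good_def pair_sum_def)
  next
    fix D assume D: "D \<in> sigma_sets UNIV {A \<times> B | A B. A \<in> sets (borel :: 'a measure) \<and> B \<in> sets (borel :: 'a measure)}"
      and gD: "good (indicator (D \<inter> U \<times> V))"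
    have D' [measurable]: "D \<in> sets (borel \<Otimes>\<^sub>M borel)" using D unfolding sp .
    let ?D' = "(UNIV - D) \<inter> U \<times> V"
    have split: "(indicator (U \<times> V) :: _ \<Rightarrow> ennreal) = (\<lambda>p. indicator (D \<inter> U \<times> V) p + indicator ?D' p)"
      by (auto simp: indicator_def fun_eq_iff)
    have m1 [measurable]: "(\<lambda>w. pair_sum (X w) (indicator (D \<inter> U \<times> V))) \<in> borel_measurable P"
      using gD by (simp add: good_def)
    have m2 [measurable]: "(\<lambda>w. pair_sum (X w) (indicator (U \<times> V))) \<in> borel_measurable P"
      using gUV by (simp add: good_def)
    have add: "pair_sum (X w) (indicator (U \<times> V)) = pair_sum (X w) (indicator (D \<inter> U \<times> V)) + pair_sum (X w) (indicator ?D')" for w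
      unfolding split unfolding pair_sum_def distrib_right by (rule nn_integral_add) auto
    \<comment> \<open>Local finiteness of the process enters here and makes the subtraction in
      \<open>e\<close> legitimate.\<close>
    have finUV: "pair_sum (X w) (indicator (U \<times> V)) < \<infinity>" if "w \<in> space P" for w
      using finite_points[OF that, of U] finite_points[OF that, of V] U
      by (subst pair_sum_rectangle) (auto simp: num_points_def emeasure_count_space_finite ennreal_mult_less_top of_nat_less_top)
    have e: "pair_sum (X w) (indicator ?D') = pair_sum (X w) (indicator (U \<times> V)) - pair_sum (X w) (indicator (D \<inter> U \<times> V))"
      if "w \<in> space P" for w
      using finUV[OF that] unfolding add[of w] by (simp add: ennreal_add_diff_cancel_left less_top)
    show "good (indicator ?D')"
      unfolding good_def
    proof
      show m3 [measurable]: "(\<lambda>w. pair_sum (X w) (indicator ?D')) \<in> borel_measurable P"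
        by (subst measurable_cong[OF e]) auto
      have "UNIV - D \<in> sets (borel \<Otimes>\<^sub>M borel)"
        using sets.compl_sets[OF D'] by (simp add: space_pair_measure)
      hence [measurable]: "?D' \<in> sets (lborel \<Otimes>\<^sub>M lborel)" "D \<inter> U \<times> V \<in> sets (lborel \<Otimes>\<^sub>M lborel)"
        unfolding lp using D' UV by (auto intro: sets.Int)
      let ?I = "\<lambda>f. \<integral>\<^sup>+p. r p * f p \<partial>(lborel \<Otimes>\<^sub>M lborel)"
      have "?I (indicator (D \<inter> U \<times> V)) + (\<integral>\<^sup>+w. pair_sum (X w) (indicator ?D') \<partial>P) = (\<integral>\<^sup>+w. pair_sum (X w) (indicator (U \<times> V)) \<partial>P)"
        unfolding add using gD by (subst nn_integral_add) (auto simp: good_def)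
      also have "\<dots> = ?I (indicator (U \<times> V))" using gUV by (simp add: good_def)
      also have "\<dots> = ?I (indicator (D \<inter> U \<times> V)) + ?I (indicator ?D')"
        unfolding split distrib_left by (rule nn_integral_add) auto
      finally have eq: "?I (indicator (D \<inter> U \<times> V)) + (\<integral>\<^sup>+w. pair_sum (X w) (indicator ?D') \<partial>P) =
        ?I (indicator (D \<inter> U \<times> V)) + ?I (indicator ?D')" .
      have "?I (indicator (D \<inter> U \<times> V)) \<le> (\<integral>\<^sup>+p. r p \<partial>(lborel \<Otimes>\<^sub>M lborel))"
        by (intro nn_integral_mono) (auto simp: indicator_def)
      hence "?I (indicator (D \<inter> U \<times> V)) \<noteq> \<infinity>" using fin by auto
      with eq show "(\<integral>\<^sup>+w. pair_sum (X w) (indicator ?D') \<partial>P) = ?I (indicator ?D')"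
        by (simp add: ennreal_add_left_cancel)
    qed
  next
    fix D :: "nat \<Rightarrow> ('a \<times> 'a) set"
    assume dis: "disjoint_family D" and D: "range D \<subseteq> sigma_sets UNIV {A \<times> B | A B. A \<in> sets (borel :: 'a measure) \<and> B \<in> sets (borel :: 'a measure)}"
      and gD: "\<And>i. good (indicator (D i \<inter> U \<times> V))"
    have [measurable]: "D i \<inter> U \<times> V \<in> sets (lborel \<Otimes>\<^sub>M lborel)" for i
      using D UV unfolding lp sp[symmetric] by auto
    have "good (\<lambda>p. \<Sum>i. indicator (D i \<inter> U \<times> V) p)"
      by (rule good_suminf[OF gD]) simp
    also have "(\<lambda>p. \<Sum>i. indicator (D i \<inter> U \<times> V) p) = (indicator ((\<Union>i. D i) \<inter> U \<times> V) :: _ \<Rightarrow> ennreal)"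
    proof
      fix p
      have "disjoint_family (\<lambda>i. D i \<inter> U \<times> V)" using dis by (auto simp: disjoint_family_on_def)
      thus "(\<Sum>i. indicator (D i \<inter> U \<times> V) p) = (indicator ((\<Union>i. D i) \<inter> U \<times> V) p :: ennreal)"
        by (subst suminf_indicator) auto
    qed
    finally show "good (indicator (\<Union>(range D) \<inter> U \<times> V))" .
  qed
qed

text \<open>The set is cut along the disjointed form of the off-diagonal cover. The pieces are added
  up countably, and the part on the diagonal is discarded at the end.\<close>

lemma good_indicator:
  assumes C: "C \<in> sets (borel \<Otimes>\<^sub>M borel)"
  shows "good (indicator C)"
proof -
  obtain R :: "nat \<Rightarrow> ('a \<times> 'a) set" and U V :: "nat \<Rightarrow> 'a set"
  where R: "\<And>i. R i = U i \<times> V i" "\<And>i. open (U i)" "\<And>i. open (V i)" "\<And>i. bounded (U i)" "\<And>i. bounded (V i)"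
    "\<And>i. U i \<inter> V i = {}" "{p. fst p \<noteq> snd p} \<subseteq> (\<Union>i. R i)"
    by (rule off_diagonal_cover[where 'a = 'a], rule that)
  have lp: "sets (lborel \<Otimes>\<^sub>M lborel) = sets (borel \<Otimes>\<^sub>M borel :: ('a \<times> 'a) measure)"
    by (rule sets_pair_measure_cong) auto
  have mR: "R i \<in> sets (borel \<Otimes>\<^sub>M borel)" for i unfolding R(1) using R(2,3) by auto
  define D where "D i = C \<inter> disjointed R i" for i
  have mdis: "disjointed R i \<in> sets (borel \<Otimes>\<^sub>M borel)" for i
    using sets.range_disjointed_sets[of R "borel \<Otimes>\<^sub>M borel"] mR by auto
  have mD: "D i \<in> sets (borel \<Otimes>\<^sub>M borel)" for i unfolding D_def using C mdis by auto
  have gD: "good (indicator (D i))" for i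
  proof -
    have "D i = D i \<inter> U i \<times> V i" using disjointed_subset[of R i] by (auto simp: D_def R(1))
    moreover have "good (indicator (D i \<inter> U i \<times> V i))"
      by (rule good_in_rectangle) (use R mD in auto)
    ultimately show ?thesis by simp
  qed
  have mD' [measurable]: "D i \<in> sets (lborel \<Otimes>\<^sub>M lborel)" for i using mD unfolding lp .
  have C' [measurable]: "C \<in> sets (lborel \<Otimes>\<^sub>M lborel)" using C unfolding lp .
  have s: "(\<Sum>i. indicator (D i) p) = (indicator (\<Union>i. D i) p :: ennreal)" for p
  proof (rule suminf_indicator)
    show "disjoint_family D"
      using disjoint_family_disjointed[of R] unfolding D_def disjoint_family_on_def by blast
  qed
  have U: "(\<Union>i. D i) = C \<inter> (\<Union>i. R i)" unfolding D_def by (simp add: UN_disjointed_eq flip: Int_UN_distrib)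
  have "good (\<lambda>p. \<Sum>i. indicator (D i) p)" by (rule good_suminf[OF gD]) simp
  hence g: "good (indicator (\<Union>i. D i))" unfolding s .
  show ?thesis
  proof (rule good_cong_off_diagonal[OF _ g])
    show "indicator C p = (indicator (\<Union>i. D i) p :: ennreal)" if "fst p \<noteq> snd p" for p
      using that R(7) unfolding U by (auto simp: indicator_def)
  qed measurable
qed

lemma good_measurable:
  assumes "f \<in> borel_measurable (borel \<Otimes>\<^sub>M borel)"
  shows "good f"
proof -
  have lp: "sets (lborel \<Otimes>\<^sub>M lborel) = sets (borel \<Otimes>\<^sub>M borel :: ('a \<times> 'a) measure)"
    by (rule sets_pair_measure_cong) auto
  note [measurable_cong] = lp
  show ?thesis
    using assms
  proof (induction rule: borel_measurable_induct)
    case (cong f g)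
    have "f = g" using cong(3) by (auto simp: fun_eq_iff space_pair_measure)
    thus ?case using cong by simp
  next
    case (set A)
    thus ?case by (rule good_indicator)
  next
    case (mult u c)
    have e: "pair_sum \<omega> (\<lambda>x. c * u x) = c * pair_sum \<omega> u" for \<omega>
      unfolding pair_sum_def mult.assoc by (rule nn_integral_cmult) simp
    have [measurable]: "(\<lambda>w. pair_sum (X w) u) \<in> borel_measurable P" using mult by (simp add: good_def)
    have [measurable]: "u \<in> borel_measurable (borel \<Otimes>\<^sub>M borel)" by fact
    have "(\<integral>\<^sup>+p. r p * (c * u p) \<partial>(lborel \<Otimes>\<^sub>M lborel)) = c * (\<integral>\<^sup>+p. r p * u p \<partial>(lborel \<Otimes>\<^sub>M lborel))"
      unfolding mult.left_commute[of _ c] by (rule nn_integral_cmult) measurable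
    thus ?case using mult(4) unfolding good_def e by (simp add: nn_integral_cmult)
  next
    case (add u v)
    have e: "pair_sum \<omega> (\<lambda>x. v x + u x) = pair_sum \<omega> v + pair_sum \<omega> u" for \<omega>
      unfolding pair_sum_def distrib_right by (rule nn_integral_add) auto
    have [measurable]: "(\<lambda>w. pair_sum (X w) u) \<in> borel_measurable P" "(\<lambda>w. pair_sum (X w) v) \<in> borel_measurable P"
      using add by (auto simp: good_def)
    have [measurable]: "u \<in> borel_measurable (borel \<Otimes>\<^sub>M borel)" "v \<in> borel_measurable (borel \<Otimes>\<^sub>M borel)" by fact+
    have "(\<integral>\<^sup>+p. r p * (v p + u p) \<partial>(lborel \<Otimes>\<^sub>M lborel)) = (\<integral>\<^sup>+p. r p * v p \<partial>(lborel \<Otimes>\<^sub>M lborel)) + (\<integral>\<^sup>+p. r p * u p \<partial>(lborel \<Otimes>\<^sub>M lborel))"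
      unfolding distrib_left by (rule nn_integral_add) measurable
    thus ?case using add unfolding good_def e by (simp add: nn_integral_add)
  next
    case (seq S)
    have [measurable]: "S i \<in> borel_measurable (borel \<Otimes>\<^sub>M borel)" for i by fact
    have [measurable]: "(\<lambda>w. pair_sum (X w) (S i)) \<in> borel_measurable P" for i using seq by (auto simp: good_def)
    have inc: "incseq (\<lambda>i p. S i p * c p)" "incseq (\<lambda>i p. c p * S i p)" for c :: "'a \<times> 'a \<Rightarrow> ennreal"
      using seq(3) by (auto simp: incseq_def le_fun_def intro!: mult_right_mono mult_left_mono)
    have e: "pair_sum \<omega> (\<lambda>p. SUP i. S i p) = (SUP i. pair_sum \<omega> (S i))" for \<omega>
      unfolding pair_sum_def SUP_mult_right_ennreal
      by (rule nn_integral_monotone_convergence_SUP[OF inc(1)]) simp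
    have incp: "incseq (\<lambda>i w. pair_sum (X w) (S i))"
      using seq(3) unfolding pair_sum_def
      by (auto simp: incseq_def le_fun_def intro!: nn_integral_mono mult_right_mono)
    have "(\<integral>\<^sup>+w. (SUP i. pair_sum (X w) (S i)) \<partial>P) = (SUP i. \<integral>\<^sup>+p. r p * S i p \<partial>(lborel \<Otimes>\<^sub>M lborel))"
      using seq by (subst nn_integral_monotone_convergence_SUP[OF incp]) (auto simp: good_def)
    also have "\<dots> = (\<integral>\<^sup>+p. r p * (SUP i. S i p) \<partial>(lborel \<Otimes>\<^sub>M lborel))"
      unfolding SUP_mult_left_ennreal
      by (subst nn_integral_monotone_convergence_SUP[OF inc(2)]) auto
    finally have "good (\<lambda>p. SUP i. S i p)" by (simp add: good_def e)
    moreover have "(\<lambda>p. SUP i. S i p) = (SUP i. S i)" by (simp add: fun_eq_iff image_comp o_def)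
    ultimately show ?case by (simp only:)
  qed
qed

end

section \<open>The map to the sphere\<close>

text \<open>The identity \<open>1 - (2 * t - 1)^2 = 4 * t * (1 - t)\<close> matches the two
  integrands. The interior form of the fundamental theorem is used because the derivative of
  \<open>slice_integral\<close> is available only inside the interval from -1 to 1.\<close>

lemma incomplete_Beta_slice:
  assumes x: "0 \<le> x" "x \<le> 1" and d: "d \<ge> 1"
  shows "incomplete_Beta x (real d) (real d) = slice_integral d (2 * x - 1) / (2 * 4 ^ (d - 1))"
proof -
  have "((\<lambda>t. t powr (real d - 1) * (1 - t) powr (real d - 1)) has_integral
    slice_integral d (2 * x - 1) / (2 * 4 ^ (d - 1)) - slice_integral d (2 * 0 - 1) / (2 * 4 ^ (d - 1))) {0..x}"
  proof (rule fundamental_theorem_of_calculus_interior[OF x(1)])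
    have "continuous_on {0..x} (slice_integral d \<circ> (\<lambda>t. 2 * t - 1))"
      by (intro continuous_on_compose continuous_intros continuous_on_subset[OF continuous_on_slice_integral])
         (use x in auto)
    thus "continuous_on {0..x} (\<lambda>t. slice_integral d (2 * t - 1) / (2 * 4 ^ (d - 1)))"
      by (intro continuous_intros) (auto simp: o_def)
    fix t assume "t \<in> {0<..<x}"
    hence t: "0 < t" "t < 1" using x by auto
    have "((\<lambda>t. slice_integral d (2 * t - 1)) has_real_derivative (1 - (2 * t - 1)\<^sup>2) ^ (d - 1) * 2) (at t)"
      by (rule DERIV_chain2[OF slice_integral_has_derivative]) (use t in \<open>auto intro!: derivative_eq_intros\<close>)
    hence "((\<lambda>t. slice_integral d (2 * t - 1) / (2 * 4 ^ (d - 1))) has_real_derivative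
        (1 - (2 * t - 1)\<^sup>2) ^ (d - 1) * 2 / (2 * 4 ^ (d - 1))) (at t)"
      by (rule DERIV_cdivide)
    also have "(1 - (2 * t - 1)\<^sup>2) ^ (d - 1) * 2 / (2 * 4 ^ (d - 1)) = t ^ (d - 1) * (1 - t) ^ (d - 1)"
    proof -
      have "1 - (2 * t - 1)\<^sup>2 = 4 * (t * (1 - t))" by (simp add: power2_eq_square algebra_simps)
      thus ?thesis by (simp add: power_mult_distrib)
    qed
    also have "\<dots> = t powr (real d - 1) * (1 - t) powr (real d - 1)"
      using t d by (simp add: powr_realpow[symmetric] of_nat_diff)
    finally show "((\<lambda>t. slice_integral d (2 * t - 1) / (2 * 4 ^ (d - 1))) has_vector_derivative
        t powr (real d - 1) * (1 - t) powr (real d - 1)) (at t)"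
      by (simp add: has_real_derivative_iff_has_vector_derivative)
  qed
  thus ?thesis unfolding incomplete_Beta_def by (simp add: integral_unique)
qed

lemma regularized_Beta_slice:
  assumes "0 \<le> x" "x \<le> 1" "d \<ge> 1"
  shows "regularized_Beta x (real d) (real d) = slice_cdf d (2 * x - 1)"
  using incomplete_Beta_slice[OF assms] incomplete_Beta_slice[of 1 d] assms
  by (simp add: regularized_Beta_def slice_cdf_def)

lemma slice_cdf_inj:
  assumes "slice_cdf d a = slice_cdf d b" "-1 \<le> a" "a \<le> 1" "-1 \<le> b" "b \<le> 1"
  shows "a = b"
  using slice_cdf_strict_mono[of a b d] slice_cdf_strict_mono[of b a d] assms by (cases a b rule: linorder_cases) auto

lemma slice_cdf_le_iff:
  assumes "-1 \<le> a" "a \<le> 1" "-1 \<le> b" "b \<le> 1"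
  shows "slice_cdf d a \<le> slice_cdf d b \<longleftrightarrow> a \<le> b"
  using slice_cdf_strict_mono[of a b d] slice_cdf_strict_mono[of b a d] assms by (cases a b rule: linorder_cases) auto

text \<open>The last coordinate of the image on the sphere of a point of norm \<open>r\<close>. In
  terms of the height the equation for \<open>g_fun\<close> becomes one for
  \<open>slice_cdf\<close>, so the map can be studied without \<open>g_fun\<close>.\<close>

definition sphere_height :: "nat \<Rightarrow> real \<Rightarrow> real" where
  "sphere_height d r = (THE t. -1 \<le> t \<and> t \<le> 1 \<and> slice_cdf d t = (r\<^sup>2 / (1 + r\<^sup>2)) ^ d)"

lemma ratio_bounds: "0 \<le> r\<^sup>2 / (1 + r\<^sup>2)" "r\<^sup>2 / (1 + r\<^sup>2) < (1::real)"
  by (simp, subst pos_divide_less_eq) (auto simp: add_pos_nonneg)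

lemma sphere_height:
  assumes d: "d \<ge> 1"
  shows "-1 \<le> sphere_height d r" "sphere_height d r \<le> 1" "slice_cdf d (sphere_height d r) = (r\<^sup>2 / (1 + r\<^sup>2)) ^ d"
proof -
  have "\<exists>t\<ge>-1. t \<le> 1 \<and> slice_cdf d t = (r\<^sup>2 / (1 + r\<^sup>2)) ^ d"
    by (rule IVT') (use ratio_bounds[of r] continuous_on_slice_cdf in \<open>auto intro: power_le_one\<close>)
  hence "\<exists>!t. -1 \<le> t \<and> t \<le> 1 \<and> slice_cdf d t = (r\<^sup>2 / (1 + r\<^sup>2)) ^ d"
    using slice_cdf_inj by (metis (no_types, lifting))
  from theI'[OF this] show "-1 \<le> sphere_height d r" "sphere_height d r \<le> 1" "slice_cdf d (sphere_height d r) = (r\<^sup>2 / (1 + r\<^sup>2)) ^ d"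
    unfolding sphere_height_def by auto
qed

lemma sphere_height_less_1:
  assumes d: "d \<ge> 1"
  shows "sphere_height d r < 1"
proof -
  have "(r\<^sup>2 / (1 + r\<^sup>2)) ^ d < 1"
    using ratio_bounds[of r] d power_strict_mono[of "r\<^sup>2 / (1 + r\<^sup>2)" 1 d] by simp
  hence "sphere_height d r \<noteq> 1" by (metis sphere_height(3)[OF d] slice_cdf_right less_irrefl)
  thus ?thesis using sphere_height(2)[OF d, of r] by simp
qed

lemma sphere_height_greater:
  assumes d: "d \<ge> 1" and r: "r \<noteq> 0"
  shows "-1 < sphere_height d r"
proof -
  have "0 < r\<^sup>2" "0 < 1 + r\<^sup>2" using r by (auto simp: add_pos_nonneg)
  hence "0 < (r\<^sup>2 / (1 + r\<^sup>2)) ^ d" by (intro zero_less_power[of "r\<^sup>2 / (1 + r\<^sup>2)"] divide_pos_pos)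
  hence "sphere_height d r \<noteq> -1" by (metis sphere_height(3)[OF d] slice_cdf_left less_irrefl)
  thus ?thesis using sphere_height(1)[OF d, of r] by simp
qed

lemma sphere_height_0:
  assumes d: "d \<ge> 1"
  shows "sphere_height d 0 = -1"
proof (rule slice_cdf_inj)
  show "slice_cdf d (sphere_height d 0) = slice_cdf d (-1)"
    unfolding sphere_height(3)[OF d] using d by (simp add: power_0_left)
qed (use sphere_height(1,2)[OF d, of 0] in auto)

lemma ratio_mono:
  fixes r q :: real
  assumes "0 \<le> r" "0 \<le> q"
  shows "r\<^sup>2 / (1 + r\<^sup>2) \<le> q\<^sup>2 / (1 + q\<^sup>2) \<longleftrightarrow> r \<le> q"
proof -
  have p: "1 + r\<^sup>2 > 0" "1 + q\<^sup>2 > 0" by (auto simp: add_pos_nonneg)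
  have "r\<^sup>2 / (1 + r\<^sup>2) \<le> q\<^sup>2 / (1 + q\<^sup>2) \<longleftrightarrow> r\<^sup>2 \<le> q\<^sup>2"
    using p by (simp add: divide_le_eq le_divide_eq algebra_simps)
  also have "\<dots> \<longleftrightarrow> r \<le> q" using assms by (simp add: power_mono_iff)
  finally show ?thesis .
qed

lemma sphere_height_le_iff:
  assumes d: "d \<ge> 1" and "0 \<le> r" "0 \<le> q"
  shows "sphere_height d r \<le> sphere_height d q \<longleftrightarrow> r \<le> q"
proof -
  have "sphere_height d r \<le> sphere_height d q \<longleftrightarrow> slice_cdf d (sphere_height d r) \<le> slice_cdf d (sphere_height d q)"
    using sphere_height[OF d] by (intro slice_cdf_le_iff[symmetric]) auto
  also have "\<dots> \<longleftrightarrow> r\<^sup>2 / (1 + r\<^sup>2) \<le> q\<^sup>2 / (1 + q\<^sup>2)"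
    unfolding sphere_height(3)[OF d] using ratio_bounds d by (intro power_mono_iff) auto
  finally show ?thesis using ratio_mono[of r q] assms by simp
qed

text \<open>The height is monotone in a nonnegative radius; \<open>max 0\<close> extends it to a
  monotone, hence Borel, function on the line.\<close>

lemma borel_measurable_sphere_height:
  assumes d: "d \<ge> 1" and f: "f \<in> borel_measurable M" "\<And>x. 0 \<le> f x"
  shows "(\<lambda>x. sphere_height d (f x)) \<in> borel_measurable M"
proof -
  have "mono (\<lambda>r. sphere_height d (max 0 r))" by (intro monoI) (simp add: sphere_height_le_iff[OF d])
  hence "(\<lambda>r. sphere_height d (max 0 r)) \<in> borel_measurable borel" by (rule borel_measurable_mono)
  from measurable_compose[OF f(1) this] show ?thesis using f(2) by (simp add: max_absorb2)
qed

text \<open>A point of height \<open>t\<close> has a stereographic projection of norm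
  \<open>u\<close> with \<open>u^2 = (1 + t) / (1 - t)\<close>, so
  \<open>u^2 / (1 + u^2) = (1 + t) / 2\<close> is the argument at which the Beta function equals
  \<open>slice_cdf d t\<close>.\<close>

lemma g_fun_sphere_height:
  assumes d: "d \<ge> 1" and r: "r > 0"
  shows "g_fun d r = sqrt ((1 + sphere_height d r) / (1 - sphere_height d r))"
  unfolding g_fun_def
proof (rule the_equality)
  define t where "t = sphere_height d r"
  have t: "-1 < t" "t < 1" using sphere_height_greater[OF d, of r] sphere_height_less_1[OF d, of r] r by (auto simp: t_def)
  define u where "u = sqrt ((1 + t) / (1 - t))"
  have u: "u > 0" using t by (simp add: u_def)
  have uu: "u\<^sup>2 = (1 + t) / (1 - t)" using t by (simp add: u_def)
  have "1 + u\<^sup>2 = 2 / (1 - t)" unfolding uu using t by (simp add: field_simps)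
  hence "u\<^sup>2 / (1 + u\<^sup>2) = (1 + t) / 2" unfolding uu using t by simp
  moreover have "regularized_Beta ((1 + t) / 2) (real d) (real d) = slice_cdf d t"
    using t d by (subst regularized_Beta_slice) (auto simp: field_simps)
  ultimately show "0 < sqrt ((1 + sphere_height d r) / (1 - sphere_height d r)) \<and>
    regularized_Beta ((sqrt ((1 + sphere_height d r) / (1 - sphere_height d r)))\<^sup>2 / (1 + (sqrt ((1 + sphere_height d r) / (1 - sphere_height d r)))\<^sup>2)) (real d) (real d) =
      (r\<^sup>2 / (1 + r\<^sup>2)) ^ d"
    using u sphere_height(3)[OF d, of r] by (simp only: u_def t_def)
  fix v assume v: "v > 0 \<and> regularized_Beta (v\<^sup>2 / (1 + v\<^sup>2)) (real d) (real d) = (r\<^sup>2 / (1 + r\<^sup>2)) ^ d"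
  define x where "x = v\<^sup>2 / (1 + v\<^sup>2)"
  have x: "0 \<le> x" "x < 1" using ratio_bounds[of v] by (auto simp: x_def)
  have "slice_cdf d (2 * x - 1) = slice_cdf d t"
    using v regularized_Beta_slice[of x d] x d sphere_height(3)[OF d, of r] by (simp add: x_def t_def)
  hence "2 * x - 1 = t" by (rule slice_cdf_inj) (use x t in auto)
  hence "(1 + t) / (1 - t) = x / (1 - x)" using x by (simp add: field_simps)
  also have "\<dots> = v\<^sup>2"
  proof -
    have p: "1 + v\<^sup>2 > 0" by (simp add: add_pos_nonneg)
    hence "1 - x = 1 / (1 + v\<^sup>2)" by (simp add: x_def field_simps)
    thus ?thesis using p by (simp add: x_def)
  qed
  finally show "v = sqrt ((1 + sphere_height d r) / (1 - sphere_height d r))" using v by (simp add: t_def)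
qed

section \<open>Explicit form of the map\<close>

lemma inverse_stereographic_eq:
  "inverse_stereographic x = ((2 / (1 + (norm x)\<^sup>2)) *\<^sub>R x, ((norm x)\<^sup>2 - 1) / (1 + (norm x)\<^sup>2))"
  unfolding inverse_stereographic_def
proof (rule the_inv_into_f_eq)
  define S where "S = 1 + (norm x)\<^sup>2"
  have S: "S > 0" "(norm x)\<^sup>2 = S - 1" by (simp_all add: S_def add_pos_nonneg)
  \<comment> \<open>A left inverse of the projection away from the pole; it supplies the injectivity
    that \<open>the_inv_into\<close> requires.\<close>
  have recover: "p = ((2 / (1 + (norm (stereographic p))\<^sup>2)) *\<^sub>R stereographic p,
      ((norm (stereographic p))\<^sup>2 - 1) / (1 + (norm (stereographic p))\<^sup>2))"
    if p: "p \<in> sphere 0 1 - {(0, 1)}" for p :: "(complex ^ 'a) \<times> real"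
  proof -
    obtain a t where at: "p = (a, t)" by (cases p)
    have n1: "(norm a)\<^sup>2 + t\<^sup>2 = 1" using p by (simp add: at norm_Pair)
    have t1: "t < 1"
    proof -
      have "t\<^sup>2 \<le> 1" using n1 zero_le_power2[of "norm a"] by linarith
      hence "t \<le> 1" using abs_square_le_1[of t] by auto
      moreover have "t \<noteq> 1" using n1 p by (auto simp: at)
      ultimately show ?thesis by simp
    qed
    have "(norm (stereographic p))\<^sup>2 = (1 - t\<^sup>2) / (1 - t)\<^sup>2"
      using n1 by (simp add: stereographic_def at power_divide power_mult_distrib)
    also have "\<dots> = (1 + t) / (1 - t)"
    proof -
      have "1 - t\<^sup>2 = (1 + t) * (1 - t)" by (simp add: power2_eq_square algebra_simps)
      thus ?thesis using t1 by (simp add: power2_eq_square)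
    qed
    finally have n2: "(norm (stereographic p))\<^sup>2 = (1 + t) / (1 - t)" .
    have s: "1 + (1 + t) / (1 - t) = 2 / (1 - t)" using t1 by (simp add: field_simps)
    have "(2 / (2 / (1 - t))) *\<^sub>R stereographic p = a"
      using t1 by (simp add: stereographic_def at)
    moreover have "((1 + t) / (1 - t) - 1) / (2 / (1 - t)) = t" using t1 by (simp add: field_simps)
    ultimately show ?thesis unfolding n2 s by (simp add: at)
  qed
  show "inj_on (stereographic :: (complex ^ 'a) \<times> real \<Rightarrow> _) (sphere 0 1 - {(0, 1)})"
    by (rule inj_onI) (metis recover)
  have e: "1 - (S - 2) / S = 2 / S" using S by (simp add: field_simps)
  have "stereographic ((2 / S) *\<^sub>R x, (S - 2) / S) = x"
    unfolding stereographic_def fst_conv snd_conv e using S by simp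
  thus "stereographic ((2 / (1 + (norm x)\<^sup>2)) *\<^sub>R x, ((norm x)\<^sup>2 - 1) / (1 + (norm x)\<^sup>2)) = x"
    unfolding S_def by (simp add: algebra_simps)
  have "(norm ((2 / S) *\<^sub>R x, (S - 2) / S))\<^sup>2 = 1"
  proof -
    have "(norm ((2 / S) *\<^sub>R x, (S - 2) / S))\<^sup>2 = (2 / S)\<^sup>2 * (S - 1) + ((S - 2) / S)\<^sup>2"
      by (simp add: norm_Pair power_mult_distrib power_divide S(2)[symmetric])
    also have "\<dots> = (4 * (S - 1) + (S - 2)\<^sup>2) / S\<^sup>2" by (simp add: power_divide add_divide_distrib)
    also have "4 * (S - 1) + (S - 2)\<^sup>2 = S\<^sup>2" by (simp add: power2_eq_square algebra_simps)
    finally show ?thesis using S by simp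
  qed
  hence "norm ((2 / S) *\<^sub>R x, (S - 2) / S) = 1" by (metis norm_ge_zero one_power2 power2_eq_imp_eq zero_le_one)
  moreover have "(S - 2) / S \<noteq> 1" using S by (simp add: field_simps)
  ultimately show "((2 / (1 + (norm x)\<^sup>2)) *\<^sub>R x, ((norm x)\<^sup>2 - 1) / (1 + (norm x)\<^sup>2)) \<in> sphere 0 1 - {(0, 1)}"
    unfolding S_def by (simp add: algebra_simps)
qed

lemma to_sphere_eq:
  fixes z :: "complex ^ 'n::finite"
  shows "to_sphere z = (sqrt (1 - (sphere_height CARD('n) (norm z))\<^sup>2) *\<^sub>R sgn z, sphere_height CARD('n) (norm z))"
proof (cases "z = 0")
  \<comment> \<open>The convention at the origin yields the south pole, in agreement with height -1
    and \<open>sgn 0 = 0\<close>.\<close>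
  case True
  thus ?thesis
    by (simp add: to_sphere_def radial_map_def inverse_stereographic_eq sphere_height_0)
next
  case False
  have d: "CARD('n) \<ge> 1" by simp
  define t where "t = sphere_height CARD('n) (norm z)"
  have t: "-1 < t" "t < 1" using sphere_height_greater[OF d, of "norm z"] sphere_height_less_1[OF d, of "norm z"] False by (auto simp: t_def)
  define u where "u = sqrt ((1 + t) / (1 - t))"
  have u0: "u \<ge> 0" and u: "u\<^sup>2 = (1 + t) / (1 - t)" using t by (auto simp: u_def)
  have x: "radial_map (g_fun CARD('n)) z = u *\<^sub>R sgn z"
    using g_fun_sphere_height[OF d, of "norm z"] False by (simp add: radial_map_def u_def t_def sgn_div_norm)
  have n: "(norm (u *\<^sub>R sgn z))\<^sup>2 = (1 + t) / (1 - t)"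
    using False u by (simp add: norm_sgn power_mult_distrib)
  have s: "1 + (1 + t) / (1 - t) = 2 / (1 - t)" using t by (simp add: field_simps)
  have "(1 - t) * u = sqrt (1 - t\<^sup>2)"
  proof -
    have "((1 - t) * u)\<^sup>2 = (1 - t)\<^sup>2 * ((1 + t) / (1 - t))" by (simp only: power_mult_distrib u)
    also have "\<dots> = 1 - t\<^sup>2" using t by (simp add: power2_eq_square field_simps)
    finally show ?thesis using t u0 by (intro real_sqrt_unique[symmetric]) auto
  qed
  moreover have "2 / (2 / (1 - t)) = 1 - t" using t by (simp add: field_simps)
  ultimately have "(2 / (2 / (1 - t))) *\<^sub>R (u *\<^sub>R sgn z) = sqrt (1 - t\<^sup>2) *\<^sub>R sgn z"
    by (simp only: scaleR_scaleR)
  moreover have "((1 + t) / (1 - t) - 1) / (2 / (1 - t)) = t" using t by (simp add: field_simps)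
  ultimately show ?thesis
    unfolding to_sphere_def o_def x inverse_stereographic_eq n s t_def[symmetric]
    by (simp only:)
qed

lemma norm_to_sphere: "z \<noteq> 0 \<Longrightarrow> norm (to_sphere z) = 1" for z :: "complex ^ 'n::finite"
proof -
  assume "z \<noteq> 0"
  have "(sphere_height CARD('n) (norm z))\<^sup>2 \<le> 1"
    using sphere_height[of "CARD('n)" "norm z"] abs_square_le_1[of "sphere_height CARD('n) (norm z)"] by (auto simp: abs_le_iff)
  thus ?thesis using \<open>z \<noteq> 0\<close> unfolding to_sphere_eq by (simp add: norm_Pair norm_sgn)
qed

text \<open>Distinct points stay distinct in the image, so the energy of the image configuration is
  a pair sum over the original one.\<close>

lemma inj_to_sphere: "inj (to_sphere :: complex ^ 'n::finite \<Rightarrow> _)"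
proof (rule injI)
  fix z w :: "complex ^ 'n"
  assume e: "to_sphere z = to_sphere w"
  have d: "CARD('n) \<ge> 1" by simp
  have h: "sphere_height CARD('n) (norm z) = sphere_height CARD('n) (norm w)" using e by (simp add: to_sphere_eq)
  hence n: "norm z = norm w"
    using sphere_height_le_iff[OF d, of "norm z" "norm w"] sphere_height_le_iff[OF d, of "norm w" "norm z"] by simp
  show "z = w"
  proof (cases "z = 0")
    case False
    define t where "t = sphere_height CARD('n) (norm z)"
    have t: "-1 < t" "t < 1" using sphere_height_greater[OF d, of "norm z"] sphere_height_less_1[OF d, of "norm z"] False by (auto simp: t_def)
    have "sqrt (1 - t\<^sup>2) *\<^sub>R sgn z = sqrt (1 - t\<^sup>2) *\<^sub>R sgn w"
      using e unfolding to_sphere_eq n[symmetric] t_def[symmetric] by simp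
    hence "sgn z = sgn w" using one_minus_square_pos[OF t] by simp
    moreover have "w \<noteq> 0" using n False by auto
    ultimately show ?thesis using n False by (simp add: sgn_div_norm)
  qed (use n in simp)
qed

lemma borel_measurable_to_sphere [measurable]:
  "(to_sphere :: complex ^ 'n::finite \<Rightarrow> _) \<in> borel_measurable borel"
proof -
  have [measurable]: "(\<lambda>z :: complex ^ 'n. sphere_height CARD('n) (norm z)) \<in> borel_measurable borel"
    by (rule borel_measurable_sphere_height) auto
  have "(\<lambda>z :: complex ^ 'n. (sqrt (1 - (sphere_height CARD('n) (norm z))\<^sup>2) *\<^sub>R sgn z, sphere_height CARD('n) (norm z))) \<in> borel_measurable borel"
    by (intro borel_measurable_Pair) measurable
  thus ?thesis unfolding to_sphere_eq[abs_def] .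
qed

text \<open>Both sides are expectations of \<open>G\<close> under probability laws on the line,
  which are shown to have the same distribution function. For \<open>x\<close> strictly between -1
  and 1 the event that the height is at most \<open>x\<close> is \<open>r \<le> a\<close> with
  \<open>sphere_height d a = x\<close>. The radial law gives it mass
  \<open>(a^2 / (1 + a^2))^d\<close>, which is \<open>slice_cdf d x\<close> by definition of the
  height.\<close>

lemma sphere_height_law:
  fixes G :: "real \<Rightarrow> ennreal"
  assumes [measurable]: "G \<in> borel_measurable borel" and d: "d \<ge> 1"
  shows "(\<integral>\<^sup>+r. ennreal (2 * real d) * (ennreal (r ^ (2 * d - 1)) * indicator {0<..} r * ennreal (1 / (1 + r\<^sup>2) ^ (d + 1))) * G (sphere_height d r) \<partial>lborel) =
    (\<integral>\<^sup>+t. ennreal (1 / slice_integral d 1) * (ennreal ((1 - t\<^sup>2) ^ (d - 1)) * indicator {-1<..<1} t) * G t \<partial>lborel)"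
proof -
  define p where "p = (\<lambda>r::real. ennreal (2 * real d) * (ennreal (r ^ (2 * d - 1)) * indicator {0<..} r * ennreal (1 / (1 + r\<^sup>2) ^ (d + 1))))"
  define q where "q = (\<lambda>t::real. ennreal (1 / slice_integral d 1) * (ennreal ((1 - t\<^sup>2) ^ (d - 1)) * indicator {-1<..<1} t))"
  \<comment> \<open>The height depends on \<open>r\<close> through its square, so the absolute value
    does not alter it; it provides the nonnegative argument needed for measurability.\<close>
  define h where "h = (\<lambda>r. sphere_height d \<bar>r\<bar>)"
  have [measurable]: "p \<in> borel_measurable borel" "q \<in> borel_measurable borel" unfolding p_def q_def by measurable
  have h [measurable]: "h \<in> borel_measurable borel"
    unfolding h_def by (rule borel_measurable_sphere_height[OF d]) auto
  have [measurable]: "h -` {..x} \<in> sets borel" for x using measurable_sets[OF h, of "{..x}"] by simp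
  have W: "slice_integral d 1 > 0" by (rule slice_integral_1_pos)
  define M where "M = distr (density lborel p) borel h"
  define N where "N = density lborel q"
  have tot_p: "(\<integral>\<^sup>+r. p r \<partial>lborel) = 1"
    unfolding p_def using d
    by (subst nn_integral_cmult, simp, subst nn_integral_fs_radial(2)[OF d order.refl]) (auto simp: ennreal_mult[symmetric])
  have Nle: "emeasure N {..x} = ennreal (slice_cdf d x)" if x: "-1 \<le> x" "x \<le> 1" for x
  proof -
    have "emeasure N {..x} = (\<integral>\<^sup>+t. ennreal (1 / slice_integral d 1) * (ennreal ((1 - t\<^sup>2) ^ (d - 1)) * indicator {-1..x} t) \<partial>lborel)"
      unfolding N_def
      by (subst emeasure_density, simp, simp, rule nn_integral_cong_AE, rule AE_mp[OF indicator_Ioo_Icc_AE[of "-1" 1]])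
         (use x in \<open>auto simp: q_def split: split_indicator_asm split: split_indicator\<close>)
    also have "\<dots> = ennreal (1 / slice_integral d 1) * ennreal (slice_integral d x - slice_integral d (-1))"
      by (subst nn_integral_cmult, simp, subst nn_integral_slice) (use x in auto)
    also have "\<dots> = ennreal (slice_cdf d x)"
      using W by (simp add: slice_cdf_def ennreal_mult'[symmetric])
    finally show ?thesis .
  qed
  have Nsp: "emeasure N UNIV = emeasure N {..1}"
  proof -
    have "emeasure N UNIV = (\<integral>\<^sup>+t. q t * indicator UNIV t \<partial>lborel)" unfolding N_def by (subst emeasure_density) auto
    also have "\<dots> = (\<integral>\<^sup>+t. q t * indicator {..1} t \<partial>lborel)"
      by (intro nn_integral_cong) (auto simp: q_def indicator_def)
    also have "\<dots> = emeasure N {..1}" unfolding N_def by (subst emeasure_density) auto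
    finally show ?thesis .
  qed
  have Mle: "emeasure M {..x} = ennreal (slice_cdf d x)" if x: "-1 < x" "x < 1" for x
  proof -
    \<comment> \<open>Solves \<open>sphere_height d a = x\<close> for \<open>a\<close>: the ratio
      \<open>a^2 / (1 + a^2)\<close> has to be the \<open>d\<close>-th root of
      \<open>slice_cdf d x\<close>.\<close>
    define e where "e = root d (slice_cdf d x)"
    note F = slice_cdf_bounds[OF x, of d]
    have e: "0 < e" "e < 1" "e ^ d = slice_cdf d x"
      using F d by (auto simp: e_def)
    define a where "a = sqrt (e / (1 - e))"
    have a: "0 \<le> a" "a\<^sup>2 = e / (1 - e)" using e by (auto simp: a_def)
    have ae: "a\<^sup>2 / (1 + a\<^sup>2) = e" unfolding a(2) using e by (simp add: field_simps)
    have ha: "sphere_height d a = x"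
    proof (rule slice_cdf_inj)
      show "slice_cdf d (sphere_height d a) = slice_cdf d x"
        unfolding sphere_height(3)[OF d] ae e(3) ..
    qed (use sphere_height(1,2)[OF d, of a] x in auto)
    have "emeasure M {..x} = (\<integral>\<^sup>+r. p r * indicator {r. h r \<le> x} r \<partial>lborel)"
    proof -
      have "h -` {..x} = {r. h r \<le> x}" by auto
      thus ?thesis unfolding M_def by (subst emeasure_distr, simp, simp, subst emeasure_density) auto
    qed
    also have "\<dots> = (\<integral>\<^sup>+r. ennreal (2 * real d) * (ennreal (r ^ (2 * d - 1)) * indicator {0<..} r * (ennreal (1 / (1 + r\<^sup>2) ^ (d + 1)) * indicator {..a} r)) \<partial>lborel)"
    proof (rule nn_integral_cong)
      fix r :: real
      show "p r * indicator {r. h r \<le> x} r =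
        ennreal (2 * real d) * (ennreal (r ^ (2 * d - 1)) * indicator {0<..} r * (ennreal (1 / (1 + r\<^sup>2) ^ (d + 1)) * indicator {..a} r))"
      proof (cases "r > 0")
        case True
        hence "h r \<le> x \<longleftrightarrow> r \<le> a" using sphere_height_le_iff[OF d, of r a] a by (simp add: h_def ha)
        thus ?thesis by (simp add: p_def indicator_def mult_ac)
      qed (simp add: p_def)
    qed
    also have "\<dots> = ennreal (2 * real d) * ennreal (e ^ d / (2 * d))"
      by (subst nn_integral_cmult, simp, subst nn_integral_fs_radial(1)[OF d a(1)]) (simp only: ae, simp)
    also have "\<dots> = ennreal (2 * real d * (e ^ d / (2 * d)))" using e F by (intro ennreal_mult[symmetric]) auto
    also have "2 * real d * (e ^ d / (2 * d)) = slice_cdf d x" using d e by simp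
    finally show ?thesis .
  qed
  have M1: "emeasure M UNIV = 1"
    unfolding M_def using tot_p by (subst emeasure_distr) (auto simp: emeasure_density)
  have N1: "emeasure N UNIV = 1" using Nsp Nle[of 1] by simp
  have sM: "sets M = sets borel" "space M = UNIV" "sets N = sets borel" "space N = UNIV" by (auto simp: M_def N_def)
  interpret M: real_distribution M
    by (rule real_distribution.intro, rule prob_spaceI, unfold real_distribution_axioms_def) (use M1 sM in auto)
  interpret N: real_distribution N
    by (rule real_distribution.intro, rule prob_spaceI, unfold real_distribution_axioms_def) (use N1 sM in auto)
  have "M = N"
  proof (rule cdf_unique[OF M.real_distribution_axioms N.real_distribution_axioms], rule ext)
    fix x :: real
    consider "x \<le> -1" | "-1 < x" "x < 1" | "1 \<le> x" by linarith
    hence "emeasure M {..x} = emeasure N {..x}"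
    proof cases
      case 1
      have "emeasure N {..x} \<le> emeasure N {..-1}" by (rule emeasure_mono) (use 1 sM in auto)
      hence n: "emeasure N {..x} = 0" using Nle[of "-1"] by simp
      have "emeasure M {..x} = (\<integral>\<^sup>+r. p r * indicator (h -` {..x}) r \<partial>lborel)"
        unfolding M_def by (subst emeasure_distr, simp, simp, subst emeasure_density)  auto
      also have "\<dots> = (\<integral>\<^sup>+r. 0 \<partial>(lborel :: real measure))"
      proof (rule nn_integral_cong)
        fix r :: real
        have "x < h r" if "r > 0" using sphere_height_greater[OF d, of r] that 1 by (simp add: h_def)
        thus "p r * indicator (h -` {..x}) r = 0" by (cases "r > 0") (auto simp: p_def indicator_def)
      qed
      finally show ?thesis using n by simp
    next
      case 2
      thus ?thesis using Mle Nle by simp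
    next
      case 3
      have "emeasure N {..1} \<le> emeasure N {..x}" by (rule emeasure_mono) (use 3 sM in auto)
      hence "1 \<le> emeasure N {..x}" using Nsp N1 by (simp only:)
      with N.emeasure_le_1[of "{..x}"] have n: "emeasure N {..x} = 1" by (rule order.antisym)
      have "h -` {..x} = UNIV"
        using sphere_height(2)[OF d] 3 by (auto simp: h_def intro: order.trans)
      hence "emeasure M {..x} = (\<integral>\<^sup>+r. p r \<partial>lborel)"
        unfolding M_def by (subst emeasure_distr) (auto simp: emeasure_density)
      thus ?thesis using n tot_p by simp
    qed
    thus "cdf M x = cdf N x" by (simp add: cdf_def measure_def)
  qed
  have "(\<integral>\<^sup>+r. p r * G (sphere_height d r) \<partial>lborel) = (\<integral>\<^sup>+r. p r * G (h r) \<partial>lborel)"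
    by (intro nn_integral_cong) (auto simp: p_def h_def indicator_def)
  also have "\<dots> = (\<integral>\<^sup>+t. G t \<partial>M)"
    unfolding M_def by (subst nn_integral_distr, simp, simp, subst nn_integral_density) auto
  also have "\<dots> = (\<integral>\<^sup>+t. q t * G t \<partial>lborel)"
    unfolding \<open>M = N\<close> N_def by (subst nn_integral_density) auto
  finally show ?thesis unfolding p_def q_def .
qed

text \<open>The map of the theorem is chosen such that it sends the one-point intensity to the uniform
  measure of the sphere.\<close>

lemma to_sphere_law:
  fixes f :: "(complex ^ 'n::finite) \<times> real \<Rightarrow> ennreal"
  assumes [measurable]: "f \<in> borel_measurable borel"
  shows "(\<integral>\<^sup>+z. ennreal (fs_density z) * f (to_sphere z) \<partial>lborel) =
    ennreal (1 / sphere_vol TYPE((complex ^ 'n) \<times> real)) * (\<integral>\<^sup>+p. f p \<partial>sphere_measure)"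
proof -
  let ?d = "CARD('n)"
  let ?V = "sphere_vol TYPE(complex ^ 'n)"
  have d: "?d \<ge> 1" by simp
  have V: "?V > 0" by (rule sphere_vol_pos)
  have W: "slice_integral ?d 1 > 0" by (rule slice_integral_1_pos)
  have f2 [measurable]: "f \<in> borel_measurable (borel \<Otimes>\<^sub>M borel)" by (simp add: borel_prod)
  have id [measurable]: "(\<lambda>u. u) \<in> borel_measurable (sphere_measure :: (complex ^ 'n) measure)"
    by (rule borel_measurable_sphere_measureI) simp
  have [measurable]: "fs_density \<in> borel_measurable (borel :: (complex ^ 'n) measure)"
    unfolding fs_density_def[abs_def] by measurable
  interpret S: finite_measure "sphere_measure :: (complex ^ 'n) measure" by (rule finite_measure_sphere_measure)
  have "(\<integral>\<^sup>+z. ennreal (fs_density z) * f (to_sphere z) \<partial>lborel) =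
    (\<integral>\<^sup>+u. \<integral>\<^sup>+r. ennreal (r ^ (2 * ?d - 1)) * indicator {0<..} r * (ennreal (fs_density (r *\<^sub>R u)) * f (to_sphere (r *\<^sub>R u))) \<partial>lborel \<partial>(sphere_measure :: (complex ^ 'n) measure))"
    by (subst nn_integral_polar) (auto simp: mult.commute[of 2])
  also have "\<dots> = (\<integral>\<^sup>+u. \<integral>\<^sup>+r. ennreal (1 / ?V) * (ennreal (2 * real ?d) * (ennreal (r ^ (2 * ?d - 1)) * indicator {0<..} r * ennreal (1 / (1 + r\<^sup>2) ^ (?d + 1))) *
      f (sqrt (1 - (sphere_height ?d r)\<^sup>2) *\<^sub>R u, sphere_height ?d r)) \<partial>lborel \<partial>sphere_measure)"
  proof (intro nn_integral_cong)
    fix u :: "complex ^ 'n" and r :: real assume "u \<in> space sphere_measure"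
    hence u: "norm u = 1" by simp
    show "ennreal (r ^ (2 * ?d - 1)) * indicator {0<..} r * (ennreal (fs_density (r *\<^sub>R u)) * f (to_sphere (r *\<^sub>R u))) =
      ennreal (1 / ?V) * (ennreal (2 * real ?d) * (ennreal (r ^ (2 * ?d - 1)) * indicator {0<..} r * ennreal (1 / (1 + r\<^sup>2) ^ (?d + 1))) *
      f (sqrt (1 - (sphere_height ?d r)\<^sup>2) *\<^sub>R u, sphere_height ?d r))"
    proof (cases "r > 0")
      case True
      have "ennreal (fs_density (r *\<^sub>R u)) = ennreal ((1 / ?V) * ((2 * real ?d) * (1 / (1 + r\<^sup>2) ^ (?d + 1))))"
        using u by (simp add: fs_density_def mult_ac)
      also have "\<dots> = ennreal (1 / ?V) * (ennreal (2 * real ?d) * ennreal (1 / (1 + r\<^sup>2) ^ (?d + 1)))"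
        using V by (subst ennreal_mult, simp, simp, subst ennreal_mult) auto
      finally have e: "ennreal (fs_density (r *\<^sub>R u)) = ennreal (1 / ?V) * (ennreal (2 * real ?d) * ennreal (1 / (1 + r\<^sup>2) ^ (?d + 1)))" .
      have "sgn (r *\<^sub>R u) = u" using True u by (simp add: sgn_div_norm)
      hence "to_sphere (r *\<^sub>R u) = (sqrt (1 - (sphere_height ?d r)\<^sup>2) *\<^sub>R u, sphere_height ?d r)"
        unfolding to_sphere_eq using True u by simp
      thus ?thesis unfolding e by (simp only: mult_ac)
    qed simp
  qed
  also have "\<dots> = (\<integral>\<^sup>+u. ennreal (1 / ?V) * (\<integral>\<^sup>+t. ennreal (1 / slice_integral ?d 1) * (ennreal ((1 - t\<^sup>2) ^ (?d - 1)) * indicator {-1<..<1} t) * f (sqrt (1 - t\<^sup>2) *\<^sub>R u, t) \<partial>lborel) \<partial>sphere_measure)"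
  proof (rule nn_integral_cong)
    fix u :: "complex ^ 'n"
    have [measurable]: "(\<lambda>r. indicator {0<..} r * f (sqrt (1 - (sphere_height ?d r)\<^sup>2) *\<^sub>R u, sphere_height ?d r)) \<in> borel_measurable borel"
    proof -
      have [measurable]: "(\<lambda>r. sphere_height ?d \<bar>r\<bar>) \<in> borel_measurable borel"
        by (rule borel_measurable_sphere_height[OF d]) auto
      have "(\<lambda>r. indicator {0<..} r * f (sqrt (1 - (sphere_height ?d r)\<^sup>2) *\<^sub>R u, sphere_height ?d r)) =
        (\<lambda>r. indicator {0<..} r * f (sqrt (1 - (sphere_height ?d \<bar>r\<bar>)\<^sup>2) *\<^sub>R u, sphere_height ?d \<bar>r\<bar>))"
        by (auto simp: indicator_def)
      thus ?thesis by simp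
    qed
    have "(\<integral>\<^sup>+r. ennreal (1 / ?V) * (ennreal (2 * real ?d) * (ennreal (r ^ (2 * ?d - 1)) * indicator {0<..} r * ennreal (1 / (1 + r\<^sup>2) ^ (?d + 1))) *
      f (sqrt (1 - (sphere_height ?d r)\<^sup>2) *\<^sub>R u, sphere_height ?d r)) \<partial>lborel) =
      ennreal (1 / ?V) * (\<integral>\<^sup>+r. ennreal (2 * real ?d) * (ennreal (r ^ (2 * ?d - 1)) * indicator {0<..} r * ennreal (1 / (1 + r\<^sup>2) ^ (?d + 1))) *
      f (sqrt (1 - (sphere_height ?d r)\<^sup>2) *\<^sub>R u, sphere_height ?d r) \<partial>lborel)"
    proof (rule nn_integral_cmult)
      have "(\<lambda>r. (ennreal (2 * real ?d) * ennreal (r ^ (2 * ?d - 1)) * ennreal (1 / (1 + r\<^sup>2) ^ (?d + 1))) * (indicator {0<..} r * f (sqrt (1 - (sphere_height ?d r)\<^sup>2) *\<^sub>R u, sphere_height ?d r))) \<in> borel_measurable lborel"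
        by measurable
      thus "(\<lambda>r. ennreal (2 * real ?d) * (ennreal (r ^ (2 * ?d - 1)) * indicator {0<..} r * ennreal (1 / (1 + r\<^sup>2) ^ (?d + 1))) *
        f (sqrt (1 - (sphere_height ?d r)\<^sup>2) *\<^sub>R u, sphere_height ?d r)) \<in> borel_measurable lborel"
        by (simp only: mult_ac)
    qed
    also have "(\<integral>\<^sup>+r. ennreal (2 * real ?d) * (ennreal (r ^ (2 * ?d - 1)) * indicator {0<..} r * ennreal (1 / (1 + r\<^sup>2) ^ (?d + 1))) *
      f (sqrt (1 - (sphere_height ?d r)\<^sup>2) *\<^sub>R u, sphere_height ?d r) \<partial>lborel) =
      (\<integral>\<^sup>+t. ennreal (1 / slice_integral ?d 1) * (ennreal ((1 - t\<^sup>2) ^ (?d - 1)) * indicator {-1<..<1} t) * f (sqrt (1 - t\<^sup>2) *\<^sub>R u, t) \<partial>lborel)"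
      by (rule sphere_height_law[OF _ d, of "\<lambda>t. f (sqrt (1 - t\<^sup>2) *\<^sub>R u, t)"]) measurable
    finally show "(\<integral>\<^sup>+r. ennreal (1 / ?V) * (ennreal (2 * real ?d) * (ennreal (r ^ (2 * ?d - 1)) * indicator {0<..} r * ennreal (1 / (1 + r\<^sup>2) ^ (?d + 1))) *
      f (sqrt (1 - (sphere_height ?d r)\<^sup>2) *\<^sub>R u, sphere_height ?d r)) \<partial>lborel) =
      ennreal (1 / ?V) * (\<integral>\<^sup>+t. ennreal (1 / slice_integral ?d 1) * (ennreal ((1 - t\<^sup>2) ^ (?d - 1)) * indicator {-1<..<1} t) * f (sqrt (1 - t\<^sup>2) *\<^sub>R u, t) \<partial>lborel)" .
  qed
  also have "\<dots> = (\<integral>\<^sup>+u. (ennreal (1 / ?V) * ennreal (1 / slice_integral ?d 1)) * (\<integral>\<^sup>+t. ennreal ((1 - t\<^sup>2) ^ (?d - 1)) * indicator {-1<..<1} t * f (sqrt (1 - t\<^sup>2) *\<^sub>R u, t) \<partial>lborel) \<partial>sphere_measure)"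
    unfolding mult.assoc by (subst nn_integral_cmult) (auto simp: mult.assoc)
  also have "\<dots> = (ennreal (1 / ?V) * ennreal (1 / slice_integral ?d 1)) * (\<integral>\<^sup>+p. f p \<partial>sphere_measure)"
    by (subst nn_integral_cmult, simp, subst nn_integral_sphere_slice[of f ?d]) auto
  also have "ennreal (1 / ?V) * ennreal (1 / slice_integral ?d 1) = ennreal (1 / sphere_vol TYPE((complex ^ 'n) \<times> real))"
    unfolding sphere_vol_slice[OF DIM_complex_vec] using V W by (subst ennreal_mult[symmetric]) auto
  finally show ?thesis .
qed

section \<open>Energy estimates\<close>

lemma fs_cos2_nonneg: "0 \<le> fs_cos2 z w"
  by (simp add: fs_cos2_def)

lemma fs_cos2_le_1: "fs_cos2 z w \<le> 1"
proof -
  have "cmod (1 + herm z w) \<le> 1 + norm z * norm w"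
    using norm_triangle_ineq[of 1 "herm z w"] norm_herm_le[of z w] by simp
  hence "(cmod (1 + herm z w))\<^sup>2 \<le> (1 + norm z * norm w)\<^sup>2" by (intro power_mono) auto
  also have "\<dots> \<le> (1 + (norm z)\<^sup>2) * (1 + (norm w)\<^sup>2)"
    using zero_le_power2[of "norm z - norm w"] by (simp add: power2_eq_square algebra_simps)
  finally show ?thesis
    using mult_pos_pos[OF one_plus_norm_pos[of z] one_plus_norm_pos[of w]] by (simp add: fs_cos2_def)
qed

lemma fs_density_nonneg: "0 \<le> fs_density z" for z :: "complex ^ 'n::finite"
  using sphere_vol_pos[where 'a = "complex ^ 'n"] by (simp add: fs_density_def)

lemma borel_measurable_fs_density [measurable]:
  "fs_density \<in> borel_measurable (borel :: (complex ^ 'n::finite) measure)"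
  unfolding fs_density_def[abs_def] by measurable

lemma borel_measurable_fs_cos2 [measurable]:
  "(\<lambda>p :: (complex ^ 'n::finite) \<times> (complex ^ 'n). fs_cos2 (fst p) (snd p)) \<in> borel_measurable (borel \<Otimes>\<^sub>M borel)"
proof -
  have "continuous_on UNIV (\<lambda>p :: (complex ^ 'n) \<times> (complex ^ 'n). fs_cos2 (fst p) (snd p))"
    unfolding fs_cos2_def herm_def
    by (intro continuous_intros) (auto simp: one_plus_norm_neq_0)
  thus ?thesis unfolding borel_prod by (rule borel_measurable_continuous_onI)
qed

lemma inner_eq_Re_herm: "z \<bullet> w = Re (herm z w)"
  by (simp add: inner_vec_def herm_def inner_complex_def)

text \<open>Let \<open>c\<close> be the real part of the normalised Hermitian product and
  \<open>p\<close>, \<open>q\<close> the images on the sphere. The radial part of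
  \<open>1 - c\<close> is controlled by \<open>radius_contraction\<close>; the angular part
  \<open>n * n' * (1 - h)\<close> is at most \<open>k * y * y' * (1 - h)\<close> by
  \<open>radius_slice_bound\<close>. As \<open>k \<ge> 1\<close>, together
  \<open>1 - c \<le> k * (1 - p \<bullet> q)\<close>.\<close>

lemma fs_cos2_lower:
  fixes z w :: "complex ^ 'n::finite"
  assumes d: "CARD('n) \<ge> 2" and zw: "z \<noteq> 0" "w \<noteq> 0" and T: "0 \<le> T" "T < 1"
    and hT: "snd (to_sphere z) \<le> T" "snd (to_sphere w) \<le> T"
  shows "1 - (norm (to_sphere z - to_sphere w))\<^sup>2 / (1 - T\<^sup>2) \<le> fs_cos2 z w"
proof -
  let ?d = "CARD('n)"
  have d1: "?d \<ge> 1" by simp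
  define t where "t = sphere_height ?d (norm z)"
  define t' where "t' = sphere_height ?d (norm w)"
  define n where "n = norm z / sqrt (1 + (norm z)\<^sup>2)"
  define n' where "n' = norm w / sqrt (1 + (norm w)\<^sup>2)"
  define y where "y = sqrt (1 - t\<^sup>2)"
  define y' where "y' = sqrt (1 - t'\<^sup>2)"
  define h where "h = sgn z \<bullet> sgn w"
  define k where "k = 1 / (1 - T\<^sup>2)"
  have t: "-1 < t" "t < 1" "t \<le> T" and t': "-1 < t'" "t' < 1" "t' \<le> T"
    using sphere_height_greater[OF d1, of "norm z"] sphere_height_less_1[OF d1, of "norm z"]
      sphere_height_greater[OF d1, of "norm w"] sphere_height_less_1[OF d1, of "norm w"] zw hT
    by (auto simp: t_def t'_def to_sphere_eq)
  have t2: "0 < 1 - t\<^sup>2" "0 < 1 - t'\<^sup>2" using one_minus_square_pos t t' by auto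
  have T2: "0 < 1 - T\<^sup>2" "1 - T\<^sup>2 \<le> 1" using one_minus_square_pos[of T] T by auto
  have k: "k \<ge> 1" using T2 by (simp add: k_def)
  have n0: "0 \<le> n" "0 \<le> n'" by (auto simp: n_def n'_def)
  have n2: "n\<^sup>2 = (norm z)\<^sup>2 / (1 + (norm z)\<^sup>2)" "n'\<^sup>2 = (norm w)\<^sup>2 / (1 + (norm w)\<^sup>2)"
    using one_plus_norm_pos[of z] one_plus_norm_pos[of w] by (simp_all add: n_def n'_def power_divide)
  have nF: "n ^ (2 * ?d) = slice_cdf ?d t" "n' ^ (2 * ?d) = slice_cdf ?d t'"
    unfolding power_mult n2 t_def t'_def sphere_height(3)[OF d1] by simp_all
  have sn: "sqrt (1 - n\<^sup>2) = 1 / sqrt (1 + (norm z)\<^sup>2)" "sqrt (1 - n'\<^sup>2) = 1 / sqrt (1 + (norm w)\<^sup>2)"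
  proof -
    have "1 - n\<^sup>2 = 1 / (1 + (norm z)\<^sup>2)" "1 - n'\<^sup>2 = 1 / (1 + (norm w)\<^sup>2)"
      unfolding n2 using one_plus_norm_pos[of z] one_plus_norm_pos[of w] by (simp_all add: field_simps)
    thus "sqrt (1 - n\<^sup>2) = 1 / sqrt (1 + (norm z)\<^sup>2)" "sqrt (1 - n'\<^sup>2) = 1 / sqrt (1 + (norm w)\<^sup>2)"
      by (simp_all add: real_sqrt_divide)
  qed
  have rad: "t * t' + y * y' \<le> n * n' + sqrt (1 - n\<^sup>2) * sqrt (1 - n'\<^sup>2)"
    unfolding y_def y'_def by (rule radius_contraction[OF d t(1,2) t'(1,2) n0(1) nF(1) n0(2) nF(2)])
  have "n * n' \<le> (y / sqrt (1 - T\<^sup>2)) * (y' / sqrt (1 - T\<^sup>2))"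
  proof (rule mult_mono)
    show "n \<le> y / sqrt (1 - T\<^sup>2)"
      unfolding y_def by (rule radius_slice_bound[OF d1 t(1,3) T n0(1) nF(1)])
    show "n' \<le> y' / sqrt (1 - T\<^sup>2)"
      unfolding y'_def by (rule radius_slice_bound[OF d1 t'(1,3) T n0(2) nF(2)])
  qed (use n0 t2 T2 in \<open>auto simp: y_def\<close>)
  also have "\<dots> = k * (y * y')"
    using T2 by (simp add: k_def divide_simps)
  finally have nn: "n * n' \<le> k * (y * y')" .
  have sg: "norm (sgn z) = 1" "norm (sgn w) = 1" using zw by (auto simp: norm_sgn)
  have h1: "h \<le> 1" using norm_cauchy_schwarz[of "sgn z" "sgn w"] sg by (simp add: h_def)
  have y2: "y\<^sup>2 = 1 - t\<^sup>2" "y'\<^sup>2 = 1 - t'\<^sup>2" using t2 by (simp_all add: y_def y'_def)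
  have tt: "t * t' + y * y' \<le> 1"
    using zero_le_power2[of "t - t'"] zero_le_power2[of "y - y'"] y2
    by (simp add: power2_eq_square algebra_simps)
  define c where "c = n * n' * h + sqrt (1 - n\<^sup>2) * sqrt (1 - n'\<^sup>2)"
  have A: "1 - k * (1 - (t * t' + y * y' * h)) \<le> c"
  proof -
    have "n * n' * (1 - h) \<le> k * (y * y') * (1 - h)" using nn h1 by (intro mult_right_mono) auto
    moreover have "0 \<le> (k - 1) * (1 - (t * t' + y * y'))" using k tt by (intro mult_nonneg_nonneg) auto
    ultimately show ?thesis using rad unfolding c_def by (simp add: algebra_simps)
  qed
  have E: "(norm (to_sphere z - to_sphere w))\<^sup>2 = 2 - 2 * (t * t' + y * y' * h)"
  proof -
    have "(norm (to_sphere z - to_sphere w))\<^sup>2 = (norm (to_sphere z))\<^sup>2 + (norm (to_sphere w))\<^sup>2 - 2 * (to_sphere z \<bullet> to_sphere w)"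
      using dot_norm_neg[of "to_sphere z" "to_sphere w"] by simp
    also have "to_sphere z \<bullet> to_sphere w = t * t' + y * y' * h"
      unfolding to_sphere_eq t_def[symmetric] t'_def[symmetric] y_def[symmetric] y'_def[symmetric]
      by (simp add: h_def)
    finally show ?thesis using zw by (simp add: norm_to_sphere)
  qed
  have "1 - k * (2 - 2 * u) \<le> 2 * c - 1" if "1 - k * (1 - u) \<le> c" for u
    using that by (simp add: right_diff_distrib)
  from this[OF A] have "1 - k * (norm (to_sphere z - to_sphere w))\<^sup>2 \<le> 2 * c - 1" unfolding E .
  \<comment> \<open>This bound for the square holds for either sign of \<open>c\<close>. It doubles
    the defect, which fits \<open>2 - 2 * (p \<bullet> q)\<close>, the squared distance of the
    images.\<close>
  also have "\<dots> \<le> c\<^sup>2" using zero_le_power2[of "c - 1"] by (simp add: power2_eq_square algebra_simps)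
  also have "c\<^sup>2 \<le> fs_cos2 z w"
  proof -
    define S where "S = sqrt (1 + (norm z)\<^sup>2)"
    define S' where "S' = sqrt (1 + (norm w)\<^sup>2)"
    have S: "S > 0" "S' > 0" "S\<^sup>2 = 1 + (norm z)\<^sup>2" "S'\<^sup>2 = 1 + (norm w)\<^sup>2"
      using one_plus_norm_pos[of z] one_plus_norm_pos[of w] by (auto simp: S_def S'_def)
    have "z \<bullet> w = norm z * norm w * h"
      using zw by (simp add: h_def sgn_div_norm field_simps)
    hence "c = (1 + z \<bullet> w) / (S * S')"
      unfolding c_def sn unfolding n_def n'_def S_def[symmetric] S'_def[symmetric]
      by (simp add: add_divide_distrib)
    also have "\<dots> = Re (1 + herm z w) / (S * S')" by (simp add: inner_eq_Re_herm)
    finally have "c\<^sup>2 = (Re (1 + herm z w))\<^sup>2 / (S\<^sup>2 * S'\<^sup>2)" by (simp add: power_divide power_mult_distrib)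
    also have "\<dots> \<le> (cmod (1 + herm z w))\<^sup>2 / (S\<^sup>2 * S'\<^sup>2)"
      by (intro divide_right_mono) (auto simp: cmod_power2)
    finally show ?thesis unfolding fs_cos2_def S(3,4) .
  qed
  finally show ?thesis by (simp add: k_def)
qed

section \<open>Intensities of the projection process\<close>

definition pair_density :: "nat \<Rightarrow> nat \<Rightarrow> (complex ^ 'n::finite) \<times> (complex ^ 'n) \<Rightarrow> real" where
  "pair_density N L p = (real N)\<^sup>2 * fs_density (fst p) * fs_density (snd p) * (1 - fs_cos2 (fst p) (snd p) ^ L)"

lemma borel_measurable_pair_density [measurable]:
  "pair_density N L \<in> borel_measurable (borel \<Otimes>\<^sub>M borel :: ((complex ^ 'n::finite) \<times> (complex ^ 'n)) measure)"
  unfolding pair_density_def[abs_def] by measurable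

lemma nn_integral_PiM_2:
  fixes g :: "'a::euclidean_space \<Rightarrow> 'a \<Rightarrow> ennreal"
  assumes [measurable]: "case_prod g \<in> borel_measurable (lborel \<Otimes>\<^sub>M lborel)"
  shows "(\<integral>\<^sup>+x. g (x 0) (x 1) \<partial>(PiM {..<2::nat} (\<lambda>_. lborel))) = (\<integral>\<^sup>+p. g (fst p) (snd p) \<partial>(lborel \<Otimes>\<^sub>M lborel))"
proof -
  interpret product_sigma_finite "\<lambda>_ :: nat. lborel :: 'a measure" ..
  have e: "{..<2::nat} = insert 1 {0}" by auto
  have [measurable]: "(\<lambda>x. g (x 0) (x 1)) \<in> borel_measurable (PiM (insert 1 {0::nat}) (\<lambda>_. lborel))"
  proof -
    have "(\<lambda>x. (x 0, x 1)) \<in> PiM (insert 1 {0::nat}) (\<lambda>_. lborel) \<rightarrow>\<^sub>M (lborel \<Otimes>\<^sub>M lborel :: ('a \<times> 'a) measure)"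
      by (intro measurable_Pair measurable_component_singleton) auto
    from measurable_compose[OF this assms] show ?thesis by simp
  qed
  have "(\<integral>\<^sup>+x. g (x 0) (x 1) \<partial>(PiM {..<2::nat} (\<lambda>_. lborel))) =
    (\<integral>\<^sup>+x. \<integral>\<^sup>+y. g (x 0) y \<partial>lborel \<partial>(PiM {0::nat} (\<lambda>_. lborel)))"
    unfolding e by (subst product_nn_integral_insert) auto
  also have "\<dots> = (\<integral>\<^sup>+x. \<integral>\<^sup>+y. g x y \<partial>lborel \<partial>lborel)"
    by (rule product_nn_integral_singleton[of "\<lambda>x. \<integral>\<^sup>+y. g x y \<partial>lborel"]) measurable
  also have "\<dots> = (\<integral>\<^sup>+p. g (fst p) (snd p) \<partial>(lborel \<Otimes>\<^sub>M lborel))"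
    by (subst lborel.nn_integral_fst[symmetric]) (auto simp: split_beta')
  finally show ?thesis .
qed

lemma nn_integral_fs_density: "(\<integral>\<^sup>+z. ennreal (fs_density z) \<partial>(lborel :: (complex ^ 'n::finite) measure)) = 1"
proof -
  have "(\<integral>\<^sup>+z. ennreal (fs_density z) \<partial>(lborel :: (complex ^ 'n) measure)) =
    ennreal (1 / sphere_vol TYPE((complex ^ 'n) \<times> real)) * (\<integral>\<^sup>+p. 1 \<partial>(sphere_measure :: ((complex ^ 'n) \<times> real) measure))"
    using to_sphere_law[of "\<lambda>_ :: (complex ^ 'n) \<times> real. 1"] by simp
  also have "(\<integral>\<^sup>+p. 1 \<partial>(sphere_measure :: ((complex ^ 'n) \<times> real) measure)) = ennreal (sphere_vol TYPE((complex ^ 'n) \<times> real))"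
    by (simp add: emeasure_sphere_vol)
  finally show ?thesis
    using sphere_vol_pos[where 'a = "(complex ^ 'n) \<times> real"] by (simp add: ennreal_mult'[symmetric])
qed

text \<open>The definition only asserts that some kernel exists; uniqueness identifies it pointwise,
  because the subspace consists of functions rather than classes.\<close>

lemma projection_dpp_kernel:
  fixes X :: "'w \<Rightarrow> (complex ^ 'n::finite) set"
  assumes "projection_dpp P lborel (weighted_polynomials L) X"
  shows "determinantal P lborel (fs_kernel L) X"
proof -
  obtain K where K: "reproducing_kernel lborel (weighted_polynomials L :: (complex ^ 'n \<Rightarrow> complex) set) K" "determinantal P lborel K X"
    using assms unfolding projection_dpp_def by auto
  have "K = fs_kernel L"
    using reproducing_kernel_unique[OF K(1) fs_kernel_reproducing] by (intro ext) simp
  thus ?thesis using K by simp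
qed

lemma joint_intensityD:
  assumes ji: "joint_intensity P \<mu> X k \<rho>"
    and D: "\<And>i. i < k \<Longrightarrow> D i \<in> sets \<mu>" "disjoint_family_on D {..<k}"
  shows "(\<integral>\<^sup>+w. (\<Prod>i<k. num_points (X w) (D i)) \<partial>P) =
    (\<integral>\<^sup>+x. ennreal (\<rho> x) * indicator (Pi\<^sub>E {..<k} D) x \<partial>(PiM {..<k} (\<lambda>_. \<mu>)))"
proof -
  have "(\<forall>i<k. D i \<in> sets \<mu>) \<and> disjoint_family_on D {..<k}" using D by simp
  with ji[unfolded joint_intensity_def, THEN conjunct2, THEN conjunct2, THEN spec[of _ D]]
  show ?thesis by (rule mp)
qed

lemma two_point_projection_dpp:
  fixes X :: "'w \<Rightarrow> (complex ^ 'n::finite) set"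
  assumes X: "projection_dpp P lborel (weighted_polynomials L) X" and N: "N = (CARD('n) + L) choose CARD('n)"
  shows "two_point P X (\<lambda>p. ennreal (pair_density N L p))"
proof
  note det = projection_dpp_kernel[OF X]
  show "point_process P lborel X" using det by (simp add: determinantal_def)
  have lp: "sets (lborel \<Otimes>\<^sub>M lborel) = sets (borel \<Otimes>\<^sub>M borel :: ((complex ^ 'n) \<times> (complex ^ 'n)) measure)"
    by (rule sets_pair_measure_cong) auto
  note [measurable_cong] = lp
  show m: "(\<lambda>p. ennreal (pair_density N L p)) \<in> borel_measurable (lborel \<Otimes>\<^sub>M lborel :: ((complex ^ 'n) \<times> (complex ^ 'n)) measure)"
    by measurable
  \<comment> \<open>Leaving out the correlation bounds the intensity by a product density of mass
    \<open>N^2\<close>, which gives the finiteness required by \<open>two_point\<close>.\<close>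
  have le: "pair_density N L p \<le> (real N)\<^sup>2 * (fs_density (fst p) * fs_density (snd p))" for p :: "(complex ^ 'n) \<times> (complex ^ 'n)"
  proof -
    have "pair_density N L p \<le> (real N)\<^sup>2 * fs_density (fst p) * fs_density (snd p) * 1"
      unfolding pair_density_def using fs_cos2_nonneg[of "fst p" "snd p"]
      by (intro mult_left_mono mult_nonneg_nonneg fs_density_nonneg) auto
    thus ?thesis by (simp add: mult_ac)
  qed
  have "(\<integral>\<^sup>+p. ennreal (pair_density N L p) \<partial>(lborel \<Otimes>\<^sub>M lborel :: ((complex ^ 'n) \<times> (complex ^ 'n)) measure)) \<le>
    (\<integral>\<^sup>+p. ennreal ((real N)\<^sup>2) * (ennreal (fs_density (fst p)) * ennreal (fs_density (snd p))) \<partial>(lborel \<Otimes>\<^sub>M lborel :: ((complex ^ 'n) \<times> (complex ^ 'n)) measure))"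
    by (intro nn_integral_mono) (use le in \<open>auto simp: ennreal_mult[symmetric] fs_density_nonneg intro!: ennreal_leI\<close>)
  also have "\<dots> = ennreal ((real N)\<^sup>2) * (\<integral>\<^sup>+p. ennreal (fs_density (fst p)) * ennreal (fs_density (snd p)) \<partial>(lborel \<Otimes>\<^sub>M lborel :: ((complex ^ 'n) \<times> (complex ^ 'n)) measure))"
    by (rule nn_integral_cmult) measurable
  also have "(\<integral>\<^sup>+p. ennreal (fs_density (fst p)) * ennreal (fs_density (snd p)) \<partial>(lborel \<Otimes>\<^sub>M lborel :: ((complex ^ 'n) \<times> (complex ^ 'n)) measure)) = 1"
    by (subst lborel.nn_integral_fst[symmetric]) (auto simp: nn_integral_cmult nn_integral_fs_density)
  finally show "(\<integral>\<^sup>+p. ennreal (pair_density N L p) \<partial>(lborel \<Otimes>\<^sub>M lborel :: ((complex ^ 'n) \<times> (complex ^ 'n)) measure)) < \<infinity>"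
    by (rule order.strict_trans1) simp
  fix A B :: "(complex ^ 'n) set"
  assume AB [measurable]: "A \<in> sets borel" "B \<in> sets borel" and dis: "A \<inter> B = {}"
  have ex: "\<exists>\<rho>. joint_intensity P lborel X k \<rho> \<and>
      (\<forall>x\<in>space (PiM {..<k} (\<lambda>_. lborel)). complex_of_real (\<rho> x) = kernel_det (fs_kernel L) k x)" if "k \<ge> 1" for k
    using det that unfolding determinantal_def by simp
  have "(1::nat) \<le> 2" by simp
  from ex[OF this] obtain \<rho> where \<rho>: "joint_intensity P lborel X 2 \<rho>"
    "\<forall>x\<in>space (PiM {..<2} (\<lambda>_. lborel)). complex_of_real (\<rho> x) = kernel_det (fs_kernel L) 2 x"
    by (elim exE conjE) (rule that)
  have r: "\<rho> x = pair_density N L (x 0, x 1)" if "x \<in> space (PiM {..<2} (\<lambda>_. lborel :: (complex ^ 'n) measure))" for x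
  proof -
    have "complex_of_real (\<rho> x) = of_real (pair_density N L (x 0, x 1))"
      using \<rho>(2) that unfolding kernel_det_2 fs_kernel_diag fs_kernel_prod N
      by (simp add: pair_density_def power2_eq_square algebra_simps)
    thus ?thesis by (simp only: of_real_eq_iff)
  qed
  define D where "D = (\<lambda>i::nat. if i = 0 then A else B)"
  have l2: "{..<2::nat} = {0, 1}" by auto
  have "(\<integral>\<^sup>+w. (\<Prod>i<2. num_points (X w) (D i)) \<partial>P) =
        (\<integral>\<^sup>+x. ennreal (\<rho> x) * indicator (Pi\<^sub>E {..<2} D) x \<partial>(PiM {..<2} (\<lambda>_. lborel)))"
    by (rule joint_intensityD[OF \<rho>(1)]) (use AB dis in \<open>auto simp: D_def disjoint_family_on_def\<close>)
  also have "\<dots> = (\<integral>\<^sup>+x. ennreal (pair_density N L (x 0, x 1)) * indicator (A \<times> B) (x 0, x 1) \<partial>(PiM {..<2::nat} (\<lambda>_. lborel)))"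
  proof (rule nn_integral_cong)
    fix x :: "nat \<Rightarrow> complex ^ 'n" assume x: "x \<in> space (PiM {..<2} (\<lambda>_. lborel))"
    have "x \<in> Pi\<^sub>E {..<2} D \<longleftrightarrow> (x 0, x 1) \<in> A \<times> B"
      using x by (auto simp: D_def space_PiM PiE_iff l2)
    thus "ennreal (\<rho> x) * indicator (Pi\<^sub>E {..<2} D) x = ennreal (pair_density N L (x 0, x 1)) * indicator (A \<times> B) (x 0, x 1)"
      by (simp add: r[OF x] indicator_def)
  qed
  also have "\<dots> = (\<integral>\<^sup>+p. ennreal (pair_density N L (fst p, snd p)) * indicator (A \<times> B) (fst p, snd p) \<partial>(lborel \<Otimes>\<^sub>M lborel))"
    by (rule nn_integral_PiM_2[of "\<lambda>x y. ennreal (pair_density N L (x, y)) * indicator (A \<times> B) (x, y)"]) (simp add: split_beta')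
  finally show "(\<integral>\<^sup>+w. num_points (X w) A * num_points (X w) B \<partial>P) =
    (\<integral>\<^sup>+p. ennreal (pair_density N L p) * indicator (A \<times> B) p \<partial>(lborel \<Otimes>\<^sub>M lborel))"
    by (simp add: D_def numeral_2_eq_2 lessThan_Suc mult.commute)
qed

text \<open>The one-point intensity has mass \<open>N\<close>, so the expected number of points is
  finite. This matters because \<open>riesz_energy\<close> is meaningful for finite configurations
  only.\<close>

lemma AE_finite_projection_dpp:
  fixes X :: "'w \<Rightarrow> (complex ^ 'n::finite) set"
  assumes X: "projection_dpp P lborel (weighted_polynomials L) X"
  shows "AE w in P. finite (X w)" and "(\<lambda>w. num_points (X w) UNIV) \<in> borel_measurable P"
proof -
  note det = projection_dpp_kernel[OF X]
  let ?N = "(CARD('n) + L) choose CARD('n)"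
  show m: "(\<lambda>w. num_points (X w) UNIV) \<in> borel_measurable P"
    using det unfolding determinantal_def point_process_def by auto
  have ex: "\<exists>\<rho>. joint_intensity P lborel X k \<rho> \<and>
      (\<forall>x\<in>space (PiM {..<k} (\<lambda>_. lborel)). complex_of_real (\<rho> x) = kernel_det (fs_kernel L) k x)" if "k \<ge> 1" for k
    using det that unfolding determinantal_def by simp
  have "(1::nat) \<le> 1" by simp
  from ex[OF this] obtain \<rho> where \<rho>: "joint_intensity P lborel X 1 \<rho>"
    "\<forall>x\<in>space (PiM {..<1} (\<lambda>_. lborel)). complex_of_real (\<rho> x) = kernel_det (fs_kernel L) 1 x"
    by (elim exE conjE) (rule that)
  have r: "\<rho> x = real ?N * fs_density (x 0)" if "x \<in> space (PiM {..<1} (\<lambda>_. lborel :: (complex ^ 'n) measure))" for x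
  proof -
    have "complex_of_real (\<rho> x) = of_real (real ?N * fs_density (x 0))"
      using \<rho>(2) that unfolding kernel_det_1 fs_kernel_diag by simp
    thus ?thesis by (simp only: of_real_eq_iff)
  qed
  interpret product_sigma_finite "\<lambda>_ :: nat. lborel :: (complex ^ 'n) measure" ..
  have l1: "{..<1::nat} = {0}" by auto
  have "(\<integral>\<^sup>+w. (\<Prod>i<1. num_points (X w) ((\<lambda>_::nat. UNIV) i)) \<partial>P) =
        (\<integral>\<^sup>+x. ennreal (\<rho> x) * indicator (Pi\<^sub>E {..<1} (\<lambda>_. UNIV)) x \<partial>(PiM {..<1} (\<lambda>_. lborel)))"
    by (rule joint_intensityD[OF \<rho>(1)]) (auto simp: disjoint_family_on_def)
  also have "\<dots> = (\<integral>\<^sup>+x. ennreal (real ?N) * ennreal (fs_density (x 0)) \<partial>(PiM {..<1::nat} (\<lambda>_. lborel :: (complex ^ 'n) measure)))"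
    by (rule nn_integral_cong) (auto simp: r space_PiM PiE_iff ennreal_mult' fs_density_nonneg ennreal_mult)
  also have "\<dots> = (\<integral>\<^sup>+z. ennreal (real ?N) * ennreal (fs_density z) \<partial>(lborel :: (complex ^ 'n) measure))"
    unfolding l1 by (rule product_nn_integral_singleton[of "\<lambda>z. ennreal (real ?N) * ennreal (fs_density z)"]) simp
  also have "\<dots> = ennreal (real ?N)" by (simp add: nn_integral_cmult nn_integral_fs_density)
  finally have "(\<integral>\<^sup>+w. num_points (X w) UNIV \<partial>P) \<noteq> \<infinity>" by (simp add: lessThan_Suc)
  from nn_integral_PInf_AE[OF m this] show "AE w in P. finite (X w)"
    by (rule AE_mp) (auto simp: num_points_def emeasure_count_space)
qed

lemma riesz_energy_image:
  assumes F: "inj F" and fin: "finite \<omega>"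
  shows "ennreal (riesz_energy s (F ` \<omega>)) = pair_sum \<omega> (\<lambda>p. ennreal (norm (F (fst p) - F (snd p)) powr (- s)))"
proof -
  have "riesz_energy s (F ` \<omega>) = (\<Sum>x\<in>\<omega>. \<Sum>y\<in>F ` \<omega> - {F x}. norm (F x - y) powr (- s))"
    unfolding riesz_energy_def by (subst sum.reindex) (use F in \<open>auto intro: inj_on_subset\<close>)
  also have "\<dots> = (\<Sum>x\<in>\<omega>. \<Sum>y\<in>\<omega> - {x}. norm (F x - F y) powr (- s))"
  proof (rule sum.cong)
    fix x
    have "F ` \<omega> - {F x} = F ` (\<omega> - {x})" using image_set_diff[OF F, of \<omega> "{x}"] by simp
    thus "(\<Sum>y\<in>F ` \<omega> - {F x}. norm (F x - y) powr (- s)) = (\<Sum>y\<in>\<omega> - {x}. norm (F x - F y) powr (- s))"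
      by (simp, subst sum.reindex) (use F in \<open>auto intro: inj_on_subset\<close>)
  qed simp
  finally show ?thesis
    unfolding pair_sum_finite[OF fin] by (simp add: sum_nonneg)
qed

section \<open>Energies as integrals over the sphere\<close>

definition sphere_potential :: "real \<Rightarrow> 'a::euclidean_space \<Rightarrow> ennreal" where
  "sphere_potential s p = (\<integral>\<^sup>+q. ennreal (norm (p - q) powr (- s)) \<partial>sphere_measure)"

lemma measurable_id_sphere [measurable]: "(\<lambda>u. u) \<in> borel_measurable (sphere_measure :: 'a::euclidean_space measure)"
  by (rule borel_measurable_sphere_measureI) simp

lemma borel_measurable_sphere_integral:
  fixes f :: "'b::euclidean_space \<Rightarrow> 'a::euclidean_space \<Rightarrow> ennreal"
  assumes [measurable]: "case_prod f \<in> borel_measurable (borel \<Otimes>\<^sub>M borel)"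
  shows "(\<lambda>p. \<integral>\<^sup>+q. f p q \<partial>sphere_measure) \<in> borel_measurable borel"
proof -
  interpret finite_measure "sphere_measure :: 'a measure" by (rule finite_measure_sphere_measure)
  have "(\<lambda>x. (fst x, snd x)) \<in> (borel \<Otimes>\<^sub>M (sphere_measure :: 'a measure)) \<rightarrow>\<^sub>M (borel \<Otimes>\<^sub>M borel :: ('b \<times> 'a) measure)"
    by (intro measurable_Pair) measurable
  from measurable_compose[OF this assms]
  have "case_prod f \<in> borel_measurable (borel \<Otimes>\<^sub>M (sphere_measure :: 'a measure))" by simp
  thus ?thesis by (rule borel_measurable_nn_integral)
qed

text \<open>Should the double integral diverge, both sides are 0: the Bochner integral by
  convention, and \<open>enn2real\<close> by its value at infinity.\<close>

lemma continuous_energy_nn_integral: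
  "continuous_energy TYPE('a::euclidean_space) s =
    1 / (sphere_vol TYPE('a))\<^sup>2 * enn2real (\<integral>\<^sup>+p. sphere_potential s p \<partial>(sphere_measure :: 'a measure))"
proof -
  let ?\<sigma> = "sphere_measure :: 'a measure"
  interpret finite_measure ?\<sigma> by (rule finite_measure_sphere_measure)
  have m: "(\<lambda>(p, q). norm (p - q) powr (- s)) \<in> borel_measurable (?\<sigma> \<Otimes>\<^sub>M ?\<sigma>)"
    by measurable
  have "(\<integral>(p, q). norm (p - q) powr (- s) \<partial>(?\<sigma> \<Otimes>\<^sub>M ?\<sigma>)) =
    enn2real (\<integral>\<^sup>+x. ennreal (case x of (p, q) \<Rightarrow> norm (p - q) powr (- s)) \<partial>(?\<sigma> \<Otimes>\<^sub>M ?\<sigma>))"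
    by (rule integral_eq_nn_integral[OF m]) auto
  also have "(\<integral>\<^sup>+x. ennreal (case x of (p, q) \<Rightarrow> norm (p - q) powr (- s)) \<partial>(?\<sigma> \<Otimes>\<^sub>M ?\<sigma>)) =
    (\<integral>\<^sup>+p. sphere_potential s p \<partial>?\<sigma>)"
    unfolding sphere_potential_def
    by (subst nn_integral_fst[symmetric]) (use m in \<open>auto simp: split_beta'\<close>)
  finally show ?thesis by (simp add: continuous_energy_def)
qed

lemma sphere_energy_finite:
  assumes d: "DIM('a::euclidean_space) = 2 * d" and s: "s < 2 * real d"
  shows "(\<integral>\<^sup>+p. sphere_potential s p \<partial>(sphere_measure :: ('a \<times> real) measure)) < \<infinity>"
proof -
  have "(\<integral>\<^sup>+p. sphere_potential s p \<partial>(sphere_measure :: ('a \<times> real) measure)) \<le>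
    (\<integral>\<^sup>+p. ennreal (sphere_vol TYPE('a) * (4 powr (real d - s / 2) / (2 * (real d - s / 2)))) \<partial>(sphere_measure :: ('a \<times> real) measure))"
    unfolding sphere_potential_def
    by (intro nn_integral_mono sphere_riesz_potential_finite[OF d _ s]) simp
  also have "\<dots> < \<infinity>"
    by (simp add: emeasure_sphere_vol ennreal_mult_less_top)
  finally show ?thesis .
qed

lemma nn_integral_to_sphere_pair:
  fixes f :: "(complex ^ 'n::finite) \<times> real \<Rightarrow> (complex ^ 'n) \<times> real \<Rightarrow> ennreal"
  assumes [measurable]: "case_prod f \<in> borel_measurable (borel \<Otimes>\<^sub>M borel)"
  shows "(\<integral>\<^sup>+p. ennreal (fs_density (fst p) * fs_density (snd p)) * f (to_sphere (fst p)) (to_sphere (snd p)) \<partial>(lborel \<Otimes>\<^sub>M lborel)) =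
    ennreal (1 / (sphere_vol TYPE((complex ^ 'n) \<times> real))\<^sup>2) * (\<integral>\<^sup>+p. \<integral>\<^sup>+q. f p q \<partial>sphere_measure \<partial>sphere_measure)"
proof -
  let ?V = "sphere_vol TYPE((complex ^ 'n) \<times> real)"
  have V: "?V > 0" by (rule sphere_vol_pos)
  have f1 [measurable]: "f p \<in> borel_measurable borel" for p
    using measurable_compose[OF measurable_Pair1' assms, of p] by simp
  have ts: "(to_sphere :: complex ^ 'n \<Rightarrow> _) \<in> borel_measurable lborel" by simp
  have [measurable]: "(\<lambda>p. f (to_sphere (fst p)) (to_sphere (snd p))) \<in> borel_measurable (lborel \<Otimes>\<^sub>M lborel)"
  proof -
    have "(\<lambda>p. (to_sphere (fst p), to_sphere (snd p))) \<in> (lborel \<Otimes>\<^sub>M lborel :: ((complex ^ 'n) \<times> (complex ^ 'n)) measure) \<rightarrow>\<^sub>M (borel \<Otimes>\<^sub>M borel)"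
      by (intro measurable_Pair measurable_compose[OF measurable_fst ts] measurable_compose[OF measurable_snd ts])
    from measurable_compose[OF this assms] show ?thesis by simp
  qed
  have m [measurable]: "(\<lambda>p. \<integral>\<^sup>+q. f p q \<partial>sphere_measure) \<in> borel_measurable borel"
    by (rule borel_measurable_sphere_integral[OF assms])
  have "(\<integral>\<^sup>+p. ennreal (fs_density (fst p) * fs_density (snd p)) * f (to_sphere (fst p)) (to_sphere (snd p)) \<partial>(lborel \<Otimes>\<^sub>M lborel)) =
    (\<integral>\<^sup>+z. \<integral>\<^sup>+w. ennreal (fs_density z * fs_density w) * f (to_sphere z) (to_sphere w) \<partial>lborel \<partial>lborel)"
    by (subst lborel.nn_integral_fst[symmetric]) auto
  also have "\<dots> = (\<integral>\<^sup>+z. ennreal (fs_density z) * (ennreal (1 / ?V) * (\<integral>\<^sup>+q. f (to_sphere z) q \<partial>sphere_measure)) \<partial>lborel)"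
  proof (rule nn_integral_cong)
    fix z :: "complex ^ 'n"
    have "(\<integral>\<^sup>+w. ennreal (fs_density z * fs_density w) * f (to_sphere z) (to_sphere w) \<partial>lborel) =
      (\<integral>\<^sup>+w. ennreal (fs_density z) * (ennreal (fs_density w) * f (to_sphere z) (to_sphere w)) \<partial>lborel)"
      by (intro nn_integral_cong) (simp add: ennreal_mult fs_density_nonneg mult.assoc)
    also have "\<dots> = ennreal (fs_density z) * (\<integral>\<^sup>+w. ennreal (fs_density w) * f (to_sphere z) (to_sphere w) \<partial>lborel)"
    proof (rule nn_integral_cmult)
      show "(\<lambda>w. ennreal (fs_density w) * f (to_sphere z) (to_sphere w)) \<in> borel_measurable lborel"
        by (rule borel_measurable_times_ennreal, simp, rule measurable_compose[OF ts f1])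
    qed
    also have "(\<integral>\<^sup>+w. ennreal (fs_density w) * f (to_sphere z) (to_sphere w) \<partial>lborel) = ennreal (1 / ?V) * (\<integral>\<^sup>+q. f (to_sphere z) q \<partial>sphere_measure)"
      by (rule to_sphere_law[OF f1])
    finally show "(\<integral>\<^sup>+w. ennreal (fs_density z * fs_density w) * f (to_sphere z) (to_sphere w) \<partial>lborel) =
      ennreal (fs_density z) * (ennreal (1 / ?V) * (\<integral>\<^sup>+q. f (to_sphere z) q \<partial>sphere_measure))" .
  qed
  also have "\<dots> = ennreal (1 / ?V) * (\<integral>\<^sup>+p. ennreal (1 / ?V) * (\<integral>\<^sup>+q. f p q \<partial>sphere_measure) \<partial>sphere_measure)"
    by (rule to_sphere_law[of "\<lambda>p. ennreal (1 / ?V) * (\<integral>\<^sup>+q. f p q \<partial>sphere_measure)"]) measurable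
  also have "\<dots> = ennreal (1 / ?V) * (ennreal (1 / ?V) * (\<integral>\<^sup>+p. \<integral>\<^sup>+q. f p q \<partial>sphere_measure \<partial>sphere_measure))"
    using borel_measurable_sphere_measureI[OF m] by (subst nn_integral_cmult) auto
  also have "\<dots> = ennreal (1 / ?V\<^sup>2) * (\<integral>\<^sup>+p. \<integral>\<^sup>+q. f p q \<partial>sphere_measure \<partial>sphere_measure)"
    using V by (simp add: mult.assoc[symmetric] ennreal_mult[symmetric] power2_eq_square)
  finally show ?thesis .
qed

text \<open>Connects the constant of the theorem with \<open>exp (-1) / 2\<close> from
  \<open>slice_tail_bound\<close>: its exponential is larger and its root is at most 1.\<close>

lemma tail_constant_bound:
  assumes "d \<ge> 1"
  shows "exp (-1) / 2 \<le> exp (- 1 + 1 / (2 * real d)) / (2 * sqrt (1 - 1 / (2 * real d)))"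
proof -
  have x: "0 < 1 / (2 * real d)" "1 / (2 * real d) < 1" using assms by (auto simp: field_simps)
  have s: "0 < sqrt (1 - 1 / (2 * real d))" "sqrt (1 - 1 / (2 * real d)) \<le> 1" using x by auto
  have "exp (-1) / 2 \<le> exp (- 1 + 1 / (2 * real d)) / (2 * 1)" using x by simp
  also have "\<dots> \<le> exp (- 1 + 1 / (2 * real d)) / (2 * sqrt (1 - 1 / (2 * real d)))"
    using s by (intro divide_left_mono mult_left_mono) auto
  finally show ?thesis .
qed

text \<open>Keeps the last factor of the bound nonnegative, so the sign of the whole bound is that
  of the power of \<open>b\<close>.\<close>

lemma tail_constant_le_1:
  assumes "d \<ge> 1"
  shows "exp (- 1 + 1 / (2 * real d)) / (2 * sqrt (1 - 1 / (2 * real d))) \<le> 1"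
proof -
  have x: "0 < 1 / (2 * real d)" "1 / (2 * real d) \<le> 1 / 2" using assms by (auto simp: field_simps)
  have "1 / 2 \<le> sqrt (1 - 1 / (2 * real d))"
  proof (rule real_le_rsqrt)
    have "(1 / 2)\<^sup>2 = (1 / 4 :: real)" by (simp add: power2_eq_square)
    thus "(1 / 2)\<^sup>2 \<le> 1 - 1 / (2 * real d)" using x(2) by linarith
  qed
  hence "1 \<le> 2 * sqrt (1 - 1 / (2 * real d))" by simp
  moreover have "exp (- 1 + 1 / (2 * real d)) \<le> 1" using x by simp
  ultimately have "exp (- 1 + 1 / (2 * real d)) \<le> 1 * (2 * sqrt (1 - 1 / (2 * real d)))" "0 < 2 * sqrt (1 - 1 / (2 * real d))"
    by linarith+
  thus ?thesis by (simp only: pos_divide_le_eq)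
qed

text \<open>If \<open>b ^ L \<le> 0\<close> the left-hand side is 0 in \<open>ennreal\<close>.
  Otherwise the condition on \<open>L\<close> forces \<open>b \<ge> 0\<close> or
  \<open>L = 0\<close>, and \<open>b \<le> fs_cos2\<close> can be raised to the power
  \<open>L\<close>. For even positive \<open>L\<close> and negative \<open>b\<close> the power would
  be positive and this step would not be available.\<close>

lemma correlation_energy_lower:
  fixes s \<tau> :: real
  defines "d \<equiv> CARD('n::finite)"
  defines "b \<equiv> 1 - \<tau>\<^sup>2 * ((1 + \<tau>\<^sup>2)\<^sup>2 / (1 - (1 / sqrt (real d) + \<tau>)\<^sup>2))"
  assumes s: "s < 2 * real d" and \<tau>: "0 < \<tau>" "\<tau> < 1 - 1 / sqrt (real d)"
    and L: "odd L \<or> L = 0 \<or> 0 \<le> b"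
  shows "ennreal (sphere_vol TYPE(complex ^ 'n) / ((2 * real d - s) * sphere_vol TYPE((complex ^ 'n) \<times> real))
      * (1 - \<tau>\<^sup>2 / 4) ^ (d - 1) * \<tau> powr (2 * real d - s) * b ^ L
      * (1 - exp (- 1 + 1 / (2 * real d)) / (2 * sqrt (1 - 1 / (2 * real d))))) \<le>
    (\<integral>\<^sup>+p. ennreal (fs_density (fst p) * fs_density (snd p)) *
      (ennreal (fs_cos2 (fst p) (snd p) ^ L) * ennreal (norm (to_sphere (fst p) - to_sphere (snd p)) powr (- s)))
      \<partial>(lborel \<Otimes>\<^sub>M lborel :: ((complex ^ 'n) \<times> (complex ^ 'n)) measure))"
    (is "ennreal ?low \<le> ?J")
proof -
  let ?V = "sphere_vol TYPE(complex ^ 'n)" and ?VS = "sphere_vol TYPE((complex ^ 'n) \<times> real)"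
  define \<epsilon> where "\<epsilon> = exp (- 1 + 1 / (2 * real d)) / (2 * sqrt (1 - 1 / (2 * real d)))"
  define a where "a = 1 / sqrt (real d)"
  define T where "T = a + \<tau>"
  define C where "C = ?V / (2 * real d - s) * (1 - \<tau>\<^sup>2 / 4) ^ (d - 1) * \<tau> powr (2 * real d - s)"
  have V: "?V > 0" "?VS > 0" by (rule sphere_vol_pos)+
  have d1: "d \<ge> 1" by (simp add: d_def)
  have a: "0 < a" using d1 by (simp add: a_def)
  have T: "0 \<le> T" "T < 1" using \<tau> a by (auto simp: T_def a_def)
  have \<tau>1: "\<tau> < 1" "a < 1" using T a \<tau> by (auto simp: T_def)
  \<comment> \<open>For \<open>d = 1\<close> the interval allowed for \<open>\<tau>\<close> is
    empty.\<close>
  have d2: "d \<ge> 2"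
  proof (rule ccontr)
    assume "\<not> d \<ge> 2"
    hence "d = 1" using d1 by simp
    thus False using \<tau>1(2) by (simp add: a_def)
  qed
  have dim: "DIM(complex ^ 'n) = 2 * d" by (simp add: d_def)
  have \<tau>2: "\<tau>\<^sup>2 \<le> 1" using \<tau> \<tau>1 by (intro power_le_one) auto
  have C: "C \<ge> 0" using V s \<tau>2 by (simp add: C_def)
  have low: "?low = C / ?VS * b ^ L * (1 - \<epsilon>)" by (simp add: C_def \<epsilon>_def)
  have \<epsilon>: "\<epsilon> \<le> 1" "exp (-1) / 2 \<le> \<epsilon>"
    unfolding \<epsilon>_def by (rule tail_constant_le_1[OF d1], rule tail_constant_bound[OF d1])
  show ?thesis
  proof (cases "b ^ L \<le> 0")
    case True
    hence "?low \<le> 0" unfolding low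
      using C V \<epsilon> by (intro mult_nonpos_nonneg mult_nonneg_nonpos divide_nonneg_nonneg) auto
    thus ?thesis by (simp only: ennreal_neg) simp
  next
    case False
    hence bL: "b ^ L > 0" by simp
    have b: "b \<ge> 0" if "L \<noteq> 0"
    proof (rule ccontr)
      assume neg: "\<not> b \<ge> 0"
      hence "odd L" using L that by auto
      hence "b ^ L < 0" using neg by (simp add: power_less_zero_eq)
      with bL show False by linarith
    qed
    have T2: "0 < 1 - T\<^sup>2" using one_minus_square_pos[of T] T by simp
    \<comment> \<open>The geometry gives the base \<open>1 - \<tau>^2 / (1 - T^2)\<close>; the
      factor \<open>(1 + \<tau>^2)^2 \<ge> 1\<close> in \<open>b\<close> only lowers it.\<close>
    have b_le: "b \<le> 1 - \<tau>\<^sup>2 / (1 - T\<^sup>2)"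
    proof -
      have "1 \<le> (1 + \<tau>\<^sup>2)\<^sup>2" by simp
      hence "1 / (1 - T\<^sup>2) \<le> (1 + \<tau>\<^sup>2)\<^sup>2 / (1 - T\<^sup>2)" using T2 by (intro divide_right_mono) auto
      hence "\<tau>\<^sup>2 * (1 / (1 - T\<^sup>2)) \<le> \<tau>\<^sup>2 * ((1 + \<tau>\<^sup>2)\<^sup>2 / (1 - T\<^sup>2))" by (intro mult_left_mono) auto
      thus ?thesis by (simp add: b_def T_def a_def)
    qed
    define g :: "(complex ^ 'n) \<times> real \<Rightarrow> (complex ^ 'n) \<times> real \<Rightarrow> ennreal" where
      "g = (\<lambda>p q. ennreal (b ^ L) * (indicator {..a} (snd p) * (ennreal (norm (p - q) powr (- s)) * indicator {..<\<tau>} (norm (p - q)))))"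
    have pointwise: "g (to_sphere z) (to_sphere w) \<le>
        ennreal (fs_cos2 z w ^ L) * ennreal (norm (to_sphere z - to_sphere w) powr (- s))"
      if zw: "z \<noteq> 0" "w \<noteq> 0" for z w
    proof (cases "snd (to_sphere z) \<le> a \<and> norm (to_sphere z - to_sphere w) < \<tau>")
      case True
      let ?D = "norm (to_sphere z - to_sphere w)"
      \<comment> \<open>Height is 1-Lipschitz, so \<open>T = a + \<tau>\<close> bounds the height of
        both points.\<close>
      have "snd (to_sphere w) \<le> snd (to_sphere z) + ?D"
      proof -
        have "\<bar>snd (to_sphere z - to_sphere w)\<bar> \<le> ?D"
          by (metis norm_snd_le prod.collapse real_norm_def)
        thus ?thesis by (simp add: abs_le_iff)
      qed
      hence hT: "snd (to_sphere z) \<le> T" "snd (to_sphere w) \<le> T" using True \<tau> by (auto simp: T_def)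
      have "b \<le> 1 - ?D\<^sup>2 / (1 - T\<^sup>2)"
      proof -
        have "?D\<^sup>2 \<le> \<tau>\<^sup>2" using True by (intro power_mono) auto
        hence "?D\<^sup>2 / (1 - T\<^sup>2) \<le> \<tau>\<^sup>2 / (1 - T\<^sup>2)" using T2 by (intro divide_right_mono) auto
        thus ?thesis using b_le by simp
      qed
      also have "\<dots> \<le> fs_cos2 z w" by (rule fs_cos2_lower[OF _ zw T hT]) (use d2 in \<open>simp add: d_def\<close>)
      finally have "b ^ L \<le> fs_cos2 z w ^ L" using b by (cases "L = 0") (auto intro: power_mono)
      thus ?thesis using True by (simp add: g_def mult_right_mono ennreal_leI)
    qed (auto simp: g_def)
    have ns: "(\<lambda>p :: ((complex ^ 'n) \<times> real) \<times> ((complex ^ 'n) \<times> real). snd (fst p)) \<in> borel_measurable (borel \<Otimes>\<^sub>M borel)"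
    proof -
      have "(snd :: (complex ^ 'n) \<times> real \<Rightarrow> real) \<in> borel_measurable borel"
        by (intro borel_measurable_continuous_onI continuous_intros)
      from measurable_compose[OF measurable_fst this] show ?thesis .
    qed
    note [measurable] = ns
    have gm: "case_prod g \<in> borel_measurable (borel \<Otimes>\<^sub>M borel)"
      unfolding g_def split_beta' by measurable
    have cap: "ennreal (C * (?V * slice_integral d a)) * ennreal (b ^ L) \<le> (\<integral>\<^sup>+p. \<integral>\<^sup>+q. g p q \<partial>sphere_measure \<partial>sphere_measure)"
    proof -
      have "ennreal (C * (?V * slice_integral d a)) = ennreal C * ennreal (?V * slice_integral d a)"
        using C V slice_integral_strict_mono[of "-1" a d] a \<tau>1 by (intro ennreal_mult) auto
      also have "ennreal (?V * slice_integral d a) = (\<integral>\<^sup>+p. indicator {..a} (snd p) \<partial>(sphere_measure :: ((complex ^ 'n) \<times> real) measure))"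
        by (rule sphere_measure_lower_cap[OF dim, symmetric]) (use a \<tau>1 in auto)
      finally have "ennreal (C * (?V * slice_integral d a)) * ennreal (b ^ L) =
        ennreal (b ^ L) * ennreal C * (\<integral>\<^sup>+p. indicator {..a} (snd p) \<partial>(sphere_measure :: ((complex ^ 'n) \<times> real) measure))"
        by (simp add: mult_ac)
      also have "\<dots> = (\<integral>\<^sup>+p. ennreal (b ^ L) * ennreal C * indicator {..a} (snd p) \<partial>(sphere_measure :: ((complex ^ 'n) \<times> real) measure))"
      proof (rule nn_integral_cmult[symmetric])
        have "(\<lambda>p :: (complex ^ 'n) \<times> real. indicator {..a} (snd p) :: ennreal) \<in> borel_measurable (borel \<Otimes>\<^sub>M borel)" by measurable
        thus "(\<lambda>p :: (complex ^ 'n) \<times> real. indicator {..a} (snd p) :: ennreal) \<in> borel_measurable sphere_measure"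
          by (intro borel_measurable_sphere_measureI) (simp add: borel_prod)
      qed
      also have "\<dots> \<le> (\<integral>\<^sup>+p. \<integral>\<^sup>+q. g p q \<partial>sphere_measure \<partial>sphere_measure)"
      proof (rule nn_integral_mono)
        fix p :: "(complex ^ 'n) \<times> real" assume "p \<in> space sphere_measure"
        hence p: "norm p = 1" by simp
        have "ennreal (b ^ L) * ennreal C * indicator {..a} (snd p) = (ennreal (b ^ L) * indicator {..a} (snd p)) * ennreal C"
          by (simp add: mult_ac)
        also have "\<dots> \<le> (ennreal (b ^ L) * indicator {..a} (snd p)) *
            (\<integral>\<^sup>+q. ennreal (norm (p - q) powr (- s)) * indicator {..<\<tau>} (norm (p - q)) \<partial>sphere_measure)"
          unfolding C_def using sphere_riesz_potential_cap[OF dim p s \<tau>(1)] \<tau>1 by (intro mult_left_mono) auto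
        also have "\<dots> = (\<integral>\<^sup>+q. g p q \<partial>sphere_measure)"
          unfolding g_def mult.assoc[symmetric]
          unfolding mult.assoc[of "ennreal (b ^ L) * indicator {..a} (snd p)"]
          by (rule nn_integral_cmult[symmetric], rule borel_measurable_sphere_measureI) measurable
        finally show "ennreal (b ^ L) * ennreal C * indicator {..a} (snd p) \<le> (\<integral>\<^sup>+q. g p q \<partial>sphere_measure)" .
      qed
      finally show ?thesis .
    qed
    have "ennreal ?low \<le> ennreal (1 / ?VS\<^sup>2) * (ennreal (C * (?V * slice_integral d a)) * ennreal (b ^ L))"
    proof -
      have W: "?VS = ?V * slice_integral d 1" by (rule sphere_vol_slice[OF dim])
      have sl: "slice_integral d 1 * (1 - \<epsilon>) \<le> slice_integral d a"
      proof -
        have "slice_integral d 1 - slice_integral d a \<le> slice_integral d 1 * (exp (-1) / 2)"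
          unfolding a_def by (rule slice_tail_bound[OF d2])
        also have "\<dots> \<le> slice_integral d 1 * \<epsilon>"
          using \<epsilon> slice_integral_1_pos[of d] by (intro mult_left_mono) auto
        finally show ?thesis by (simp add: right_diff_distrib)
      qed
      have "?low = (1 / ?VS\<^sup>2) * (C * (?V * (slice_integral d 1 * (1 - \<epsilon>)))) * b ^ L"
      proof -
        have k: "?V * (slice_integral d 1 * (1 - \<epsilon>)) = ?VS * (1 - \<epsilon>)" unfolding W by simp
        show ?thesis unfolding low k using V by (simp add: power2_eq_square)
      qed
      also have "\<dots> \<le> (1 / ?VS\<^sup>2) * (C * (?V * slice_integral d a)) * b ^ L"
        using bL C V sl by (intro mult_right_mono mult_left_mono) auto
      finally have "ennreal ?low \<le> ennreal ((1 / ?VS\<^sup>2) * (C * (?V * slice_integral d a)) * b ^ L)"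
        by (rule ennreal_leI)
      also have "\<dots> = ennreal (1 / ?VS\<^sup>2) * (ennreal (C * (?V * slice_integral d a)) * ennreal (b ^ L))"
        using bL C V slice_integral_strict_mono[of "-1" a d] a \<tau>1
        by (simp add: ennreal_mult[symmetric] mult.assoc)
      finally show ?thesis .
    qed
    also have "\<dots> \<le> ennreal (1 / ?VS\<^sup>2) * (\<integral>\<^sup>+p. \<integral>\<^sup>+q. g p q \<partial>sphere_measure \<partial>sphere_measure)"
      by (rule mult_left_mono[OF cap]) simp
    also have "\<dots> = (\<integral>\<^sup>+p. ennreal (fs_density (fst p) * fs_density (snd p)) * g (to_sphere (fst p)) (to_sphere (snd p)) \<partial>(lborel \<Otimes>\<^sub>M lborel))"
      by (rule nn_integral_to_sphere_pair[OF gm, symmetric])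
    also have "\<dots> \<le> ?J"
    proof (rule nn_integral_mono_AE)
      \<comment> \<open>The pointwise estimate concerns nonzero points; the pairs with a zero entry
        form a null set.\<close>
      have "AE p in lborel \<Otimes>\<^sub>M lborel :: ((complex ^ 'n) \<times> (complex ^ 'n)) measure. fst p \<noteq> 0 \<and> snd p \<noteq> 0"
      proof (rule lborel_pair.AE_pair_measure)
        show "{p \<in> space (lborel \<Otimes>\<^sub>M lborel :: ((complex ^ 'n) \<times> (complex ^ 'n)) measure). fst p \<noteq> 0 \<and> snd p \<noteq> 0} \<in> sets (lborel \<Otimes>\<^sub>M lborel)"
          by measurable
        show "AE x in lborel. AE y in lborel. fst (x :: complex ^ 'n, y :: complex ^ 'n) \<noteq> 0 \<and> snd (x, y) \<noteq> 0"
          using AE_lborel_singleton[of "0 :: complex ^ 'n"] by auto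
      qed
      thus "AE p in lborel \<Otimes>\<^sub>M lborel. ennreal (fs_density (fst p) * fs_density (snd p)) * g (to_sphere (fst p)) (to_sphere (snd p)) \<le>
        ennreal (fs_density (fst p) * fs_density (snd p)) *
      (ennreal (fs_cos2 (fst p) (snd p) ^ L) * ennreal (norm (to_sphere (fst p) - to_sphere (snd p)) powr (- s)))"
        by (rule AE_mp) (intro AE_I2 impI mult_left_mono pointwise; simp)
    qed
    finally show ?thesis .
  qed
qed

theorem theorem5p2:
  fixes P :: "'w measure"
    and X :: "'w \<Rightarrow> (complex ^ 'n::finite) set"
    and d L N :: nat
    and s \<tau> :: real
  assumes "d = CARD('n)"
    and "0 < s" and "s < 2 * real d"
    and "N = (d + L) choose d"
    and "projection_dpp P lborel (weighted_polynomials L) X"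
    and "0 < \<tau>" and "\<tau> < 1 - 1 / sqrt (real d)"
    and "odd L \<or> L = 0 \<or>
         0 \<le> 1 - \<tau>\<^sup>2 * ((1 + \<tau>\<^sup>2)\<^sup>2 / (1 - (1 / sqrt (real d) + \<tau>)\<^sup>2))"
  shows "integrable P (\<lambda>w. riesz_energy s (pushforward_process to_sphere X w)) \<and>
    prob_space.expectation P (\<lambda>w. riesz_energy s (pushforward_process to_sphere X w))
    \<le> (real N)\<^sup>2 * continuous_energy TYPE((complex ^ 'n) \<times> real) s
      - (real N)\<^sup>2 * sphere_vol TYPE(complex ^ 'n)
          / ((2 * real d - s) * sphere_vol TYPE((complex ^ 'n) \<times> real))
        * (1 - \<tau>\<^sup>2 / 4) ^ (d - 1)
        * \<tau> powr (2 * real d - s)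
        * (1 - \<tau>\<^sup>2 * ((1 + \<tau>\<^sup>2)\<^sup>2 / (1 - (1 / sqrt (real d) + \<tau>)\<^sup>2))) ^ L
        * (1 - exp (- 1 + 1 / (2 * real d)) / (2 * sqrt (1 - 1 / (2 * real d))))"
proof -
  let ?VS = "sphere_vol TYPE((complex ^ 'n) \<times> real)"
  note d = assms(1) and s = assms(3) and dpp = assms(5)
  interpret two_point P X "\<lambda>p. ennreal (pair_density N L p)"
    by (rule two_point_projection_dpp[OF dpp]) (simp add: assms(4) d)
  define low where "low = sphere_vol TYPE(complex ^ 'n) / ((2 * real d - s) * ?VS)
      * (1 - \<tau>\<^sup>2 / 4) ^ (d - 1) * \<tau> powr (2 * real d - s)
      * (1 - \<tau>\<^sup>2 * ((1 + \<tau>\<^sup>2)\<^sup>2 / (1 - (1 / sqrt (real d) + \<tau>)\<^sup>2))) ^ L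
      * (1 - exp (- 1 + 1 / (2 * real d)) / (2 * sqrt (1 - 1 / (2 * real d))))"
  define f :: "(complex ^ 'n) \<times> (complex ^ 'n) \<Rightarrow> ennreal" where
    "f = (\<lambda>p. ennreal (norm (to_sphere (fst p) - to_sphere (snd p)) powr (- s)))"
  define \<mu> :: "(complex ^ 'n) \<times> (complex ^ 'n) \<Rightarrow> real" where
    "\<mu> = (\<lambda>p. fs_density (fst p) * fs_density (snd p))"
  define c :: "(complex ^ 'n) \<times> (complex ^ 'n) \<Rightarrow> real" where "c = (\<lambda>p. fs_cos2 (fst p) (snd p) ^ L)"
  define e where "e = (\<lambda>w. riesz_energy s (pushforward_process to_sphere X w))"
  define Q where "Q = (\<lambda>w. pair_sum (X w) f)"
  let ?M = "lborel \<Otimes>\<^sub>M lborel :: ((complex ^ 'n) \<times> (complex ^ 'n)) measure"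
  have lp: "sets ?M = sets (borel \<Otimes>\<^sub>M borel)" by (rule sets_pair_measure_cong) auto
  have ts: "(\<lambda>p. to_sphere (fst p)) \<in> borel_measurable (borel \<Otimes>\<^sub>M borel :: ((complex ^ 'n) \<times> (complex ^ 'n)) measure)"
    "(\<lambda>p. to_sphere (snd p)) \<in> borel_measurable (borel \<Otimes>\<^sub>M borel :: ((complex ^ 'n) \<times> (complex ^ 'n)) measure)"
    by (rule measurable_compose[OF measurable_fst borel_measurable_to_sphere],
        rule measurable_compose[OF measurable_snd borel_measurable_to_sphere])
  note [measurable] = ts
  have f: "f \<in> borel_measurable (borel \<Otimes>\<^sub>M borel)" unfolding f_def by measurable
  have mc: "c \<in> borel_measurable (borel \<Otimes>\<^sub>M borel)" "\<mu> \<in> borel_measurable (borel \<Otimes>\<^sub>M borel)"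
    unfolding c_def \<mu>_def by measurable
  have [measurable]: "f \<in> borel_measurable ?M" "c \<in> borel_measurable ?M" "\<mu> \<in> borel_measurable ?M"
    using f mc unfolding measurable_cong_sets[OF lp refl] .
  have c01: "0 \<le> c p" "c p \<le> 1" for p
    unfolding c_def by (intro zero_le_power power_le_one fs_cos2_nonneg fs_cos2_le_1)+
  have \<mu>0: "0 \<le> \<mu> p" for p unfolding \<mu>_def by (intro mult_nonneg_nonneg fs_density_nonneg)
  have good: "Q \<in> borel_measurable P" "(\<integral>\<^sup>+w. Q w \<partial>P) = (\<integral>\<^sup>+p. ennreal (pair_density N L p) * f p \<partial>?M)"
    using good_measurable[OF f] unfolding good_def Q_def by auto
  \<comment> \<open>\<open>A\<close> is the total energy of the sphere, \<open>J\<close> the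
    correlation term and \<open>I\<close> the expected energy divided by \<open>N^2\<close>. They
    are related by \<open>I + J = A\<close>, and the subtraction is made in the reals once
    \<open>A\<close> is known to be finite.\<close>
  define I where "I = (\<integral>\<^sup>+p. ennreal (\<mu> p * (1 - c p)) * f p \<partial>?M)"
  define J where "J = (\<integral>\<^sup>+p. ennreal (\<mu> p) * (ennreal (c p) * f p) \<partial>?M)"
  define A where "A = ennreal (1 / ?VS\<^sup>2) * (\<integral>\<^sup>+p. sphere_potential s p \<partial>(sphere_measure :: ((complex ^ 'n) \<times> real) measure))"
  have EQ: "(\<integral>\<^sup>+w. Q w \<partial>P) = ennreal ((real N)\<^sup>2) * I"
  proof -
    have "pair_density N L p = (real N)\<^sup>2 * (\<mu> p * (1 - c p))" for p
      by (simp add: pair_density_def \<mu>_def c_def)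
    hence "(\<integral>\<^sup>+p. ennreal (pair_density N L p) * f p \<partial>?M) = (\<integral>\<^sup>+p. ennreal ((real N)\<^sup>2) * (ennreal (\<mu> p * (1 - c p)) * f p) \<partial>?M)"
      using \<mu>0 c01 by (intro nn_integral_cong) (simp add: ennreal_mult mult.assoc)
    thus ?thesis unfolding good(2) I_def by (simp add: nn_integral_cmult)
  qed
  have IJ: "I + J = A"
  proof -
    have "I + J = (\<integral>\<^sup>+p. ennreal (\<mu> p * (1 - c p)) * f p + ennreal (\<mu> p) * (ennreal (c p) * f p) \<partial>?M)"
      unfolding I_def J_def by (rule nn_integral_add[symmetric]) measurable
    also have "\<dots> = (\<integral>\<^sup>+p. ennreal (\<mu> p) * f p \<partial>?M)"
    proof (rule nn_integral_cong)
      fix p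
      have "ennreal (\<mu> p * (1 - c p)) + ennreal (\<mu> p) * ennreal (c p) = ennreal (\<mu> p * (1 - c p) + \<mu> p * c p)"
        using \<mu>0[of p] c01[of p] by (simp add: ennreal_mult[symmetric] ennreal_plus[symmetric] del: ennreal_plus)
      also have "\<mu> p * (1 - c p) + \<mu> p * c p = \<mu> p" by (simp add: algebra_simps)
      finally show "ennreal (\<mu> p * (1 - c p)) * f p + ennreal (\<mu> p) * (ennreal (c p) * f p) = ennreal (\<mu> p) * f p"
        by (metis distrib_right mult.assoc)
    qed
    also have "\<dots> = A"
      unfolding A_def sphere_potential_def \<mu>_def f_def
      by (rule nn_integral_to_sphere_pair[of "\<lambda>p q. ennreal (norm (p - q) powr (- s))"]) measurable
    finally show ?thesis .
  qed
  have Afin: "A < \<infinity>"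
    unfolding A_def using sphere_energy_finite[of d s, where 'a = "complex ^ 'n"] s d
    by (simp add: ennreal_mult_less_top)
  have Ifin: "I < \<infinity>" "J < \<infinity>" using Afin unfolding IJ[symmetric] by auto
  have Jlow: "ennreal low \<le> J"
    unfolding low_def J_def \<mu>_def c_def f_def d
    by (rule correlation_energy_lower) (use assms in auto)
  have Acont: "enn2real A = continuous_energy TYPE((complex ^ 'n) \<times> real) s"
    unfolding A_def continuous_energy_nn_integral by (simp add: enn2real_mult)
  have "low \<le> enn2real J"
    using Jlow Ifin(2) by (metis enn2real_nonneg ennreal_enn2real ennreal_le_iff infinity_ennreal_def)
  moreover have "enn2real A = enn2real I + enn2real J"
    using Ifin unfolding IJ[symmetric] by (intro enn2real_plus) auto
  ultimately have Ile: "enn2real I \<le> continuous_energy TYPE((complex ^ 'n) \<times> real) s - low"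
    using Acont by simp
  note fin = AE_finite_projection_dpp[OF dpp]
  have e_nonneg: "0 \<le> e w" for w by (simp add: e_def riesz_energy_def sum_nonneg)
  have eQ: "ennreal (e w) = Q w" if "finite (X w)" for w
    unfolding e_def Q_def f_def pushforward_process_def by (rule riesz_energy_image[OF inj_to_sphere that])
  \<comment> \<open>Finiteness holds only almost surely, and the energy of an infinite configuration
    is 0 as a sum over an infinite set. This case distinction expresses \<open>e\<close> everywhere
    through two measurable functions, \<open>Q\<close> and the number of points.\<close>
  have e_eq: "e w = (if num_points (X w) UNIV = \<infinity> then 0 else enn2real (Q w))" for w
  proof (cases "finite (X w)")
    case True
    thus ?thesis using eQ[OF True] e_nonneg[of w]
      by (auto simp: num_points_def emeasure_count_space_finite simp flip: eQ[OF True])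
  next
    case False
    hence "infinite (to_sphere ` X w)" using inj_to_sphere by (metis finite_imageD inj_on_subset subset_UNIV)
    hence "e w = 0" by (simp add: e_def riesz_energy_def pushforward_process_def)
    thus ?thesis using False by (simp add: num_points_def)
  qed
  have me: "e \<in> borel_measurable P"
  proof -
    have [measurable]: "Q \<in> borel_measurable P" "(\<lambda>w. num_points (X w) UNIV) \<in> borel_measurable P"
      using good(1) fin(2) by auto
    have "(\<lambda>w. if num_points (X w) UNIV = \<infinity> then 0 else enn2real (Q w)) \<in> borel_measurable P" by measurable
    thus ?thesis unfolding e_eq[abs_def] .
  qed
  have ne: "(\<integral>\<^sup>+w. ennreal (e w) \<partial>P) = ennreal ((real N)\<^sup>2) * I"
    unfolding EQ[symmetric] by (rule nn_integral_cong_AE, rule AE_mp[OF fin(1)]) (simp add: eQ)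
  have "integrable P e"
    by (rule integrableI_nonneg[OF me]) (use e_nonneg ne Ifin(1) in \<open>auto simp: ennreal_mult_less_top\<close>)
  moreover have "(\<integral>w. e w \<partial>P) = (real N)\<^sup>2 * enn2real I"
    by (subst integral_eq_nn_integral[OF me]) (use e_nonneg ne in \<open>auto simp: enn2real_mult\<close>)
  moreover have "(real N)\<^sup>2 * enn2real I \<le> (real N)\<^sup>2 * (continuous_energy TYPE((complex ^ 'n) \<times> real) s - low)"
    by (rule mult_left_mono[OF Ile]) simp
  ultimately show ?thesis
    unfolding e_def low_def by (simp add: right_diff_distrib mult.assoc)
qed

end
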